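(* Let $\Omega\subset X$ be a uniform domain with $X\setminus\Omega\neq\emptyset$, and suppose that $\Omega$ satisfies the measure doubling condition: there is $c_d>0$ such that $0<\mu(B(x,2r)\cap\Omega)\le c_d\,\mu(B(x,r)\cap\Omega)<\infty$ for every $x\in\overline\Omega$ and every $r>0$. Then for any given measure $\widetilde{\mathcal H}$ on $\partial\Omega$, the trace spaces of $N^{1,1}(\Omega)$ and $M^{1,1}(\Omega)$ with respect to $\widetilde{\mathcal H}$ are the same; that is, if a Banach function space $\mathbb Z(\partial\Omega,\widetilde{\mathcal H})$ is the trace space of $N^{1,1}(\Omega)$ with respect to $\widetilde{\mathcal H}$, then it is also the trace space of $M^{1,1}(\Omega)$ with respect to $\widetilde{\mathcal H}$, and vice versa.
   Context: Standing assumptions: $(X,d,\mu)$ is a complete metric space with a Borel regular outer measure $\mu$ that is doubling: there is $C_d\ge 1$ with $0<\mu(B(x,2r))\le C_d\,\mu(B(x,r))<\infty$ for all balls $B(x,r)=\{y\in X: d(x,y)<r\}$. $X$ supports a $(1,1)$-Poincaré inequality: there are $C_P>0$, $\lambda\ge 1$ such that for every ball $B(x,r)$, every $u\in L^1_{\mathrm{loc}}(X)$ and every upper gradient $g$ of $u$, $\frac{1}{\mu(B(x,r))}\int_{B(x,r)}|u-u_{B(x,r)}|\,d\mu\le C_P r\,\frac{1}{\mu(B(x,\lambda r))}\int_{B(x,\lambda r)}g\,d\mu$, where $u_B$ is the $\mu$-mean of $u$ over $B$. A curve is a rectifiable continuous map from a compact interval. A nonnegative Borel function $g$ is an upper gradient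 of $u$ if $|u(x)-u(y)|\le\int_\gamma g\,ds$ for all nonconstant curves $\gamma$ with end points $x,y$ (with $|u(x)-u(y)|:=\infty$ if $|u(x)|$ or $|u(y)|$ is infinite). A curve family $\Gamma$ has zero $1$-modulus if there is a nonnegative Borel $\rho\in L^1(X)$ with $\int_\gamma\rho\,ds=\infty$ for all $\gamma\in\Gamma$. A nonnegative $\mu$-measurable $g$ is a $1$-weak upper gradient of $u$ in $H\subset X$ if the upper gradient inequality holds for all curves in $H$ outside a family of zero $1$-modulus. $\|u\|_{N^{1,1}(H)}:=\|u\|_{L^1(H)}+\inf\|g\|_{L^1(H)}$ (infimum over $1$-weak upper gradients of $u$ in $H$), $N^{1,1}(H)=\{u:\|u\|_{N^{1,1}(H)}<\infty\}$. Hajłasz-Sobolev space: $M^{1,1}(\Omega)$ is the set of $u\in L^1(\Omega)$ for which there exist $0\le g\in L^1(\Omega)$ and a set $A\subset\Omega$ of $\mu$-measure zero such that $|u(x)-u(y)|\le d(x,y)(g(x)+g(y))$ for all $x,y\in\Omega\setminus A$; the norm is $\|u\|_{L^1(\Omega)}+\inf\|g\|_{L^1(\Omega)}$ over all such $g$. (As usual, functions in $M^{1,1}(\Omega)$ are regarded as functions in $N^{1,1}(\Omega)$ up to modification on a $\mu$-null set.) A domain $\Omega\subset X$ is uniform if there is $c_U\in(0,1]$ such that every pair of distinct points $x,y\in\Omega$ can be joined by a curve $\gamma:[0,\ell_\gamma]\to\Omega$ parametrized by arc-length with $\gamma(0)=x$, $\gamma(\ell_\gamma)=y$, $\ell_\gamma\le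 c_U^{-1}d(x,y)$ and $\mathrm{dist}(\gamma(t),X\setminus\Omega)\ge c_U\min\{t,\ell_\gamma-t\}$ for all $t\in[0,\ell_\gamma]$. Trace: for a $\mu$-measurable function $u$ on $\Omega$ and $x\in\partial\Omega$, a number $Tu(x)$ is the trace of $u$ at $x$ if $\lim_{r\to0^+}\frac{1}{\mu(B(x,r)\cap\Omega)}\int_{B(x,r)\cap\Omega}|u-Tu(x)|\,d\mu=0$. The function $u$ has a trace with respect to $\widetilde{\mathcal H}$ if $Tu(x)$ exists for $\widetilde{\mathcal H}$-a.e. $x\in\partial\Omega$. For a Banach function space $\mathbb X(\Omega)$ on $\Omega$, a Banach space $\mathbb Y(\partial\Omega,\widetilde{\mathcal H})$ of functions on $\partial\Omega$ is the trace space of $\mathbb X(\Omega)$ with respect to $\widetilde{\mathcal H}$ if every $u\in\mathbb X(\Omega)$ has a trace with respect to $\widetilde{\mathcal H}$ and the trace operator $u\mapsto Tu$ is a bounded linear surjective operator from $\mathbb X(\Omega)$ to $\mathbb Y(\partial\Omega,\widetilde{\mathcal H})$. *)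

theory Defs
  imports "HOL-Analysis.Analysis"
begin

section \<open>The ambient metric measure space\<close>

definition borel_regular_outer_measure :: "('a::metric_space set \<Rightarrow> ennreal) \<Rightarrow> bool" where
  "borel_regular_outer_measure \<mu> \<longleftrightarrow>
     outer_measure_space UNIV \<mu> \<and>
     sets borel \<subseteq> lambda_system UNIV UNIV \<mu> \<and>
     (\<forall>A. \<exists>B\<in>sets borel. A \<subseteq> B \<and> \<mu> B = \<mu> A)"

text \<open>Integration with respect to an outer measure means integration with respect to its
  restriction to the Caratheodory measurable sets.\<close>

definition caratheodory_measure :: "('a set \<Rightarrow> ennreal) \<Rightarrow> 'a measure" where
  "caratheodory_measure \<mu> = measure_of UNIV (lambda_system UNIV UNIV \<mu>) \<mu>"

definition doubling :: "('a::metric_space set \<Rightarrow> ennreal) \<Rightarrow> bool" where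
  "doubling \<mu> \<longleftrightarrow>
     (\<exists>C\<^sub>d::real. C\<^sub>d \<ge> 1 \<and> (\<forall>x r. r > 0 \<longrightarrow>
        0 < \<mu> (ball x (2 * r)) \<and>
        \<mu> (ball x (2 * r)) \<le> ennreal C\<^sub>d * \<mu> (ball x r) \<and>
        ennreal C\<^sub>d * \<mu> (ball x r) < \<infinity>))"

definition doubling_on :: "('a::metric_space set \<Rightarrow> ennreal) \<Rightarrow> 'a set \<Rightarrow> bool" where
  "doubling_on \<mu> \<Omega> \<longleftrightarrow>
     (\<exists>c\<^sub>d::real. c\<^sub>d > 0 \<and> (\<forall>x\<in>closure \<Omega>. \<forall>r>0.
        0 < \<mu> (ball x (2 * r) \<inter> \<Omega>) \<and>
        \<mu> (ball x (2 * r) \<inter> \<Omega>) \<le> ennreal c\<^sub>d * \<mu> (ball x r \<inter> \<Omega>) \<and>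
        ennreal c\<^sub>d * \<mu> (ball x r \<inter> \<Omega>) < \<infinity>))"


section \<open>Curves and line integrals\<close>

text \<open>A curve on the compact interval \<open>[a, b]\<close> is given by \<open>\<gamma>\<close>, \<open>a\<close> and \<open>b\<close>; values of \<open>\<gamma>\<close> off the
  interval are irrelevant. Lists \<open>p\<close> below are the finite partitions.\<close>

definition curve_length :: "(real \<Rightarrow> 'a::metric_space) \<Rightarrow> real \<Rightarrow> real \<Rightarrow> ennreal" where
  "curve_length \<gamma> a b =
     (SUP p\<in>{p. sorted p \<and> set p \<subseteq> {a..b}}.
        \<Sum>i<length p - 1. ennreal (dist (\<gamma> (p ! i)) (\<gamma> (p ! Suc i))))"

definition is_curve :: "(real \<Rightarrow> 'a::metric_space) \<Rightarrow> real \<Rightarrow> real \<Rightarrow> bool" where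
  "is_curve \<gamma> a b \<longleftrightarrow> a \<le> b \<and> continuous_on {a..b} \<gamma> \<and> curve_length \<gamma> a b < \<infinity>"

definition nonconstant_curve :: "(real \<Rightarrow> 'a::metric_space) \<Rightarrow> real \<Rightarrow> real \<Rightarrow> bool" where
  "nonconstant_curve \<gamma> a b \<longleftrightarrow> is_curve \<gamma> a b \<and> \<not> \<gamma> constant_on {a..b}"

text \<open>The point reached after arc length \<open>s\<close>. The choice of the parameter \<open>t\<close> is immaterial, since
  \<open>\<gamma>\<close> is constant on every interval on which the length function is constant.\<close>

definition arclength_param :: "(real \<Rightarrow> 'a::metric_space) \<Rightarrow> real \<Rightarrow> real \<Rightarrow> real \<Rightarrow> 'a" where
  "arclength_param \<gamma> a b s = \<gamma> (SOME t. t \<in> {a..b} \<and> curve_length \<gamma> a t = ennreal s)"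

definition curve_integral ::
    "('a::metric_space \<Rightarrow> ennreal) \<Rightarrow> (real \<Rightarrow> 'a) \<Rightarrow> real \<Rightarrow> real \<Rightarrow> ennreal" where
  "curve_integral g \<gamma> a b =
     (\<integral>\<^sup>+s\<in>{0..enn2real (curve_length \<gamma> a b)}. g (arclength_param \<gamma> a b s) \<partial>lebesgue)"


section \<open>Upper gradients and the Poincare inequality\<close>

definition ext_absdiff :: "ereal \<Rightarrow> ereal \<Rightarrow> ennreal" where
  "ext_absdiff p q = (if \<bar>p\<bar> = \<infinity> \<or> \<bar>q\<bar> = \<infinity> then \<infinity> else e2ennreal \<bar>p - q\<bar>)"

definition upper_gradient :: "('a::metric_space \<Rightarrow> ereal) \<Rightarrow> ('a \<Rightarrow> ennreal) \<Rightarrow> bool" where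
  "upper_gradient u g \<longleftrightarrow>
     g \<in> borel_measurable borel \<and>
     (\<forall>\<gamma> a b. nonconstant_curve \<gamma> a b \<longrightarrow>
        ext_absdiff (u (\<gamma> a)) (u (\<gamma> b)) \<le> curve_integral g \<gamma> a b)"

definition L1_norm :: "'a measure \<Rightarrow> 'a set \<Rightarrow> ('a \<Rightarrow> ereal) \<Rightarrow> ennreal" where
  "L1_norm M H u = (\<integral>\<^sup>+x\<in>H. e2ennreal \<bar>u x\<bar> \<partial>M)"

text \<open>Functions on \<open>H\<close> are total functions whose values off \<open>H\<close> are irrelevant.\<close>

definition L1 :: "'a measure \<Rightarrow> 'a set \<Rightarrow> ('a \<Rightarrow> ereal) set" where
  "L1 M H = {u. u \<in> borel_measurable (restrict_space M H) \<and> L1_norm M H u < \<infinity>}"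

definition L1_loc :: "'a::metric_space measure \<Rightarrow> ('a \<Rightarrow> ereal) set" where
  "L1_loc M = {u. \<forall>x. \<exists>r>0. u \<in> L1 M (ball x r)}"

text \<open>An integrable extended real function is finite almost everywhere, so \<^const>\<open>real_of_ereal\<close>
  changes it only on a null set.\<close>

definition mean_on :: "'a measure \<Rightarrow> 'a set \<Rightarrow> ('a \<Rightarrow> ereal) \<Rightarrow> real" where
  "mean_on M B u = (LINT y:B|M. real_of_ereal (u y)) / measure M B"

definition poincare_1_1 :: "'a::metric_space measure \<Rightarrow> bool" where
  "poincare_1_1 M \<longleftrightarrow>
     (\<exists>C\<^sub>P \<Lambda>. C\<^sub>P > 0 \<and> \<Lambda> \<ge> 1 \<and>
        (\<forall>x r u g. r > 0 \<longrightarrow> u \<in> L1_loc M \<longrightarrow> upper_gradient u g \<longrightarrow>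
           (\<integral>\<^sup>+y\<in>ball x r. ext_absdiff (u y) (ereal (mean_on M (ball x r) u)) \<partial>M)
               / emeasure M (ball x r)
           \<le> ennreal (C\<^sub>P * r) *
              ((\<integral>\<^sup>+y\<in>ball x (\<Lambda> * r). g y \<partial>M) / emeasure M (ball x (\<Lambda> * r)))))"


section \<open>The spaces \<open>N\<^sup>1\<^sup>,\<^sup>1\<close> and \<open>M\<^sup>1\<^sup>,\<^sup>1\<close>\<close>

definition zero_modulus ::
    "'a::metric_space measure \<Rightarrow> ((real \<Rightarrow> 'a) \<times> real \<times> real) set \<Rightarrow> bool" where
  "zero_modulus M \<Gamma> \<longleftrightarrow>
     (\<exists>\<rho>::'a \<Rightarrow> ennreal. \<rho> \<in> borel_measurable borel \<and> (\<integral>\<^sup>+x. \<rho> x \<partial>M) < \<infinity> \<and>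
        (\<forall>(\<gamma>, a, b)\<in>\<Gamma>. curve_integral \<rho> \<gamma> a b = \<infinity>))"

text \<open>For \<open>M\<close>-measurable \<open>g\<close> the integrand of the line integral can fail to be measurable only along
  a curve family of zero modulus, so it does not matter how the integral is read there.\<close>

definition weak_upper_gradient ::
    "'a::metric_space measure \<Rightarrow> 'a set \<Rightarrow> ('a \<Rightarrow> ereal) \<Rightarrow> ('a \<Rightarrow> ennreal) \<Rightarrow> bool" where
  "weak_upper_gradient M H u g \<longleftrightarrow>
     g \<in> borel_measurable (restrict_space M H) \<and>
     (\<exists>\<Gamma>. zero_modulus M \<Gamma> \<and>
        (\<forall>\<gamma> a b. nonconstant_curve \<gamma> a b \<longrightarrow> \<gamma> ` {a..b} \<subseteq> H \<longrightarrow> (\<gamma>, a, b) \<notin> \<Gamma> \<longrightarrow>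
           ext_absdiff (u (\<gamma> a)) (u (\<gamma> b)) \<le> curve_integral g \<gamma> a b))"

definition N11_norm :: "'a::metric_space measure \<Rightarrow> 'a set \<Rightarrow> ('a \<Rightarrow> ereal) \<Rightarrow> ennreal" where
  "N11_norm M H u =
     L1_norm M H u + (INF g\<in>{g. weak_upper_gradient M H u g}. \<integral>\<^sup>+x\<in>H. g x \<partial>M)"

definition N11 :: "'a::metric_space measure \<Rightarrow> 'a set \<Rightarrow> ('a \<Rightarrow> ereal) set" where
  "N11 M H = {u. u \<in> borel_measurable (restrict_space M H) \<and> N11_norm M H u < \<infinity>}"

definition hajlasz_gradient ::
    "'a::metric_space measure \<Rightarrow> 'a set \<Rightarrow> ('a \<Rightarrow> ereal) \<Rightarrow> ('a \<Rightarrow> ennreal) \<Rightarrow> bool" where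
  "hajlasz_gradient M \<Omega> u g \<longleftrightarrow>
     g \<in> borel_measurable (restrict_space M \<Omega>) \<and> (\<integral>\<^sup>+x\<in>\<Omega>. g x \<partial>M) < \<infinity> \<and>
     (\<exists>A. A \<subseteq> \<Omega> \<and> A \<in> null_sets M \<and>
        (\<forall>x\<in>\<Omega> - A. \<forall>y\<in>\<Omega> - A.
           ext_absdiff (u x) (u y) \<le> ennreal (dist x y) * (g x + g y)))"

definition M11 :: "'a::metric_space measure \<Rightarrow> 'a set \<Rightarrow> ('a \<Rightarrow> ereal) set" where
  "M11 M \<Omega> = {u \<in> L1 M \<Omega>. \<exists>g. hajlasz_gradient M \<Omega> u g}"

definition M11_norm :: "'a::metric_space measure \<Rightarrow> 'a set \<Rightarrow> ('a \<Rightarrow> ereal) \<Rightarrow> ennreal" where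
  "M11_norm M \<Omega> u =
     L1_norm M \<Omega> u + (INF g\<in>{g. hajlasz_gradient M \<Omega> u g}. \<integral>\<^sup>+x\<in>\<Omega>. g x \<partial>M)"


section \<open>Uniform domains\<close>

text \<open>The distance to the empty set is infinite, whereas \<^term>\<open>infdist x {}\<close> is \<open>0\<close>; hence the case
  distinction.\<close>

definition uniform_domain :: "'a::metric_space set \<Rightarrow> bool" where
  "uniform_domain \<Omega> \<longleftrightarrow>
     open \<Omega> \<and> connected \<Omega> \<and> \<Omega> \<noteq> {} \<and>
     (\<exists>c\<^sub>U::real. 0 < c\<^sub>U \<and> c\<^sub>U \<le> 1 \<and>
        (\<forall>x\<in>\<Omega>. \<forall>y\<in>\<Omega>. x \<noteq> y \<longrightarrow>
           (\<exists>\<gamma> l. is_curve \<gamma> 0 l \<and>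
              (\<forall>t\<in>{0..l}. curve_length \<gamma> 0 t = ennreal t) \<and>
              \<gamma> ` {0..l} \<subseteq> \<Omega> \<and> \<gamma> 0 = x \<and> \<gamma> l = y \<and>
              l \<le> inverse c\<^sub>U * dist x y \<and>
              (\<forall>t\<in>{0..l}. - \<Omega> = {} \<or> infdist (\<gamma> t) (- \<Omega>) \<ge> c\<^sub>U * min t (l - t)))))"


section \<open>Traces\<close>

definition is_trace_at ::
    "'a::metric_space measure \<Rightarrow> 'a set \<Rightarrow> ('a \<Rightarrow> ereal) \<Rightarrow> 'a \<Rightarrow> real \<Rightarrow> bool" where
  "is_trace_at M \<Omega> u x c \<longleftrightarrow>
     ((\<lambda>r. (\<integral>\<^sup>+y\<in>ball x r \<inter> \<Omega>. ext_absdiff (u y) (ereal c) \<partial>M) / emeasure M (ball x r \<inter> \<Omega>))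
        \<longlongrightarrow> 0) (at_right 0)"

definition has_trace ::
    "'a::metric_space measure \<Rightarrow> 'a set \<Rightarrow> 'a measure \<Rightarrow> ('a \<Rightarrow> ereal) \<Rightarrow> bool" where
  "has_trace M \<Omega> \<H> u \<longleftrightarrow> (AE x in \<H>. \<exists>c. is_trace_at M \<Omega> u x c)"

text \<open>Arbitrary at points where there is no trace.\<close>

definition trace_fun ::
    "'a::metric_space measure \<Rightarrow> 'a set \<Rightarrow> ('a \<Rightarrow> ereal) \<Rightarrow> 'a \<Rightarrow> real" where
  "trace_fun M \<Omega> u x = (THE c. is_trace_at M \<Omega> u x c)"

text \<open>A Banach space of functions on the space of \<open>\<H>\<close>. As traces are determined only \<open>\<H>\<close>-almost
  everywhere, its elements are equivalence classes modulo \<open>\<H>\<close>-a.e. equality; the set \<open>Z\<close> consists of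
  all representatives.\<close>

definition banach_function_space ::
    "'a measure \<Rightarrow> ('a \<Rightarrow> real) set \<Rightarrow> (('a \<Rightarrow> real) \<Rightarrow> real) \<Rightarrow> bool" where
  "banach_function_space \<H> Z nrm \<longleftrightarrow>
     (\<lambda>_. 0) \<in> Z \<and>
     (\<forall>f\<in>Z. \<forall>g\<in>Z. (\<lambda>x. f x + g x) \<in> Z) \<and>
     (\<forall>f\<in>Z. \<forall>c. (\<lambda>x. c * f x) \<in> Z) \<and>
     (\<forall>f\<in>Z. \<forall>g. (AE x in \<H>. f x = g x) \<longrightarrow> g \<in> Z \<and> nrm g = nrm f) \<and>
     (\<forall>f\<in>Z. nrm f \<ge> 0 \<and> (nrm f = 0 \<longleftrightarrow> (AE x in \<H>. f x = 0))) \<and>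
     (\<forall>f\<in>Z. \<forall>c. nrm (\<lambda>x. c * f x) = \<bar>c\<bar> * nrm f) \<and>
     (\<forall>f\<in>Z. \<forall>g\<in>Z. nrm (\<lambda>x. f x + g x) \<le> nrm f + nrm g) \<and>
     (\<forall>F::nat \<Rightarrow> 'a \<Rightarrow> real. (\<forall>n. F n \<in> Z) \<longrightarrow>
        (\<forall>e>0. \<exists>N. \<forall>m\<ge>N. \<forall>n\<ge>N. nrm (\<lambda>x. F m x - F n x) < e) \<longrightarrow>
        (\<exists>f\<in>Z. (\<lambda>n. nrm (\<lambda>x. F n x - f x)) \<longlonglongrightarrow> 0))"

text \<open>\<open>Y\<close>, with norm \<open>nY\<close>, is the trace space of \<open>X\<close>, with norm \<open>nX\<close>. The sum of extended real
  functions is meaningful only where they are finite, that is, almost everywhere; hence the form of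
  the linearity condition.\<close>

definition is_trace_space ::
    "'a::metric_space measure \<Rightarrow> 'a set \<Rightarrow> 'a measure \<Rightarrow>
     ('a \<Rightarrow> ereal) set \<Rightarrow> (('a \<Rightarrow> ereal) \<Rightarrow> ennreal) \<Rightarrow>
     ('a \<Rightarrow> real) set \<Rightarrow> (('a \<Rightarrow> real) \<Rightarrow> real) \<Rightarrow> bool" where
  "is_trace_space M \<Omega> \<H> X nX Y nY \<longleftrightarrow>
     (\<forall>u\<in>X. has_trace M \<Omega> \<H> u \<and> trace_fun M \<Omega> u \<in> Y) \<and>
     (\<forall>u\<in>X. \<forall>v\<in>X. \<forall>w\<in>X. \<forall>\<alpha> \<beta>::real.
        (AE x in M. x \<in> \<Omega> \<longrightarrow> w x = ereal \<alpha> * u x + ereal \<beta> * v x) \<longrightarrow>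
        (AE x in \<H>. trace_fun M \<Omega> w x = \<alpha> * trace_fun M \<Omega> u x + \<beta> * trace_fun M \<Omega> v x)) \<and>
     (\<exists>C::real. \<forall>u\<in>X. ennreal (nY (trace_fun M \<Omega> u)) \<le> ennreal C * nX u) \<and>
     (\<forall>f\<in>Y. \<exists>u\<in>X. AE x in \<H>. trace_fun M \<Omega> u x = f x)"

end

theory Submission
  imports Defs
begin

text \<open>Every function in \<open>M\<^sup>1\<^sup>,\<^sup>1\<close> has a representative in \<open>N\<^sup>1\<^sup>,\<^sup>1\<close>: if \<open>g\<close> is a Hajlasz gradient
  of \<open>u\<close>, chaining along points where \<open>g\<close> is below its average shows that \<open>4 g\<close> controls \<open>u\<close>
  between any two points of a curve at which \<open>g\<close> is finite, and \<open>u\<close> is then redefined where \<open>g\<close>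
  is infinite.

  Conversely, let \<open>v\<close> be the average of \<open>u \<in> N\<^sup>1\<^sup>,\<^sup>1\<close> over balls whose radius is a small multiple of
  the distance \<open>\<delta>\<close> to the complement of \<open>\<Omega>\<close>. By the Poincare inequality the Lipschitz constant of
  \<open>v\<close> near \<open>p\<close> is at most the average of the upper gradient \<open>G\<close> over a ball of radius comparable to
  \<open>\<delta> p\<close>. Points \<open>p\<close> in the half of a uniform curve that is closer to its end point \<open>x\<close> satisfy
  \<open>dist x p \<le> \<delta> p / c\<close>, so all these averages are bounded by the single function
  \<open>h x = \<integral> G z / \<mu> (ball z (\<delta> z))\<close>, the integral being over all \<open>z\<close> with \<open>dist z x < 2 / c * \<delta> z\<close>.
  Hence \<open>h\<close> is a Hajlasz gradient of \<open>v\<close>, and by Tonelli and doubling its integral is bounded by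
  that of \<open>G\<close>.

  At a boundary point \<open>x\<close> the mean of \<open>\<bar>u - v\<bar>\<close> over \<open>ball x r \<inter> \<Omega>\<close> is at most a multiple of
  \<open>r\<close> times the mean of \<open>G\<close> over \<open>ball x (2 * r) \<inter> \<Omega>\<close>. Covering the set of points where this does
  not tend to \<open>0\<close> by small balls and adding up bump functions yields a function in \<open>M\<^sup>1\<^sup>,\<^sup>1\<close> that
  tends to infinity there. So if all functions have traces almost everywhere, then \<open>u\<close> and \<open>v\<close>
  have the same trace almost everywhere, for whatever measure on the boundary.\<close>

section \<open>Length of curves and Lipschitz paths\<close>

text \<open>Two mismatches shape the constructions. The Poincare inequality speaks of functions and
  upper gradients on the whole space, while \<open>u\<close> and \<open>G\<close> live on \<Omega>.
  So \<open>u\<close> has to be cut off without spoiling its gradient on the ball that the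
  inequality sees, and this dictates the averaging radius \<open>\<epsilon> * \<delta> p\<close>
  with \<open>\<epsilon> = 1 / (16 * \<Lambda>)\<close>. And the boundary measure \<H> is arbitrary,
  so no exceptional set can be shown to be null by estimating its measure. All that is known of \<H>
  is that functions have traces \<H>-almost everywhere; smallness of a content of codimension one is
  therefore converted into a function that would violate this.

  Whitney coverings and partitions of unity are avoided. The balls
  \<open>ball w (a * \<delta> w)\<close>, with the weight \<open>1 / V w\<close> on their centres,
  cover each point of \<Omega> with total weight bounded from above and below, and Tonelli takes the
  place of summation over a covering.

  Norms are infima that need not be attained; hence the loss \<open>e\<close> in the smoothing,
  which can be sent to 0 because the constant does not depend on it.\<close>

definition chord_sum :: "(real \<Rightarrow> 'a::metric_space) \<Rightarrow> real list \<Rightarrow> ennreal" where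
  "chord_sum \<gamma> p = (\<Sum>i<length p - 1. ennreal (dist (\<gamma> (p ! i)) (\<gamma> (p ! Suc i))))"

lemma chord_sum_simps [simp]:
  "chord_sum \<gamma> [] = 0"
  "chord_sum \<gamma> [x] = 0"
  "chord_sum \<gamma> (x # y # p) = ennreal (dist (\<gamma> x) (\<gamma> y)) + chord_sum \<gamma> (y # p)"
  by (simp_all add: chord_sum_def sum.lessThan_Suc_shift del: sum.lessThan_Suc)

lemma curve_length_eq:
  "curve_length \<gamma> a b = (SUP p\<in>{p. sorted p \<and> set p \<subseteq> {a..b}}. chord_sum \<gamma> p)"
  by (simp add: curve_length_def chord_sum_def)

lemma chord_sum_le_curve_length:
  "sorted p \<Longrightarrow> set p \<subseteq> {a..b} \<Longrightarrow> chord_sum \<gamma> p \<le> curve_length \<gamma> a b"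
  unfolding curve_length_eq by (rule SUP_upper) auto

lemma curve_length_mono:
  "a' \<le> a \<Longrightarrow> b \<le> b' \<Longrightarrow> curve_length \<gamma> a b \<le> curve_length \<gamma> a' b'"
  unfolding curve_length_eq by (rule SUP_subset_mono) auto

text \<open>Only an inequality: the right-hand side also contains the edge from the last point of
  \<open>p\<close> to the first point of \<open>q\<close>.\<close>

lemma chord_sum_append: "chord_sum \<gamma> p + chord_sum \<gamma> q \<le> chord_sum \<gamma> (p @ q)"
proof (induction p rule: induct_list012)
  case 1
  then show ?case by simp
next
  case (2 x)
  then show ?case by (cases q) simp_all
next
  case (3 x y p)
  then show ?case by (simp add: add.assoc add_left_mono)
qed

lemma curve_length_superadd:
  assumes "a \<le> b" "b \<le> c"
  shows "curve_length \<gamma> a b + curve_length \<gamma> b c \<le> curve_length \<gamma> a c"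
proof -
  let ?P = "\<lambda>a b. {p::real list. sorted p \<and> set p \<subseteq> {a..b}}"
  have ne: "?P a b \<noteq> {}" "?P b c \<noteq> {}" by (auto intro!: exI[of _ "[]"])
  have "chord_sum \<gamma> p + chord_sum \<gamma> q \<le> curve_length \<gamma> a c"
    if "p \<in> ?P a b" "q \<in> ?P b c" for p q
    using that assms
    by (intro order_trans[OF chord_sum_append chord_sum_le_curve_length])
       (auto simp: sorted_append subset_iff intro: order_trans)
  then have "curve_length \<gamma> a b + chord_sum \<gamma> q \<le> curve_length \<gamma> a c" if "q \<in> ?P b c" for q
    using that unfolding curve_length_eq[of _ a b] ennreal_SUP_add_left[OF ne(1), symmetric]
    by (intro SUP_least)
  then show ?thesis
    unfolding curve_length_eq[of _ b c] ennreal_SUP_add_right[OF ne(2)]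
    by (intro SUP_least)
qed

text \<open>The partition is clamped at \<open>b\<close> from both sides. An edge on one side of
  \<open>b\<close> survives in one list and degenerates to length 0 in the other; an edge across
  \<open>b\<close> is estimated by the triangle inequality through \<open>\<gamma> b\<close>. This
  yields subadditivity of the length without refining partitions.\<close>

lemma chord_sum_split:
  assumes "sorted p"
  shows "chord_sum \<gamma> p \<le> chord_sum \<gamma> (map (min b) p) + chord_sum \<gamma> (map (max b) p)"
  using assms
proof (induction p rule: induct_list012)
  case (3 x y p)
  have "ennreal (dist (\<gamma> x) (\<gamma> y)) \<le>
      ennreal (dist (\<gamma> (min b x)) (\<gamma> (min b y))) + ennreal (dist (\<gamma> (max b x)) (\<gamma> (max b y)))"
    using 3(3) by (auto simp: min_def max_def dist_triangle simp flip: ennreal_plus intro!: ennreal_leI)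
  from add_mono[OF this 3(2)] 3(3) show ?case
    by (simp add: ac_simps)
qed simp_all

lemma curve_length_subadd:
  assumes "a \<le> b" "b \<le> c"
  shows "curve_length \<gamma> a c \<le> curve_length \<gamma> a b + curve_length \<gamma> b c"
  unfolding curve_length_eq[of _ a c]
proof (rule SUP_least)
  fix p assume "p \<in> {p. sorted p \<and> set p \<subseteq> {a..c}}"
  then have p: "sorted p" "set p \<subseteq> {a..c}" by auto
  have "sorted (map (min b) p)" "sorted (map (max b) p)"
    using p(1) by (auto simp: sorted_map intro: sorted_wrt_mono_rel[of p "(\<le>)"])
  moreover have "set (map (min b) p) \<subseteq> {a..b}" "set (map (max b) p) \<subseteq> {b..c}"
    using p(2) assms by auto
  ultimately show "chord_sum \<gamma> p \<le> curve_length \<gamma> a b + curve_length \<gamma> b c"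
    using chord_sum_split[OF p(1), of \<gamma> b]
    by (meson add_mono chord_sum_le_curve_length order_trans)
qed

lemma curve_length_add:
  assumes "a \<le> b" "b \<le> c"
  shows "curve_length \<gamma> a c = curve_length \<gamma> a b + curve_length \<gamma> b c"
  by (intro antisym curve_length_subadd curve_length_superadd assms)

lemma dist_le_curve_length:
  assumes "a \<le> b"
  shows "ennreal (dist (\<gamma> a) (\<gamma> b)) \<le> curve_length \<gamma> a b"
  using chord_sum_le_curve_length[of "[a, b]" a b \<gamma>] assms by simp

lemma curve_length_refl [simp]: "curve_length \<gamma> a a = 0"
proof -
  have "chord_sum \<gamma> p = 0" if "set p \<subseteq> {a}" for p
    using that by (induction p rule: induct_list012) auto
  then show ?thesis by (auto simp: curve_length_eq intro!: antisym SUP_least)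
qed

text \<open>A partition of \<open>{a..b}\<close> is moved into \<open>{a..t}\<close> by clamping it
  at \<open>t\<close>, and by continuity of \<gamma> its chord sum converges as \<open>t\<close>
  tends to \<open>b\<close>. A partition that nearly attains the length up to \<open>b\<close> thus
  certifies almost the same length up to \<open>t\<close>.\<close>

lemma chord_sum_min_tendsto:
  assumes "continuous_on {a..b} \<gamma>" "sorted p" "set p \<subseteq> {a..b}" "F \<le> at b within {a..b}"
  shows "((\<lambda>t. chord_sum \<gamma> (map (min t) p)) \<longlongrightarrow> chord_sum \<gamma> p) F"
proof -
  have *: "((\<lambda>t. \<gamma> (min t x)) \<longlongrightarrow> \<gamma> x) F" if x: "x \<in> {a..b}" for x
  proof -
    have "continuous_on {a..b} (\<lambda>t. \<gamma> (min t x))"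
      by (rule continuous_on_compose2[OF assms(1)]) (use x in \<open>auto intro!: continuous_intros\<close>)
    moreover have "b \<in> {a..b}" "min b x = x" using x by auto
    ultimately have "((\<lambda>t. \<gamma> (min t x)) \<longlongrightarrow> \<gamma> x) (at b within {a..b})"
      unfolding continuous_on_def by metis
    then show ?thesis using assms(4) by (auto intro: tendsto_mono)
  qed
  show ?thesis
    using assms(2,3)
    by (induction p rule: induct_list012) (auto intro!: tendsto_intros * tendsto_ennrealI)
qed

lemma chord_sum_max_tendsto:
  assumes "continuous_on {a..b} \<gamma>" "sorted p" "set p \<subseteq> {a..b}" "F \<le> at a within {a..b}"
  shows "((\<lambda>t. chord_sum \<gamma> (map (max t) p)) \<longlongrightarrow> chord_sum \<gamma> p) F"
proof -
  have *: "((\<lambda>t. \<gamma> (max t x)) \<longlongrightarrow> \<gamma> x) F" if x: "x \<in> {a..b}" for x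
  proof -
    have "continuous_on {a..b} (\<lambda>t. \<gamma> (max t x))"
      by (rule continuous_on_compose2[OF assms(1)]) (use x in \<open>auto intro!: continuous_intros\<close>)
    moreover have "a \<in> {a..b}" "max a x = x" using x by auto
    ultimately have "((\<lambda>t. \<gamma> (max t x)) \<longlongrightarrow> \<gamma> x) (at a within {a..b})"
      unfolding continuous_on_def by metis
    then show ?thesis using assms(4) by (auto intro: tendsto_mono)
  qed
  show ?thesis
    using assms(2,3)
    by (induction p rule: induct_list012) (auto intro!: tendsto_intros * tendsto_ennrealI)
qed

text \<open>Lower semicontinuity of the length in either end point, together with additivity, makes the
  length function continuous.\<close>

lemma curve_length_lsc_right:
  assumes "continuous_on {a..b} \<gamma>" "a < b" "c < curve_length \<gamma> a b"
  shows "\<forall>\<^sub>F t in at_left b. c < curve_length \<gamma> a t"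
proof -
  obtain p where p: "sorted p" "set p \<subseteq> {a..b}" "c < chord_sum \<gamma> p"
    using assms(3) unfolding curve_length_eq less_SUP_iff by auto
  have "at_left b \<le> at b within {a..b}"
    using assms(2) by (simp add: at_within_Icc_at_left)
  from order_tendstoD(1)[OF chord_sum_min_tendsto[OF assms(1) p(1,2) this] p(3)]
  have "\<forall>\<^sub>F t in at_left b. c < chord_sum \<gamma> (map (min t) p)" .
  moreover have "\<forall>\<^sub>F t in at_left b. a < t \<and> t < b"
    using eventually_at_left_field[of _ b] assms(2) by blast
  ultimately show ?thesis
  proof eventually_elim
    case (elim t)
    have "sorted (map (min t) p)"
      using p(1) by (auto simp: sorted_map intro: sorted_wrt_mono_rel[of p "(\<le>)"])
    moreover have "set (map (min t) p) \<subseteq> {a..t}" using p(2) elim by auto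
    ultimately show ?case using elim chord_sum_le_curve_length order_less_le_trans by blast
  qed
qed

lemma curve_length_lsc_left:
  assumes "continuous_on {a..b} \<gamma>" "a < b" "c < curve_length \<gamma> a b"
  shows "\<forall>\<^sub>F t in at_right a. c < curve_length \<gamma> t b"
proof -
  obtain p where p: "sorted p" "set p \<subseteq> {a..b}" "c < chord_sum \<gamma> p"
    using assms(3) unfolding curve_length_eq less_SUP_iff by auto
  have "at_right a \<le> at a within {a..b}"
    using assms(2) by (simp add: at_within_Icc_at_right)
  from order_tendstoD(1)[OF chord_sum_max_tendsto[OF assms(1) p(1,2) this] p(3)]
  have "\<forall>\<^sub>F t in at_right a. c < chord_sum \<gamma> (map (max t) p)" .
  moreover have "\<forall>\<^sub>F t in at_right a. a < t \<and> t < b"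
    using eventually_at_right_field[of _ a] assms(2) by blast
  ultimately show ?thesis
  proof eventually_elim
    case (elim t)
    have "sorted (map (max t) p)"
      using p(1) by (auto simp: sorted_map intro: sorted_wrt_mono_rel[of p "(\<le>)"])
    moreover have "set (map (max t) p) \<subseteq> {t..b}" using p(2) elim by auto
    ultimately show ?case using elim chord_sum_le_curve_length order_less_le_trans by blast
  qed
qed

text \<open>An intermediate value theorem for the length function. Let \<open>m\<close> be the
  supremum of the parameters with length at most \<open>s\<close>. If the length up to
  \<open>m\<close> exceeded \<open>s\<close>, semicontinuity in the right end point would make it
  exceed \<open>s\<close> already before \<open>m\<close>; if it fell short of \<open>s\<close>,
  semicontinuity of the tail in its left end point gives a contradiction.\<close>

lemma curve_length_attained:
  assumes "is_curve \<gamma> a b" "ennreal s \<le> curve_length \<gamma> a b"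
  shows "\<exists>t\<in>{a..b}. curve_length \<gamma> a t = ennreal s"
proof -
  have ab: "a \<le> b" and cont: "continuous_on {a..b} \<gamma>" and fin: "curve_length \<gamma> a b < \<infinity>"
    using assms(1) by (auto simp: is_curve_def)
  define T where "T = {t\<in>{a..b}. curve_length \<gamma> a t \<le> ennreal s}"
  define m where "m = Sup T"
  have aT: "a \<in> T" using ab by (auto simp: T_def)
  have bdd: "bdd_above T" by (auto simp: T_def intro: bdd_aboveI[of _ b])
  have mab: "m \<in> {a..b}"
    using aT bdd by (auto simp: m_def T_def intro!: cSup_upper cSup_least)
  have down: "curve_length \<gamma> a t \<le> ennreal s" if "t < m" "a \<le> t" for t
  proof -
    obtain t' where "t' \<in> T" "t < t'"
      using less_cSup_iff[OF _ bdd] aT \<open>t < m\<close> unfolding m_def by blast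
    then show ?thesis
      using curve_length_mono[of a a t t' \<gamma>] by (auto simp: T_def intro: order_trans)
  qed
  have up: "ennreal s < curve_length \<gamma> a t" if "m < t" "t \<le> b" for t
    using that cSup_upper[OF _ bdd, of t] mab unfolding m_def[symmetric]
    by (force simp: T_def not_le)
  have le: "curve_length \<gamma> a m \<le> ennreal s"
  proof (rule ccontr)
    assume "\<not> ?thesis"
    then have gt: "ennreal s < curve_length \<gamma> a m" by simp
    then have "a < m" using mab by (cases "a = m") auto
    moreover have "continuous_on {a..m} \<gamma>"
      using cont mab by (auto elim: continuous_on_subset)
    ultimately have "\<forall>\<^sub>F t in at_left m. ennreal s < curve_length \<gamma> a t"
      using gt by (intro curve_length_lsc_right)
    moreover have "\<forall>\<^sub>F t in at_left m. a < t \<and> t < m"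
      using eventually_at_left_field[of _ m] \<open>a < m\<close> by blast
    ultimately have "\<forall>\<^sub>F t in at_left m. False"
      by eventually_elim (use down in \<open>force simp: not_le[symmetric]\<close>)
    then show False by simp
  qed
  have "ennreal s \<le> curve_length \<gamma> a m"
  proof (rule ccontr)
    assume "\<not> ?thesis"
    then have lt: "curve_length \<gamma> a m < ennreal s" by simp
    then have "m < b" using mab assms(2) by (cases "m = b") auto
    have split: "curve_length \<gamma> a b = curve_length \<gamma> a t + curve_length \<gamma> t b" if "t \<in> {a..b}" for t
      using that by (intro curve_length_add) auto
    have fins: "curve_length \<gamma> a t < \<infinity>" "curve_length \<gamma> t b < \<infinity>" if "t \<in> {a..b}" for t
      using split[OF that] fin by (auto simp: less_top[symmetric])
    have "curve_length \<gamma> a b - ennreal s < curve_length \<gamma> m b"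
    proof -
      obtain p q where p: "curve_length \<gamma> a m = ennreal p" "0 \<le> p"
        and q: "curve_length \<gamma> m b = ennreal q" "0 \<le> q"
        using fins[OF mab] by (metis ennreal_cases infinity_ennreal_def less_irrefl)
      have "p < s" using lt p by (simp add: ennreal_less_iff)
      then have "0 \<le> s" using p by simp
      have "ennreal p + ennreal q - ennreal s = ennreal (p + q - s)" using \<open>0 \<le> s\<close>
        using p q by (simp add: ennreal_minus flip: ennreal_plus)
      then show ?thesis
        using assms(2) \<open>p < s\<close> \<open>0 \<le> s\<close> p q unfolding split[OF mab]
        by (simp add: ennreal_less_iff flip: ennreal_plus)
    qed
    \<comment> \<open>Just to the right of \<open>m\<close> the head is longer than
      \<open>s\<close>, while the tail is still longer than the total length minus \<open>s\<close>;
      together they exceed the total.\<close>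
    then have "\<forall>\<^sub>F t in at_right m. curve_length \<gamma> a b - ennreal s < curve_length \<gamma> t b"
      using \<open>m < b\<close> cont mab by (intro curve_length_lsc_left) (auto elim: continuous_on_subset)
    moreover have "\<forall>\<^sub>F t in at_right m. m < t \<and> t < b"
      using eventually_at_right_field[of _ m] \<open>m < b\<close> by blast
    ultimately have "\<forall>\<^sub>F t in at_right m. False"
    proof eventually_elim
      case (elim t)
      have t: "t \<in> {a..b}" using elim mab by auto
      have "curve_length \<gamma> a b = ennreal s + (curve_length \<gamma> a b - ennreal s)"
        using assms(2) by (simp add: add_diff_inverse_ennreal)
      also have "\<dots> < curve_length \<gamma> a t + curve_length \<gamma> t b"
        using up[of t] elim fins[OF t] by (intro add_strict_mono) auto
      finally show False using split[OF t] by simp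
    qed
    then show False by simp
  qed
  with le mab show ?thesis by (auto intro!: bexI[of _ m])
qed

lemma arclength_param_obtain:
  assumes "is_curve \<gamma> a b" "ennreal s \<le> curve_length \<gamma> a b"
  obtains t where "t \<in> {a..b}" "curve_length \<gamma> a t = ennreal s" "arclength_param \<gamma> a b s = \<gamma> t"
proof -
  have "\<exists>t. t \<in> {a..b} \<and> curve_length \<gamma> a t = ennreal s"
    using curve_length_attained[OF assms] by blast
  from someI_ex[OF this] show ?thesis
    using that unfolding arclength_param_def by blast
qed

text \<open>The distance is at most the length of the arc in between, which is the difference of the
  two arc lengths. The case \<open>p = q\<close> shows that parameters with the same arc length give
  the same point, so that the choice in \<open>arclength_param\<close> does no harm.\<close>

lemma dist_le_length_diff:
  assumes "s \<in> {a..b}" "t \<in> {a..b}" "0 \<le> p" "0 \<le> q"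
    and "curve_length \<gamma> a s = ennreal p" "curve_length \<gamma> a t = ennreal q"
  shows "dist (\<gamma> s) (\<gamma> t) \<le> \<bar>p - q\<bar>"
proof -
  have *: "dist (\<gamma> s) (\<gamma> t) \<le> q - p"
    if "s \<le> t" "s \<in> {a..b}" "0 \<le> p" "0 \<le> q"
      "curve_length \<gamma> a s = ennreal p" "curve_length \<gamma> a t = ennreal q" for s t p q
  proof -
    have "ennreal p + ennreal (dist (\<gamma> s) (\<gamma> t)) \<le> ennreal q"
      using curve_length_add[of a s t \<gamma>] dist_le_curve_length[of s t \<gamma>] that
      by (metis add_left_mono atLeastAtMost_iff)
    then show ?thesis using that by (simp flip: ennreal_plus)
  qed
  show ?thesis
    using *[of s t p q] *[of t s q p] assms by (cases "s \<le> t") (auto simp: dist_commute)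
qed


text \<open>Arc-length parametrizations are of this kind. Being 1-Lipschitz is checked directly
  under restriction, reversal and concatenation, the operations needed for the extension formula
  below, whereas unit speed would require computing lengths each time.\<close>

definition lip_path :: "(real \<Rightarrow> 'a::metric_space) \<Rightarrow> real \<Rightarrow> bool" where
  "lip_path \<sigma> l \<longleftrightarrow> 0 \<le> l \<and> (\<forall>s\<in>{0..l}. \<forall>t\<in>{0..l}. dist (\<sigma> s) (\<sigma> t) \<le> \<bar>s - t\<bar>)"

text \<open>Integration is over the parameter. For an arc-length parametrization this is the line
  integral; a path slower than unit speed is weighted by its duration instead of its length.\<close>

definition path_nn_integral :: "('a::metric_space \<Rightarrow> ennreal) \<Rightarrow> (real \<Rightarrow> 'a) \<Rightarrow> real \<Rightarrow> ennreal" where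
  "path_nn_integral g \<sigma> l = (\<integral>\<^sup>+s\<in>{0..l}. g (\<sigma> s) \<partial>lborel)"

lemma lip_pathD: "lip_path \<sigma> l \<Longrightarrow> s \<in> {0..l} \<Longrightarrow> t \<in> {0..l} \<Longrightarrow> dist (\<sigma> s) (\<sigma> t) \<le> \<bar>s - t\<bar>"
  by (simp add: lip_path_def)

lemma lip_path_continuous: "lip_path \<sigma> l \<Longrightarrow> continuous_on {0..l} \<sigma>"
  by (intro lipschitz_on_continuous_on[of 1] lipschitz_onI) (simp_all add: lip_path_def dist_real_def)

lemma lip_path_measurable:
  assumes "lip_path \<sigma> l" "g \<in> borel_measurable borel"
  shows "(\<lambda>s. (g (\<sigma> s)::ennreal) * indicator {0..l} s) \<in> borel_measurable borel"
proof -
  have "\<sigma> \<in> borel_measurable (restrict_space borel {0..l})"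
    by (intro borel_measurable_continuous_on_restrict lip_path_continuous assms)
  then have "(\<lambda>s. g (\<sigma> s)) \<in> borel_measurable (restrict_space borel {0..l})"
    using assms(2) by measurable
  then show ?thesis
    by (subst (asm) borel_measurable_restrict_space_iff_ennreal) auto
qed

lemma arclength_param_lip_path:
  assumes "is_curve \<gamma> a b"
  defines "l \<equiv> enn2real (curve_length \<gamma> a b)" and "\<sigma> \<equiv> arclength_param \<gamma> a b"
  shows "lip_path \<sigma> l" "\<sigma> 0 = \<gamma> a" "\<sigma> l = \<gamma> b" "\<sigma> ` {0..l} \<subseteq> \<gamma> ` {a..b}"
proof -
  have ab: "a \<le> b" and fin: "curve_length \<gamma> a b < \<infinity>"
    using assms(1) by (auto simp: is_curve_def)
  have len: "curve_length \<gamma> a b = ennreal l" using fin by (simp add: l_def)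
  have l0: "0 \<le> l" by (simp add: l_def)
  have *: "\<exists>t\<in>{a..b}. curve_length \<gamma> a t = ennreal s \<and> \<sigma> s = \<gamma> t" if "s \<in> {0..l}" for s
    using arclength_param_obtain[OF assms(1), of s] that len unfolding \<sigma>_def
    by (metis atLeastAtMost_iff ennreal_leI)
  show "\<sigma> ` {0..l} \<subseteq> \<gamma> ` {a..b}" using * by fastforce
  show "lip_path \<sigma> l" unfolding lip_path_def
  proof (intro conjI ballI l0)
    fix s t assume "s \<in> {0..l}" "t \<in> {0..l}"
    then show "dist (\<sigma> s) (\<sigma> t) \<le> \<bar>s - t\<bar>"
      using *[of s] *[of t] dist_le_length_diff[of _ a b _ s t \<gamma>] by auto
  qed
  obtain t where "t \<in> {a..b}" "curve_length \<gamma> a t = ennreal 0" "\<sigma> 0 = \<gamma> t" using *[of 0] l0 by auto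
  then show "\<sigma> 0 = \<gamma> a" using dist_le_length_diff[of t a b a 0 0 \<gamma>] by auto
  obtain t where "t \<in> {a..b}" "curve_length \<gamma> a t = ennreal l" "\<sigma> l = \<gamma> t" using *[of l] l0 by auto
  then show "\<sigma> l = \<gamma> b" using dist_le_length_diff[of t a b b l l \<gamma>] l0 len ab by auto
qed

text \<open>\<open>lebesgue\<close> is the completion of \<open>lborel\<close>, and integrals of
  nonnegative functions agree for the two.\<close>

lemma curve_integral_eq_path:
  "curve_integral g \<gamma> a b =
    path_nn_integral g (arclength_param \<gamma> a b) (enn2real (curve_length \<gamma> a b))"
  unfolding curve_integral_def path_nn_integral_def
  by (rule nn_integral_completion)

lemma nonconstant_curve_length_pos:
  assumes "nonconstant_curve \<gamma> a b"
  shows "0 < enn2real (curve_length \<gamma> a b)"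
proof (rule ccontr)
  have c: "is_curve \<gamma> a b" and nc: "\<not> \<gamma> constant_on {a..b}"
    using assms(1) by (auto simp: nonconstant_curve_def)
  assume "\<not> ?thesis"
  then have "enn2real (curve_length \<gamma> a b) = 0" by (simp add: order.antisym)
  then have "curve_length \<gamma> a b = 0"
    using c by (auto simp: is_curve_def enn2real_eq_0_iff)
  have "\<gamma> t = \<gamma> a" if "t \<in> {a..b}" for t
  proof -
    have "ennreal (dist (\<gamma> a) (\<gamma> t)) \<le> 0"
      using order_trans[OF dist_le_curve_length[of a t \<gamma>] curve_length_mono[of a a t b \<gamma>]] that
        \<open>curve_length \<gamma> a b = 0\<close> by simp
    then show ?thesis by simp
  qed
  then have "\<gamma> constant_on {a..b}" unfolding constant_on_def by blast
  then show False using nc by simp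
qed

lemma curve_integral_cmult:
  assumes "is_curve \<gamma> a b" "g \<in> borel_measurable borel"
  shows "curve_integral (\<lambda>x. c * g x) \<gamma> a b = c * curve_integral g \<gamma> a b"
proof -
  define l where "l = enn2real (curve_length \<gamma> a b)"
  define \<sigma> where "\<sigma> = arclength_param \<gamma> a b"
  have "curve_integral (\<lambda>x. c * g x) \<gamma> a b = (\<integral>\<^sup>+s. c * (g (\<sigma> s) * indicator {0..l} s) \<partial>lborel)"
    by (simp only: curve_integral_eq_path path_nn_integral_def l_def \<sigma>_def mult.assoc)
  also have "\<dots> = c * path_nn_integral g \<sigma> l" unfolding path_nn_integral_def
    using lip_path_measurable[OF arclength_param_lip_path(1)[OF assms(1)] assms(2)]
    by (intro nn_integral_cmult) (auto simp: l_def \<sigma>_def)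
  finally show ?thesis by (simp add: curve_integral_eq_path l_def \<sigma>_def)
qed

lemma lip_path_restrict:
  assumes "lip_path \<sigma> l" "0 \<le> s" "s \<le> l"
  shows "lip_path \<sigma> s" "path_nn_integral g \<sigma> s \<le> path_nn_integral g \<sigma> l"
  using assms unfolding lip_path_def path_nn_integral_def
  by (auto intro!: nn_integral_mono mult_left_mono simp: indicator_def)

lemma lip_path_reverse:
  assumes "lip_path \<sigma> l" "g \<in> borel_measurable borel"
  shows "lip_path (\<lambda>s. \<sigma> (l - s)) l"
    "path_nn_integral g (\<lambda>s. \<sigma> (l - s)) l = path_nn_integral g \<sigma> l"
proof -
  show "lip_path (\<lambda>s. \<sigma> (l - s)) l"
    unfolding lip_path_def
  proof (intro conjI ballI)
    show "dist (\<sigma> (l - s)) (\<sigma> (l - t)) \<le> \<bar>s - t\<bar>" if "s \<in> {0..l}" "t \<in> {0..l}" for s t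
      using lip_pathD[OF assms(1), of "l - s" "l - t"] that by auto
  qed (use assms(1) in \<open>simp add: lip_path_def\<close>)
  have "path_nn_integral g \<sigma> l = (\<integral>\<^sup>+s. g (\<sigma> (l - s)) * indicator {0..l} (l - s) \<partial>lborel)"
    unfolding path_nn_integral_def
    using nn_integral_real_affine[OF lip_path_measurable[OF assms], of "-1" l] by simp
  also have "\<dots> = path_nn_integral g (\<lambda>s. \<sigma> (l - s)) l"
    unfolding path_nn_integral_def
    by (intro nn_integral_cong) (auto simp: indicator_def)
  finally show "path_nn_integral g (\<lambda>s. \<sigma> (l - s)) l = path_nn_integral g \<sigma> l" ..
qed

lemma lip_path_join:
  assumes \<sigma>: "lip_path \<sigma> l" and \<tau>: "lip_path \<tau> m" and eq: "\<sigma> l = \<tau> 0"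
    and g: "g \<in> borel_measurable borel"
  defines "\<omega> \<equiv> \<lambda>s. if s \<le> l then \<sigma> s else \<tau> (s - l)"
  shows "lip_path \<omega> (l + m)" "\<omega> 0 = \<sigma> 0" "\<omega> (l + m) = \<tau> m"
    "\<omega> ` {0..l + m} \<subseteq> \<sigma> ` {0..l} \<union> \<tau> ` {0..m}"
    "path_nn_integral g \<omega> (l + m) \<le> path_nn_integral g \<sigma> l + path_nn_integral g \<tau> m"
proof -
  have l0: "0 \<le> l" and m0: "0 \<le> m" using \<sigma> \<tau> by (auto simp: lip_path_def)
  show "\<omega> 0 = \<sigma> 0" "\<omega> (l + m) = \<tau> m" using l0 m0 eq by (auto simp: \<omega>_def)
  show "\<omega> ` {0..l + m} \<subseteq> \<sigma> ` {0..l} \<union> \<tau> ` {0..m}" by (auto simp: \<omega>_def)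
  have *: "dist (\<omega> s) (\<omega> t) \<le> t - s" if "0 \<le> s" "s \<le> t" "t \<le> l + m" for s t
  proof -
    consider "t \<le> l" | "s > l" | "s \<le> l" "l < t" by linarith
    then show ?thesis
    proof cases
      case 1 then show ?thesis using lip_pathD[OF \<sigma>, of s t] that by (auto simp: \<omega>_def)
    next
      case 2 then show ?thesis using lip_pathD[OF \<tau>, of "s - l" "t - l"] that by (auto simp: \<omega>_def)
    next
      case 3
      have "dist (\<sigma> s) (\<sigma> l) \<le> l - s" "dist (\<tau> 0) (\<tau> (t - l)) \<le> t - l"
        using lip_pathD[OF \<sigma>, of s l] lip_pathD[OF \<tau>, of 0 "t - l"] that 3 l0 m0 by auto
      then show ?thesis using 3 eq dist_triangle[of "\<sigma> s" "\<tau> (t - l)" "\<sigma> l"] by (auto simp: \<omega>_def)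
    qed
  qed
  show "lip_path \<omega> (l + m)" unfolding lip_path_def
  proof (intro conjI ballI)
    fix s t assume "s \<in> {0..l + m}" "t \<in> {0..l + m}"
    then show "dist (\<omega> s) (\<omega> t) \<le> \<bar>s - t\<bar>"
      using *[of s t] *[of t s] by (cases "s \<le> t") (auto simp: dist_commute)
  qed (use l0 m0 in auto)
  note meas = lip_path_measurable[OF \<sigma> g] lip_path_measurable[OF \<tau> g]
  have meas2: "(\<lambda>s. g (\<tau> (s - l)) * indicator {0..m} (s - l)) \<in> borel_measurable borel"
    using measurable_compose[of "\<lambda>s. s - l" borel borel, OF _ meas(2)] by simp
  have "path_nn_integral g \<omega> (l + m) \<le>
      (\<integral>\<^sup>+s. g (\<sigma> s) * indicator {0..l} s + g (\<tau> (s - l)) * indicator {0..m} (s - l) \<partial>lborel)"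
    unfolding path_nn_integral_def
    by (intro nn_integral_mono) (auto simp: \<omega>_def indicator_def)
  also have "\<dots> = path_nn_integral g \<sigma> l + (\<integral>\<^sup>+s. g (\<tau> (s - l)) * indicator {0..m} (s - l) \<partial>lborel)"
    unfolding path_nn_integral_def using meas meas2 by (intro nn_integral_add) auto
  also have "(\<integral>\<^sup>+s. g (\<tau> (s - l)) * indicator {0..m} (s - l) \<partial>lborel) = path_nn_integral g \<tau> m"
    unfolding path_nn_integral_def
    using nn_integral_real_affine[OF meas(2), of 1 "- l"] by simp
  finally show "path_nn_integral g \<omega> (l + m) \<le> path_nn_integral g \<sigma> l + path_nn_integral g \<tau> m" .
qed

section \<open>Hajlasz gradients along paths\<close>

text \<open>If \<open>f\<close> exceeded its average at every point, its integral would exceed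
  itself; if the integral is infinite, any point will do. The intervals are half-open because the
  pieces to which this is applied have to be disjoint.\<close>

lemma exists_le_average:
  fixes f :: "real \<Rightarrow> ennreal"
  assumes "(\<lambda>s. f s * indicator {a..<b} s) \<in> borel_measurable borel" "a < b"
  shows "\<exists>s\<in>{a..<b}. ennreal (b - a) * f s \<le> (\<integral>\<^sup>+s\<in>{a..<b}. f s \<partial>lborel)"
proof (rule ccontr)
  let ?J = "\<integral>\<^sup>+s\<in>{a..<b}. f s \<partial>lborel"
  assume "\<not> ?thesis"
  then have gt: "?J < ennreal (b - a) * f s" if "s \<in> {a..<b}" for s
    using that by (auto simp: not_le)
  have fin: "?J < \<infinity>" using gt[of a] assms(2) by (auto simp: less_top[symmetric] top_unique)
  define c where "c = ?J * ennreal (1 / (b - a))"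
  have c: "c * ennreal (b - a) = ?J"
    unfolding c_def using assms(2) by (simp add: mult.assoc flip: ennreal_mult)
  have lt: "c < f s" if "s \<in> {a..<b}" for s
    using gt[OF that] c mult_right_mono[of "f s" c "ennreal (b - a)"] by (auto simp: not_le[symmetric] mult.commute)
  have eq: "(\<integral>\<^sup>+s. c * indicator {a..<b} s \<partial>lborel) = ?J"
    using c assms(2) by (simp add: nn_integral_cmult_indicator)
  have "(\<integral>\<^sup>+s. c * indicator {a..<b} s \<partial>lborel) < ?J"
  proof (rule nn_integral_less)
    show "(\<lambda>s. f s * indicator {a..<b} s) \<in> borel_measurable lborel" using assms(1) by simp
    show "(\<integral>\<^sup>+s. c * indicator {a..<b} s \<partial>lborel) \<noteq> \<infinity>" using fin eq by simp
    show "AE s in lborel. c * indicator {a..<b} s \<le> f s * indicator {a..<b} s"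
      using lt by (auto simp: indicator_def less_imp_le)
    show "\<not> (AE s in lborel. f s * indicator {a..<b} s \<le> c * indicator {a..<b} s)"
    proof
      assume "AE s in lborel. f s * indicator {a..<b} s \<le> c * indicator {a..<b} s"
      then have "AE s in lborel. s \<notin> {a..<b}"
        by eventually_elim (use lt in \<open>force simp: indicator_def not_le[symmetric] split: if_splits\<close>)
      then have "emeasure lborel {a..<b} = 0"
        by (subst (asm) AE_iff_measurable[of "{a..<b}"]) auto
      then show False using assms(2) by simp
    qed
  qed simp
  with eq show False by simp
qed

text \<open>The exceptional null set of a Hajlasz gradient is coded into \<open>g\<close> by the
  value \<infinity>, so the inequality is available at all points where \<open>g\<close> is finite.
  A Borel \<open>g\<close> is measurable along every path.\<close>

locale hajlasz_pair =
  fixes \<Omega> :: "'a::metric_space set" and f :: "'a \<Rightarrow> real" and g :: "'a \<Rightarrow> ennreal"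
  assumes g_borel: "g \<in> borel_measurable borel"
    and hajlasz: "\<And>x y. x \<in> \<Omega> \<Longrightarrow> y \<in> \<Omega> \<Longrightarrow> g x < \<infinity> \<Longrightarrow> g y < \<infinity> \<Longrightarrow>
      ennreal \<bar>f x - f y\<bar> \<le> ennreal (dist x y) * (g x + g y)"
begin

text \<open>Cut the path into pieces of length \<open>h\<close> and hop along points at which \<open>g\<close> is at most its average
  over the piece; only the two end points need not be of this kind, and they contribute \<open>O(h)\<close>.\<close>

lemma path_chain:
  assumes \<sigma>: "lip_path \<sigma> l" and sub: "\<sigma> ` {0..l} \<subseteq> \<Omega>"
    and fin: "path_nn_integral g \<sigma> l < \<infinity>" "g (\<sigma> 0) < \<infinity>" "g (\<sigma> l) < \<infinity>"
  shows "ennreal \<bar>f (\<sigma> 0) - f (\<sigma> l)\<bar> \<le> 4 * path_nn_integral g \<sigma> l"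
proof (cases "l = 0")
  case True
  then show ?thesis by simp
next
  case False
  then have l: "0 < l" using \<sigma> by (auto simp: lip_path_def)
  let ?I = "path_nn_integral g \<sigma> l"
  let ?K = "g (\<sigma> 0) + g (\<sigma> l)"
  have step: "ennreal \<bar>f (\<sigma> 0) - f (\<sigma> l)\<bar> \<le> 4 * ?I + ennreal (l / real (Suc n)) * ?K" for n
  proof -
    define h where "h = l / real (Suc n)"
    have h: "0 < h" "real (Suc n) * h = l" using l by (auto simp: h_def)
    define A where "A i = {real i * h..<real i * h + h}" for i
    have Asets: "A i \<in> sets borel" for i by (simp add: A_def)
    define J where "J i = (\<integral>\<^sup>+s\<in>A i. g (\<sigma> s) \<partial>lborel)" for i
    \<comment> \<open>The weighted measure turns the sum of the integrals over the disjoint pieces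
      into the measure of their union.\<close>
    define \<nu> where "\<nu> = density lborel (\<lambda>s. g (\<sigma> s) * indicator {0..l} s)"
    note meas = lip_path_measurable[OF \<sigma> g_borel]
    have Asub: "A i \<subseteq> {0..l}" if "i < Suc n" for i
    proof -
      have "(real i + 1) * h \<le> real (Suc n) * h" using that h(1) by (intro mult_right_mono) auto
      then have "real i * h + h \<le> l" unfolding h(2) by (simp add: distrib_right)
      moreover have "0 \<le> real i * h" using h(1) by simp
      ultimately show ?thesis unfolding A_def
        by (meson atLeastAtMost_iff atLeastLessThan_iff less_imp_le order_trans subsetI)
    qed
    have \<nu>A: "emeasure \<nu> (A i) = J i" if "i < Suc n" for i
    proof -
      have "emeasure \<nu> (A i) = (\<integral>\<^sup>+s. g (\<sigma> s) * indicator {0..l} s * indicator (A i) s \<partial>lborel)"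
        unfolding \<nu>_def using meas by (subst emeasure_density) (auto simp: A_def)
      also have "\<dots> = J i" unfolding J_def
        using Asub[OF that] by (intro nn_integral_cong) (auto simp: indicator_def)
      finally show ?thesis .
    qed
    have disj: "disjoint_family_on A {..<Suc n}"
    proof (unfold disjoint_family_on_def, intro ballI impI)
      have *: "A i \<inter> A j = {}" if "i < j" for i j
      proof -
        have "(real i + 1) * h \<le> real j * h" using that h(1) by (intro mult_right_mono) auto
        then show ?thesis by (auto simp: A_def algebra_simps)
      qed
      show "A i \<inter> A j = {}" if "i \<noteq> j" for i j
        using *[of i j] *[of j i] that by (cases "i < j") auto
    qed
    have sumJ: "(\<Sum>i<Suc n. J i) \<le> ?I"
    proof -
      have "(\<Sum>i<Suc n. J i) = (\<Sum>i<Suc n. emeasure \<nu> (A i))" using \<nu>A by simp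
      also have "\<dots> = emeasure \<nu> (\<Union>i<Suc n. A i)"
        using disj Asets by (intro sum_emeasure) (auto simp: \<nu>_def)
      also have "\<dots> \<le> emeasure \<nu> {0..l}"
        using Asub by (intro emeasure_mono) (auto simp: \<nu>_def)
      also have "\<dots> = (\<integral>\<^sup>+s. g (\<sigma> s) * indicator {0..l} s * indicator {0..l} s \<partial>lborel)"
        unfolding \<nu>_def using meas by (subst emeasure_density) auto
      also have "\<dots> = ?I" unfolding path_nn_integral_def
        by (intro nn_integral_cong) (auto simp: indicator_def)
      finally show ?thesis .
    qed
    have "\<exists>s. s \<in> A i \<and> ennreal h * g (\<sigma> s) \<le> J i" if "i < Suc n" for i
    proof -
      have "(\<lambda>s. g (\<sigma> s) * indicator (A i) s) = (\<lambda>s. g (\<sigma> s) * indicator {0..l} s * indicator (A i) s)"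
        using Asub[OF that] by (auto simp: indicator_def fun_eq_iff)
      then have "(\<lambda>s. g (\<sigma> s) * indicator (A i) s) \<in> borel_measurable borel"
        using meas by (simp add: A_def)
      from exists_le_average[OF this[unfolded A_def]] h show ?thesis
        unfolding A_def J_def by auto
    qed
    then obtain s where s: "\<And>i. i < Suc n \<Longrightarrow> s i \<in> A i"
      "\<And>i. i < Suc n \<Longrightarrow> ennreal h * g (\<sigma> (s i)) \<le> J i" by metis
    have J_fin: "J i < \<infinity>" if "i < Suc n" for i
    proof -
      have "J i \<le> (\<Sum>i<Suc n. J i)" using that by (intro member_le_sum) auto
      then show ?thesis using sumJ fin(1) by (meson order_le_less_trans)
    qed
    have g_fin: "g (\<sigma> (s i)) < \<infinity>" if "i < Suc n" for i
    proof -
      have "ennreal h * g (\<sigma> (s i)) < \<infinity>" using s(2)[OF that] J_fin[OF that] by (rule order_le_less_trans)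
      then show ?thesis using h(1) by (auto simp: ennreal_mult_less_top)
    qed
    \<comment> \<open>The Hajlasz inequality for parameters at distance at most
      \<open>k * h\<close>. It is applied with \<open>k = 1\<close> between an end point and a point
      of its own piece, and with \<open>k = 2\<close> between points of neighbouring pieces.\<close>
    have hop: "ennreal \<bar>f (\<sigma> p) - f (\<sigma> q)\<bar> \<le> c * (ennreal h * g (\<sigma> p)) + c * (ennreal h * g (\<sigma> q))"
      if "p \<in> {0..l}" "q \<in> {0..l}" "\<bar>p - q\<bar> \<le> real k * h" "g (\<sigma> p) < \<infinity>" "g (\<sigma> q) < \<infinity>"
        "c = ennreal (real k)" for p q k c
    proof -
      have "dist (\<sigma> p) (\<sigma> q) \<le> real k * h" using lip_pathD[OF \<sigma> that(1,2)] that(3) by linarith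
      then have "ennreal (dist (\<sigma> p) (\<sigma> q)) \<le> c * ennreal h"
        using h(1) by (simp add: that(6) ennreal_leI flip: ennreal_mult)
      then have "ennreal (dist (\<sigma> p) (\<sigma> q)) * (g (\<sigma> p) + g (\<sigma> q)) \<le> c * ennreal h * (g (\<sigma> p) + g (\<sigma> q))"
        by (intro mult_right_mono) auto
      moreover have "\<sigma> p \<in> \<Omega>" "\<sigma> q \<in> \<Omega>" using that(1,2) sub by auto
      ultimately show ?thesis
        using hajlasz[of "\<sigma> p" "\<sigma> q"] that(4,5) by (simp add: distrib_left mult.assoc)
    qed
    have tri: "ennreal \<bar>x - z\<bar> \<le> ennreal \<bar>x - y\<bar> + ennreal \<bar>y - z\<bar>" for x y z :: real
      by (simp flip: ennreal_plus add: ennreal_leI)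
    \<comment> \<open>Each chosen point takes part in two hops, each contributing at most
      \<open>2 * J i\<close>, which is the origin of the factor 4. The summand
      \<open>2 * J k\<close> is the share of the hop arriving at \<open>s k\<close>; the next hop
      supplies the other half.\<close>
    have ind: "ennreal \<bar>f (\<sigma> 0) - f (\<sigma> (s k))\<bar> \<le>
        ennreal h * g (\<sigma> 0) + 4 * (\<Sum>i<k. J i) + 2 * J k" if "k < Suc n" for k
      using that
    proof (induction k)
      case 0
      have "ennreal \<bar>f (\<sigma> 0) - f (\<sigma> (s 0))\<bar> \<le> 1 * (ennreal h * g (\<sigma> 0)) + 1 * (ennreal h * g (\<sigma> (s 0)))"
        using s(1)[of 0] Asub[of 0] l fin(2) g_fin[of 0] by (intro hop[of _ _ 1]) (auto simp: A_def)
      also have "\<dots> \<le> ennreal h * g (\<sigma> 0) + (J 0 + J 0)"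
        using s(2)[of 0] by (auto intro!: add_left_mono intro: add_increasing)
      finally show ?case by (simp flip: mult_2)
    next
      case (Suc k)
      have "ennreal \<bar>f (\<sigma> (s k)) - f (\<sigma> (s (Suc k)))\<bar> \<le>
          2 * (ennreal h * g (\<sigma> (s k))) + 2 * (ennreal h * g (\<sigma> (s (Suc k))))"
        using s(1)[of k] s(1)[of "Suc k"] Asub[of k] Asub[of "Suc k"] Suc.prems g_fin[of k] g_fin[of "Suc k"]
        by (intro hop[of _ _ 2]) (auto simp: A_def algebra_simps subset_iff)
      also have "\<dots> \<le> 2 * J k + 2 * J (Suc k)"
        using s(2)[of k] s(2)[of "Suc k"] Suc.prems by (intro add_mono mult_left_mono) auto
      finally have "ennreal \<bar>f (\<sigma> 0) - f (\<sigma> (s (Suc k)))\<bar> \<le>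
          (ennreal h * g (\<sigma> 0) + 4 * (\<Sum>i<k. J i) + 2 * J k) + (2 * J k + 2 * J (Suc k))"
        using Suc by (intro order_trans[OF tri add_mono[OF Suc.IH]]) auto
      also have "\<dots> = ennreal h * g (\<sigma> 0) + 4 * (\<Sum>i<Suc k. J i) + 2 * J (Suc k)"
      proof -
        have "(4::ennreal) * J k = 2 * J k + 2 * J k" by (simp flip: distrib_right)
        then show ?thesis by (simp add: distrib_left ac_simps)
      qed
      finally show ?case .
    qed
    have "ennreal \<bar>f (\<sigma> (s n)) - f (\<sigma> l)\<bar> \<le> 1 * (ennreal h * g (\<sigma> (s n))) + 1 * (ennreal h * g (\<sigma> l))"
      using s(1)[of n] Asub[of n] l fin(3) g_fin[of n] h
      by (intro hop[of _ _ 1]) (auto simp: A_def algebra_simps)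
    also have "\<dots> \<le> 2 * J n + ennreal h * g (\<sigma> l)"
      using s(2)[of n] by (auto intro!: add_mono intro: add_increasing simp: mult_2)
    finally have "ennreal \<bar>f (\<sigma> 0) - f (\<sigma> l)\<bar> \<le>
        (ennreal h * g (\<sigma> 0) + 4 * (\<Sum>i<n. J i) + 2 * J n) + (2 * J n + ennreal h * g (\<sigma> l))"
      by (intro order_trans[OF tri add_mono[OF ind]]) auto
    also have "\<dots> = 4 * (\<Sum>i<Suc n. J i) + ennreal h * ?K"
    proof -
      have "(4::ennreal) * J n = 2 * J n + 2 * J n" by (simp flip: distrib_right)
      then show ?thesis by (simp add: distrib_left ac_simps)
    qed
    also have "\<dots> \<le> 4 * ?I + ennreal h * ?K"
      using sumJ by (intro add_right_mono mult_left_mono) auto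
    finally show ?thesis by (simp add: h_def)
  qed
  \<comment> \<open>The end point terms carry the factor \<open>h\<close> and vanish in the limit
    because \<open>g\<close> is finite at both ends.\<close>
  have "(\<lambda>n. 4 * ?I + ennreal (l / real (Suc n)) * ?K) \<longlonglongrightarrow> 4 * ?I + ennreal 0 * ?K"
  proof (intro tendsto_add tendsto_const ennreal_tendsto_cmult tendsto_ennrealI tendsto_mult_ennreal)
    show "(\<lambda>n. l / real (Suc n)) \<longlonglongrightarrow> 0"
      using LIMSEQ_Suc[OF lim_const_over_n[of l]] by simp
  qed (use fin in auto)
  then have "ennreal \<bar>f (\<sigma> 0) - f (\<sigma> l)\<bar> \<le> 4 * ?I + ennreal 0 * ?K"
    by (rule LIMSEQ_le_const) (use step in auto)
  then show ?thesis by simp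
qed

text \<open>Every path of finite cost from \<open>x\<close> to a point where \<open>g\<close> is
  finite proposes a value at \<open>x\<close>: the value of \<open>f\<close> at its end plus the
  price of the path. The factor 4 is that of \<open>path_chain\<close>, so where \<open>g x\<close>
  is finite no proposal lies below \<open>f x\<close>.\<close>

definition costs :: "'a \<Rightarrow> real set" where
  "costs x = {f (\<tau> m) + 4 * enn2real (path_nn_integral g \<tau> m) | \<tau> m.
     lip_path \<tau> m \<and> \<tau> ` {0..m} \<subseteq> \<Omega> \<and> \<tau> 0 = x \<and> g (\<tau> m) < \<infinity> \<and> path_nn_integral g \<tau> m < \<infinity>}"

text \<open>McShane's extension formula for the path metric with density \<open>4 g\<close>. A representative of \<open>f\<close>
  that can be controlled along every path has to be prescribed on the null set where \<open>g\<close> is infinite.\<close>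

definition repr :: "'a \<Rightarrow> real" where
  "repr x = Inf (costs x)"

lemma costs_join:
  assumes \<sigma>: "lip_path \<sigma> l" "\<sigma> ` {0..l} \<subseteq> \<Omega>" "path_nn_integral g \<sigma> l < \<infinity>" and c: "c \<in> costs (\<sigma> l)"
  shows "\<exists>c'\<in>costs (\<sigma> 0). c' \<le> c + 4 * enn2real (path_nn_integral g \<sigma> l)"
proof -
  obtain \<tau> m where \<tau>: "lip_path \<tau> m" "\<tau> ` {0..m} \<subseteq> \<Omega>" "\<tau> 0 = \<sigma> l" "g (\<tau> m) < \<infinity>"
    "path_nn_integral g \<tau> m < \<infinity>" and c: "c = f (\<tau> m) + 4 * enn2real (path_nn_integral g \<tau> m)"
    using c by (auto simp: costs_def)
  obtain \<omega> where join: "lip_path \<omega> (l + m)" "\<omega> 0 = \<sigma> 0" "\<omega> (l + m) = \<tau> m"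
    "\<omega> ` {0..l + m} \<subseteq> \<sigma> ` {0..l} \<union> \<tau> ` {0..m}"
    "path_nn_integral g \<omega> (l + m) \<le> path_nn_integral g \<sigma> l + path_nn_integral g \<tau> m"
    using lip_path_join[OF \<sigma>(1) \<tau>(1) \<tau>(3)[symmetric] g_borel] by blast
  have fin: "path_nn_integral g \<omega> (l + m) < \<infinity>"
    using join(5) \<sigma>(3) \<tau>(5) by (auto simp: order_le_less_trans)
  have "enn2real (path_nn_integral g \<omega> (l + m)) \<le>
      enn2real (path_nn_integral g \<sigma> l + path_nn_integral g \<tau> m)"
    using join(5) \<sigma>(3) \<tau>(5) by (intro enn2real_mono) auto
  also have "\<dots> = enn2real (path_nn_integral g \<sigma> l) + enn2real (path_nn_integral g \<tau> m)"
    using \<sigma>(3) \<tau>(5) by (intro enn2real_plus) auto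
  finally have "f (\<omega> (l + m)) + 4 * enn2real (path_nn_integral g \<omega> (l + m)) \<le>
      c + 4 * enn2real (path_nn_integral g \<sigma> l)" using join(3) c by simp
  moreover have "f (\<omega> (l + m)) + 4 * enn2real (path_nn_integral g \<omega> (l + m)) \<in> costs (\<sigma> 0)"
    unfolding costs_def using join(1-3) order_trans[OF join(4) Un_least[OF \<sigma>(2) \<tau>(2)]] fin \<tau>(4)
    by (intro CollectI exI[of _ \<omega>] exI[of _ "l + m"]) simp
  ultimately show ?thesis by blast
qed

text \<open>Prefixing a competitor for \<open>\<sigma> l\<close> by \<sigma> gives a competitor for
  \<open>\<sigma> 0\<close>. It connects two points at which \<open>g\<close> is finite, and
  \<open>path_chain\<close> applies to it.\<close>

lemma costs_lower:
  assumes "g (\<sigma> 0) < \<infinity>" "lip_path \<sigma> l" "\<sigma> ` {0..l} \<subseteq> \<Omega>" "path_nn_integral g \<sigma> l < \<infinity>"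
    and c: "c \<in> costs (\<sigma> l)"
  shows "f (\<sigma> 0) - 4 * enn2real (path_nn_integral g \<sigma> l) \<le> c"
proof -
  obtain c' where c': "c' \<in> costs (\<sigma> 0)" "c' \<le> c + 4 * enn2real (path_nn_integral g \<sigma> l)"
    using costs_join[OF assms(2-4) c] by auto
  obtain \<tau> m where \<tau>: "lip_path \<tau> m" "\<tau> ` {0..m} \<subseteq> \<Omega>" "\<tau> 0 = \<sigma> 0" "g (\<tau> m) < \<infinity>"
    "path_nn_integral g \<tau> m < \<infinity>" and c'': "c' = f (\<tau> m) + 4 * enn2real (path_nn_integral g \<tau> m)"
    using c'(1) by (auto simp: costs_def)
  have "ennreal \<bar>f (\<tau> 0) - f (\<tau> m)\<bar> \<le> 4 * path_nn_integral g \<tau> m"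
    using \<tau> assms(1) by (intro path_chain) auto
  also have "4 * path_nn_integral g \<tau> m = ennreal (4 * enn2real (path_nn_integral g \<tau> m))"
    using \<tau>(5) by (simp add: ennreal_mult)
  finally have "\<bar>f (\<tau> 0) - f (\<tau> m)\<bar> \<le> 4 * enn2real (path_nn_integral g \<tau> m)"
    by (simp add: ennreal_le_iff)
  then show ?thesis using c'(2) c'' \<tau>(3) by auto
qed

lemma repr_eq:
  assumes "x \<in> \<Omega>" "g x < \<infinity>"
  shows "repr x = f x"
proof -
  have triv: "lip_path (\<lambda>_. x) 0" "path_nn_integral g (\<lambda>_. x) 0 = 0"
    by (auto simp: lip_path_def path_nn_integral_def mult_indicator_subset nn_integral_null_set
             intro!: nn_integral_null_set[of "{0}" lborel "\<lambda>_. g x"])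
  have "f x \<in> costs x"
    unfolding costs_def using triv assms by (intro CollectI exI[of _ "\<lambda>_. x"] exI[of _ 0]) auto
  moreover have "f x \<le> c" if "c \<in> costs x" for c
    using costs_lower[of "\<lambda>_. x" 0 c] triv assms that by auto
  ultimately show ?thesis unfolding repr_def by (intro cInf_eq_minimum)
qed

text \<open>Infima of real sets are meaningful only for nonempty sets bounded below. Both properties
  come from one point \<open>\<sigma> s\<close> at which \<open>g\<close> is finite; it exists
  because the path has positive duration and finite integral. Seen from the start, it bounds
  \<open>costs (\<sigma> 0)\<close> from below; seen from the end, it provides a member of
  \<open>costs (\<sigma> l)\<close>. The inequality itself is \<open>costs_join\<close>.\<close>

lemma repr_le:
  assumes \<sigma>: "lip_path \<sigma> l" "\<sigma> ` {0..l} \<subseteq> \<Omega>" "path_nn_integral g \<sigma> l < \<infinity>" and l: "0 < l"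
  shows "repr (\<sigma> 0) \<le> repr (\<sigma> l) + 4 * enn2real (path_nn_integral g \<sigma> l)"
proof -
  have "\<exists>s\<in>{0..l}. g (\<sigma> s) < \<infinity>"
  proof (rule ccontr)
    assume "\<not> ?thesis"
    then have "path_nn_integral g \<sigma> l = (\<integral>\<^sup>+s. \<infinity> * indicator {0..l} s \<partial>lborel)"
      unfolding path_nn_integral_def
      by (intro nn_integral_cong) (auto simp: indicator_def less_top[symmetric])
    also have "\<dots> = \<infinity>" using l by (subst nn_integral_cmult_indicator) (auto simp: ennreal_top_mult)
    finally show False using \<sigma>(3) by simp
  qed
  then obtain s where s: "s \<in> {0..l}" "g (\<sigma> s) < \<infinity>" by blast
  define \<rho> where "\<rho> t = \<sigma> (s - t)" for t
  have pre: "lip_path \<sigma> s" "path_nn_integral g \<sigma> s < \<infinity>"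
    using lip_path_restrict[OF \<sigma>(1), of s] s \<sigma>(3) by (auto intro: order_le_less_trans)
  then have \<rho>: "lip_path \<rho> s" "path_nn_integral g \<rho> s < \<infinity>" "\<rho> ` {0..s} \<subseteq> \<Omega>" "\<rho> 0 = \<sigma> s" "\<rho> s = \<sigma> 0"
    using lip_path_reverse[OF pre(1) g_borel] \<sigma>(2) s(1) unfolding \<rho>_def[abs_def] by auto
  have bdd: "bdd_below (costs (\<sigma> 0))"
    using costs_lower[of \<rho> s] \<rho> s
    by (intro bdd_belowI[of _ "f (\<sigma> s) - 4 * enn2real (path_nn_integral g \<rho> s)"]) auto
  define \<eta> where "\<eta> t = \<sigma> (l - t)" for t
  have \<eta>: "lip_path \<eta> l" "path_nn_integral g \<eta> l = path_nn_integral g \<sigma> l"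
    using lip_path_reverse[OF \<sigma>(1) g_borel] unfolding \<eta>_def[abs_def] by auto
  have \<eta>s: "lip_path \<eta> (l - s)" "path_nn_integral g \<eta> (l - s) < \<infinity>"
    using lip_path_restrict(1)[OF \<eta>(1), of "l - s"] lip_path_restrict(2)[OF \<eta>(1), of "l - s" g]
      \<eta>(2) s \<sigma>(3) by (auto intro: order_le_less_trans)
  have "f (\<eta> (l - s)) + 4 * enn2real (path_nn_integral g \<eta> (l - s)) \<in> costs (\<sigma> l)"
    unfolding costs_def using \<eta>s s \<sigma>(2)
    by (intro CollectI exI[of _ \<eta>] exI[of _ "l - s"]) (auto simp: \<eta>_def)
  then have ne: "costs (\<sigma> l) \<noteq> {}" by auto
  have "repr (\<sigma> 0) - 4 * enn2real (path_nn_integral g \<sigma> l) \<le> c" if "c \<in> costs (\<sigma> l)" for c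
    using costs_join[OF \<sigma> that] cInf_lower[OF _ bdd] unfolding repr_def by force
  then have "repr (\<sigma> 0) - 4 * enn2real (path_nn_integral g \<sigma> l) \<le> repr (\<sigma> l)"
    unfolding repr_def[of "\<sigma> l"] using ne by (intro cInf_greatest)
  then show ?thesis by simp
qed

text \<open>The estimate holds along every curve in \<Omega>, not just almost every one. If the
  integral is infinite there is nothing to show; otherwise the path and its reversal give the two
  signs.\<close>

lemma repr_upper_gradient:
  assumes "nonconstant_curve \<gamma> a b" "\<gamma> ` {a..b} \<subseteq> \<Omega>"
  shows "ennreal \<bar>repr (\<gamma> a) - repr (\<gamma> b)\<bar> \<le> curve_integral (\<lambda>x. 4 * g x) \<gamma> a b"
proof -
  have c: "is_curve \<gamma> a b" using assms(1) by (simp add: nonconstant_curve_def)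
  define l where "l = enn2real (curve_length \<gamma> a b)"
  define \<sigma> where "\<sigma> = arclength_param \<gamma> a b"
  note p = arclength_param_lip_path[OF c, folded l_def \<sigma>_def]
  have l: "0 < l" unfolding l_def by (rule nonconstant_curve_length_pos[OF assms(1)])
  have eq: "curve_integral (\<lambda>x. 4 * g x) \<gamma> a b = 4 * path_nn_integral g \<sigma> l"
    using curve_integral_cmult[OF c g_borel, of 4] by (simp only: curve_integral_eq_path l_def \<sigma>_def)
  show ?thesis
  proof (cases "path_nn_integral g \<sigma> l < \<infinity>")
    case True
    have sub: "\<sigma> ` {0..l} \<subseteq> \<Omega>" using p(4) assms(2) by auto
    define \<rho> where "\<rho> t = \<sigma> (l - t)" for t
    have \<rho>: "lip_path \<rho> l" "path_nn_integral g \<rho> l = path_nn_integral g \<sigma> l" "\<rho> ` {0..l} \<subseteq> \<Omega>"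
      using lip_path_reverse[OF p(1) g_borel] sub unfolding \<rho>_def[abs_def] by auto
    have "\<bar>repr (\<gamma> a) - repr (\<gamma> b)\<bar> \<le> 4 * enn2real (path_nn_integral g \<sigma> l)"
      using repr_le[OF p(1) sub True l] repr_le[OF \<rho>(1,3) _ l] True \<rho>(2) p(2,3) by (auto simp: \<rho>_def)
    then have "ennreal \<bar>repr (\<gamma> a) - repr (\<gamma> b)\<bar> \<le> ennreal (4 * enn2real (path_nn_integral g \<sigma> l))"
      by (rule ennreal_leI)
    then show ?thesis using True by (simp add: eq ennreal_mult)
  next
    case False
    then have "path_nn_integral g \<sigma> l = top" by (simp add: less_top[symmetric])
    then show ?thesis unfolding eq by (simp add: ennreal_mult_top)
  qed
qed

end

section \<open>Doubling measures\<close>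

text \<open>The 5r-covering lemma. Zorn's lemma is applied to disjoint families such that every ball
  meeting the family meets a member of at least half its radius. A maximal one meets every ball,
  since otherwise a missed ball with more than half the supremal radius among the missed ones could
  be added. The factor 5 comes from \<open>r i \<le> 2 * r j\<close>, as the points of ball
  \<open>i\<close> are within \<open>2 * r i + r j\<close> of \<open>c j\<close>.\<close>

lemma Vitali_covering_metric:
  fixes c :: "'i \<Rightarrow> 'a::metric_space"
  assumes r: "\<And>i. i \<in> K \<Longrightarrow> 0 < r i \<and> r i \<le> B"
  obtains C where "C \<subseteq> K" "disjoint_family_on (\<lambda>i. ball (c i) (r i)) C"
    "\<And>i. i \<in> K \<Longrightarrow> \<exists>j\<in>C. ball (c i) (r i) \<subseteq> ball (c j) (5 * r j)"
proof -
  let ?U = "\<lambda>i. ball (c i) (r i)"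
  define \<A> where "\<A> = {C. C \<subseteq> K \<and> disjoint_family_on ?U C \<and>
    (\<forall>i\<in>K. (\<exists>j\<in>C. ?U i \<inter> ?U j \<noteq> {}) \<longrightarrow> (\<exists>j\<in>C. ?U i \<inter> ?U j \<noteq> {} \<and> r i \<le> 2 * r j))}"
  have "{} \<in> \<A>" by (auto simp: \<A>_def disjoint_family_on_def)
  moreover have "\<Union>\<C> \<in> \<A>" if ne: "\<C> \<noteq> {}" and ch: "subset.chain \<A> \<C>" for \<C>
  proof -
    have sub: "\<C> \<subseteq> \<A>" using ch by (auto simp: subset.chain_def)
    have "disjoint_family_on ?U (\<Union>\<C>)"
      unfolding disjoint_family_on_def
    proof (intro ballI impI)
      fix i j assume "i \<in> \<Union>\<C>" "j \<in> \<Union>\<C>" and ij: "i \<noteq> j"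
      then obtain X Y where XY: "i \<in> X" "X \<in> \<C>" "j \<in> Y" "Y \<in> \<C>" by blast
      then have "X \<subseteq> Y \<or> Y \<subseteq> X" using ch by (auto simp: subset.chain_def)
      then obtain Z where "Z \<in> \<C>" "i \<in> Z" "j \<in> Z" using XY by blast
      then show "?U i \<inter> ?U j = {}"
        using sub ij by (auto simp: \<A>_def disjoint_family_on_def)
    qed
    moreover have "\<Union>\<C> \<subseteq> K" using sub by (auto simp: \<A>_def)
    moreover have "\<exists>j\<in>\<Union>\<C>. ?U i \<inter> ?U j \<noteq> {} \<and> r i \<le> 2 * r j"
      if i: "i \<in> K" and ex: "\<exists>j\<in>\<Union>\<C>. ?U i \<inter> ?U j \<noteq> {}" for i
    proof -
      obtain X where "X \<in> \<C>" "\<exists>j\<in>X. ?U i \<inter> ?U j \<noteq> {}" using ex by blast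
      then have "\<exists>j\<in>X. ?U i \<inter> ?U j \<noteq> {} \<and> r i \<le> 2 * r j"
        using sub i unfolding \<A>_def by blast
      then show ?thesis using \<open>X \<in> \<C>\<close> by blast
    qed
    ultimately show ?thesis unfolding \<A>_def by blast
  qed
  ultimately obtain C where C: "C \<in> \<A>" and max: "\<And>X. X \<in> \<A> \<Longrightarrow> C \<subseteq> X \<Longrightarrow> X = C"
    using subset_Zorn_nonempty[of \<A>] by blast
  have meets: "\<exists>j\<in>C. ?U i \<inter> ?U j \<noteq> {}" if i: "i \<in> K" for i
  proof (rule ccontr)
    define K' where "K' = {i \<in> K. \<forall>j\<in>C. ?U i \<inter> ?U j = {}}"
    assume "\<not> ?thesis"
    then have iK': "i \<in> K'" using i by (auto simp: K'_def)
    have bdd: "bdd_above (r ` K')" using r by (auto simp: K'_def intro!: bdd_aboveI[of _ B])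
    define S where "S = Sup (r ` K')"
    have le: "r j \<le> S" if "j \<in> K'" for j using that bdd by (auto simp: S_def intro: cSup_upper)
    have "0 < S" using le[OF iK'] r[OF i] by linarith
    then have "\<exists>x\<in>r ` K'. S / 2 < x"
      unfolding S_def using bdd iK' by (subst less_cSup_iff[symmetric]) auto
    then obtain k where k: "k \<in> K'" "S / 2 < r k" by blast
    have kK: "k \<in> K" "\<And>j. j \<in> C \<Longrightarrow> ?U k \<inter> ?U j = {}" using k by (auto simp: K'_def)
    have "c k \<in> ?U k" using r[OF kK(1)] by simp
    then have kC: "k \<notin> C" using kK(2)[of k] by blast
    have "insert k C \<in> \<A>"
      unfolding \<A>_def
    proof (intro CollectI conjI ballI impI)
      show "insert k C \<subseteq> K" using C kK by (auto simp: \<A>_def)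
      show "disjoint_family_on ?U (insert k C)"
        using C kK(2) unfolding \<A>_def disjoint_family_on_def by blast
      fix i assume i: "i \<in> K" and ex: "\<exists>j\<in>insert k C. ?U i \<inter> ?U j \<noteq> {}"
      show "\<exists>j\<in>insert k C. ?U i \<inter> ?U j \<noteq> {} \<and> r i \<le> 2 * r j"
      proof (cases "\<exists>j\<in>C. ?U i \<inter> ?U j \<noteq> {}")
        case True
        then show ?thesis using C i unfolding \<A>_def by blast
      next
        case False
        then have "i \<in> K'" using i by (auto simp: K'_def)
        then have "r i \<le> 2 * r k" using le[of i] k by linarith
        then show ?thesis using ex False by blast
      qed
    qed
    then show False using max[of "insert k C"] kC by blast
  qed
  show ?thesis
  proof
    show "C \<subseteq> K" "disjoint_family_on ?U C" using C by (auto simp: \<A>_def)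
    fix i assume i: "i \<in> K"
    then obtain j where j: "j \<in> C" "?U i \<inter> ?U j \<noteq> {}" "r i \<le> 2 * r j"
      using C meets[OF i] unfolding \<A>_def by blast
    then obtain z where "dist (c i) z < r i" "dist (c j) z < r j" by auto
    then have *: "dist (c j) (c i) < r i + r j"
      using dist_triangle[of "c j" "c i" z] by (simp add: dist_commute)
    have "?U i \<subseteq> ball (c j) (5 * r j)"
    proof
      fix y assume "y \<in> ?U i"
      then show "y \<in> ball (c j) (5 * r j)"
        using * j(3) dist_triangle[of "c j" y "c i"] by simp
    qed
    then show "\<exists>j\<in>C. ?U i \<subseteq> ball (c j) (5 * r j)" using j(1) by blast
  qed
qed

text \<open>The properties of the Caratheodory measure on which everything below rests. Its
  \<sigma>-algebra may be larger than the Borel one: \<open>null_subset\<close> is completeness, and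
  \<open>borel_regular\<close> is the way back to Borel functions, which are integrated along
  curves.\<close>

locale doubling_space =
  fixes M :: "'a::metric_space measure" and D :: real
  assumes space_M [simp]: "space M = UNIV"
    and borel_sets: "A \<in> sets borel \<Longrightarrow> A \<in> sets M"
    and null_subset: "N \<in> null_sets M \<Longrightarrow> A \<subseteq> N \<Longrightarrow> A \<in> sets M"
    and borel_regular: "A \<in> sets M \<Longrightarrow> \<exists>B\<in>sets borel. A \<subseteq> B \<and> emeasure M B = emeasure M A"
    and D_ge_1: "1 \<le> D"
    and ball_pos: "0 < r \<Longrightarrow> 0 < emeasure M (ball x r)"
    and ball_finite: "emeasure M (ball x r) < \<infinity>"
    and ball_double: "0 < r \<Longrightarrow> emeasure M (ball x (2 * r)) \<le> ennreal D * emeasure M (ball x r)"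
begin

lemma open_sets: "open A \<Longrightarrow> A \<in> sets M"
  by (intro borel_sets borel_open)

lemma ball_sets [measurable, simp]: "ball x r \<in> sets M" by (simp add: open_sets)

lemma measurable_from_borel: "f \<in> borel_measurable borel \<Longrightarrow> f \<in> borel_measurable M"
  using borel_sets by (auto simp: measurable_def)

lemma continuous_measurable: "continuous_on UNIV f \<Longrightarrow> f \<in> borel_measurable M"
  by (intro measurable_from_borel borel_measurable_continuous_onI)

lemma dist_measurable [measurable]: "(\<lambda>x. dist x q) \<in> borel_measurable M"
  by (intro continuous_measurable continuous_intros)

lemma dist_measurable' [measurable]: "(\<lambda>x. dist q x) \<in> borel_measurable M"
  by (intro continuous_measurable continuous_intros)

lemma ball_double_power:
  assumes "0 < r"
  shows "emeasure M (ball x (2 ^ n * r)) \<le> ennreal (D ^ n) * emeasure M (ball x r)"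
proof (induction n)
  case (Suc n)
  have "emeasure M (ball x (2 ^ Suc n * r)) \<le> ennreal D * emeasure M (ball x (2 ^ n * r))"
    using ball_double[of "2 ^ n * r" x] assms by (simp add: mult.assoc)
  also have "\<dots> \<le> ennreal D * (ennreal (D ^ n) * emeasure M (ball x r))"
    by (intro mult_left_mono Suc) simp
  also have "\<dots> = ennreal (D ^ Suc n) * emeasure M (ball x r)"
    using D_ge_1 by (simp add: ennreal_mult mult.assoc)
  finally show ?case .
qed simp

lemma ball_le_ball:
  assumes "0 < r" "dist x y + s \<le> 2 ^ n * r"
  shows "emeasure M (ball x s) \<le> ennreal (D ^ n) * emeasure M (ball y r)"
proof -
  have "ball x s \<subseteq> ball y (2 ^ n * r)"
  proof
    fix z assume "z \<in> ball x s"
    then show "z \<in> ball y (2 ^ n * r)"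
      using assms(2) dist_triangle[of y z x] by (simp add: dist_commute)
  qed
  then have "emeasure M (ball x s) \<le> emeasure M (ball y (2 ^ n * r))"
    by (intro emeasure_mono) auto
  then show ?thesis using ball_double_power[OF assms(1)] by (rule order_trans)
qed

sublocale sigma_finite_measure M
proof
  fix x0 :: 'a
  show "\<exists>A. countable A \<and> A \<subseteq> sets M \<and> \<Union> A = space M \<and> (\<forall>a\<in>A. emeasure M a \<noteq> \<infinity>)"
  proof (intro exI conjI ballI)
    show "\<Union> (range (\<lambda>n. ball x0 (real n))) = space M"
      using reals_Archimedean2[of "dist x0 _"] by auto
    show "emeasure M a \<noteq> \<infinity>" if "a \<in> range (\<lambda>n. ball x0 (real n))" for a
      using that ball_finite by (auto simp: less_top[symmetric])
  qed auto
qed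

text \<open>Inside a fixed ball, which has finite measure, only finitely many members can have
  measure at least \<open>1 / (k + 1)\<close>. Letting the ball and \<open>k\<close> grow exhausts
  the index set.\<close>

lemma countable_disjoint_positive:
  assumes disj: "disjoint_family_on A I" and sets: "\<And>i. i \<in> I \<Longrightarrow> A i \<in> sets M"
    and pos: "\<And>i. i \<in> I \<Longrightarrow> 0 < emeasure M (A i)"
  shows "countable I"
proof -
  fix x0 :: 'a
  define E where "E n k = {i \<in> I. ennreal (1 / real (Suc k)) \<le> emeasure M (A i \<inter> ball x0 (real n))}" for n k
  have fin: "finite (E n k)" for n k
  proof -
    define b where "b = enn2real (emeasure M (ball x0 (real n)))"
    have b: "emeasure M (ball x0 (real n)) = ennreal b" "0 \<le> b"
      using ball_finite by (auto simp: b_def)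
    have "card G \<le> nat \<lceil>b * real (Suc k)\<rceil>" if G: "G \<subseteq> E n k" "finite G" for G
    proof -
      have "ennreal (real (card G) * (1 / real (Suc k))) = (\<Sum>i\<in>G. ennreal (1 / real (Suc k)))"
        by (subst ennreal_mult) (auto simp: ennreal_of_nat_eq_real_of_nat)
      also have "\<dots> \<le> (\<Sum>i\<in>G. emeasure M (A i \<inter> ball x0 (real n)))"
        using G by (intro sum_mono) (auto simp: E_def)
      also have "\<dots> = emeasure M (\<Union>i\<in>G. A i \<inter> ball x0 (real n))"
      proof (rule sum_emeasure)
        show "(\<lambda>i. A i \<inter> ball x0 (real n)) ` G \<subseteq> sets M"
          using G sets by (auto simp: E_def)
        show "disjoint_family_on (\<lambda>i. A i \<inter> ball x0 (real n)) G"
          using disj G unfolding disjoint_family_on_def E_def by blast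
      qed (use G in auto)
      also have "\<dots> \<le> ennreal b" unfolding b(1)[symmetric] by (intro emeasure_mono) auto
      finally have "real (card G) * (1 / real (Suc k)) \<le> b" using b(2) by (simp add: ennreal_le_iff)
      then have "real (card G) \<le> b * real (Suc k)" by (simp add: field_simps)
      then show ?thesis by linarith
    qed
    then show ?thesis using finite_if_finite_subsets_card_bdd[of "E n k"] by blast
  qed
  have "I \<subseteq> (\<Union>n. \<Union>k. E n k)"
  proof
    fix i assume i: "i \<in> I"
    have "(\<lambda>n. emeasure M (A i \<inter> ball x0 (real n))) \<longlonglongrightarrow> emeasure M (\<Union>n. A i \<inter> ball x0 (real n))"
      using sets[OF i] by (intro Lim_emeasure_incseq) (auto simp: incseq_def)
    moreover have "(\<Union>n. A i \<inter> ball x0 (real n)) = A i"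
      using reals_Archimedean2[of "dist x0 _"] by auto
    ultimately have "\<forall>\<^sub>F n in sequentially. 0 < emeasure M (A i \<inter> ball x0 (real n))"
      using pos[OF i] by (intro order_tendstoD(1)) auto
    then obtain n where n: "0 < emeasure M (A i \<inter> ball x0 (real n))"
      by (meson eventually_sequentially order_refl)
    have "(\<lambda>k. ennreal (1 / real (Suc k))) \<longlonglongrightarrow> ennreal 0"
      using LIMSEQ_Suc[OF lim_const_over_n[of 1]] by (intro tendsto_ennrealI) simp
    then have "\<forall>\<^sub>F k in sequentially. ennreal (1 / real (Suc k)) < emeasure M (A i \<inter> ball x0 (real n))"
      using n by (intro order_tendstoD(2)) auto
    then obtain k where "ennreal (1 / real (Suc k)) < emeasure M (A i \<inter> ball x0 (real n))"
      by (meson eventually_sequentially order_refl)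
    then show "i \<in> (\<Union>n. \<Union>k. E n k)" using i by (auto simp: E_def intro: less_imp_le)
  qed
  then show ?thesis
    by (rule countable_subset) (intro countable_UN countableI_type fin[THEN countable_finite])
qed

text \<open>At each scale a disjoint Vitali family of balls of that radius is countable, and its
  centres form a net at five times the scale. Separability is what places conditions such as
  \<open>dist x z < a z\<close> in the product \<sigma>-algebra.\<close>

lemma separable: "\<exists>S. countable S \<and> (\<forall>x::'a. \<forall>e>0. \<exists>q\<in>S. dist x q < e)"
proof -
  have "\<exists>S. countable S \<and> (\<forall>x::'a. \<exists>q\<in>S. dist x q < 5 * (1 / real (Suc n)))" for n
  proof -
    obtain S where S: "disjoint_family_on (\<lambda>x::'a. ball x (1 / real (Suc n))) S"
      "\<And>x. \<exists>q\<in>S. ball x (1 / real (Suc n)) \<subseteq> ball q (5 * (1 / real (Suc n)))"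
      using Vitali_covering_metric[of UNIV "\<lambda>_. 1 / real (Suc n)" "1 / real (Suc n)" "\<lambda>x. x"]
      by (auto simp: subset_iff)
    have "countable S" using S(1) by (rule countable_disjoint_positive) (auto intro: ball_pos)
    moreover have "\<exists>q\<in>S. dist x q < 5 * (1 / real (Suc n))" for x
    proof -
      have "x \<in> ball x (1 / real (Suc n))" by simp
      then show ?thesis using S(2)[of x] by (metis dist_commute mem_ball subsetD)
    qed
    ultimately show ?thesis by blast
  qed
  then obtain S where S: "\<And>n. countable (S n)" "\<And>n x. \<exists>q\<in>S n. dist (x::'a) q < 5 * (1 / real (Suc n))"
    by metis
  have "\<exists>q\<in>\<Union>(range S). dist x q < e" if "0 < e" for x :: 'a and e
  proof -
    have "0 < e / 5" using that by simp
    then obtain n where "inverse (real (Suc n)) < e / 5" using reals_Archimedean by blast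
    then have "5 * (1 / real (Suc n)) < e" by (simp add: field_simps)
    then show ?thesis using S(2)[of n x] by (meson UN_I UNIV_I order_less_trans)
  qed
  then show ?thesis using S(1) by (intro exI[of _ "\<Union>(range S)"]) auto
qed

text \<open>The product \<sigma>-algebra is generated by rectangles, so the set is exhibited as a
  countable union of them: a point \<open>q\<close> near \<open>x\<close> from a countable dense set
  and a rational \<open>s\<close> slightly above \<open>dist x q\<close> separate the two
  variables.\<close>

lemma pred_dist_less:
  assumes [measurable]: "a \<in> borel_measurable M"
  shows "{p \<in> space (M \<Otimes>\<^sub>M M). dist (fst p) (snd p) < a (snd p)} \<in> sets (M \<Otimes>\<^sub>M M)"
proof -
  obtain S where S: "countable S" "\<And>x e. 0 < e \<Longrightarrow> \<exists>q\<in>S. dist (x::'a) q < e"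
    using separable by blast
  have "{p \<in> space (M \<Otimes>\<^sub>M M). dist (fst p) (snd p) < a (snd p)} =
      (\<Union>q\<in>S. \<Union>s\<in>\<rat>. ball q s \<times> {z \<in> space M. dist z q < a z - s})"
  proof (intro equalityI subsetI)
    fix p assume "p \<in> {p \<in> space (M \<Otimes>\<^sub>M M). dist (fst p) (snd p) < a (snd p)}"
    then obtain x z where p: "p = (x, z)" "dist x z < a z" by (cases p) auto
    define e where "e = (a z - dist x z) / 3"
    have e: "0 < e" using p by (simp add: e_def)
    obtain q where q: "q \<in> S" "dist x q < e" using S(2)[OF e] by blast
    obtain s where s: "s \<in> \<rat>" "dist x q < s" "s < dist x q + e"
      using Rats_dense_in_real[of "dist x q" "dist x q + e"] e by auto
    have "dist z q < a z - s"
    proof -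
      have "3 * e = a z - dist x z" by (simp add: e_def)
      then show ?thesis
        using dist_triangle[of z q x] q(2) s(3) dist_commute[of z x] by linarith
    qed
    then show "p \<in> (\<Union>q\<in>S. \<Union>s\<in>\<rat>. ball q s \<times> {z \<in> space M. dist z q < a z - s})"
      using p q s by (auto simp: dist_commute)
  next
    fix p assume "p \<in> (\<Union>q\<in>S. \<Union>s\<in>\<rat>. ball q s \<times> {z \<in> space M. dist z q < a z - s})"
    then obtain x z q s where "p = (x, z)" "dist q x < s" "dist z q < a z - s" by auto
    then show "p \<in> {p \<in> space (M \<Otimes>\<^sub>M M). dist (fst p) (snd p) < a (snd p)}"
      using dist_triangle[of x z q] by (simp add: space_pair_measure dist_commute)
  qed
  also have "\<dots> \<in> sets (M \<Otimes>\<^sub>M M)"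
  proof -
    have "{z \<in> space M. dist z q < a z - s} \<in> sets M" for q s by measurable
    then show ?thesis
      using S(1) by (intro sets.countable_UN'' countable_rat pair_measureI) simp_all
  qed
  finally show ?thesis .
qed

lemma pred_dist_less_snd:
  assumes "a \<in> borel_measurable M"
  shows "Measurable.pred (M \<Otimes>\<^sub>M M) (\<lambda>(x, z). dist x z < a z)"
  using pred_dist_less[OF assms] by (simp add: pred_def case_prod_beta')

lemma pred_dist_less_fst:
  assumes "a \<in> borel_measurable M"
  shows "Measurable.pred (M \<Otimes>\<^sub>M M) (\<lambda>(x, z). dist x z < a x)"
  using measurable_compose[OF measurable_pair_swap' pred_dist_less_snd[OF assms]]
  by (simp add: case_prod_beta' dist_commute)

lemma emeasure_ball_measurable:
  assumes "a \<in> borel_measurable M"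
  shows "(\<lambda>w. emeasure M (ball w (a w))) \<in> borel_measurable M"
proof -
  have "{p \<in> space (M \<Otimes>\<^sub>M M). dist (fst p) (snd p) < a (fst p)} \<in> sets (M \<Otimes>\<^sub>M M)"
    using pred_dist_less_fst[OF assms] by (simp add: pred_def case_prod_beta')
  from measurable_emeasure_Pair[OF this] show ?thesis
    by (simp add: space_pair_measure ball_def vimage_def)
qed

text \<open>The passage from measurable to Borel gradients: a majorant everywhere preserves
  inequalities along curves, and equality almost everywhere preserves integrals. The majorant is
  assembled from Borel hulls of the superlevel sets at rational levels.\<close>

lemma borel_majorant:
  assumes g: "g \<in> borel_measurable M"
  shows "\<exists>g'. g' \<in> borel_measurable borel \<and> (\<forall>x. g x \<le> g' x) \<and> (AE x in M. g' x = (g x :: ennreal))"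
proof -
  \<comment> \<open>Regularity gives a hull of equal measure, from which one concludes that the
    difference is null if the measure is finite; hence the intersection with balls.\<close>
  have hull: "\<exists>B. B \<in> sets borel \<and> A \<subseteq> B \<and> B - A \<in> null_sets M" if A: "A \<in> sets M" for A
  proof -
    fix x0 :: 'a
    have "\<exists>B. B \<in> sets borel \<and> A \<inter> ball x0 (real n) \<subseteq> B \<and> B - A \<inter> ball x0 (real n) \<in> null_sets M" for n
    proof -
      have s: "A \<inter> ball x0 (real n) \<in> sets M" using A by auto
      obtain B where B: "B \<in> sets borel" "A \<inter> ball x0 (real n) \<subseteq> B"
        "emeasure M B = emeasure M (A \<inter> ball x0 (real n))" using borel_regular[OF s] by blast
      have "emeasure M (A \<inter> ball x0 (real n)) \<le> emeasure M (ball x0 (real n))"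
        by (intro emeasure_mono) auto
      then have "emeasure M (A \<inter> ball x0 (real n)) \<noteq> \<infinity>"
        using ball_finite[of x0 "real n"] by (auto simp: top_unique)
      then have "emeasure M (B - A \<inter> ball x0 (real n)) = 0"
        using B s borel_sets[OF B(1)] by (subst emeasure_Diff) auto
      then show ?thesis using B s borel_sets[OF B(1)] by (intro exI[of _ B]) auto
    qed
    then obtain B where B: "\<And>n. B n \<in> sets borel" "\<And>n. A \<inter> ball x0 (real n) \<subseteq> B n"
      "\<And>n. B n - A \<inter> ball x0 (real n) \<in> null_sets M" by metis
    have "A \<subseteq> (\<Union>n. B n)"
    proof
      fix x assume "x \<in> A"
      obtain n where "dist x0 x < real n" using reals_Archimedean2 by blast
      then show "x \<in> (\<Union>n. B n)" using B(2)[of n] \<open>x \<in> A\<close> by auto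
    qed
    moreover have "(\<Union>n. B n) - A \<in> null_sets M"
    proof (rule null_sets_subset)
      show "(\<Union>n. B n - A \<inter> ball x0 (real n)) \<in> null_sets M"
        using B(3) by (intro null_sets_UN) auto
      show "(\<Union>n. B n) - A \<in> sets M" using B(1) borel_sets A by (intro sets.Diff sets.countable_UN) auto
    qed auto
    ultimately show ?thesis using B(1) by (intro exI[of _ "\<Union>n. B n"]) auto
  qed
  have "{x \<in> space M. ennreal (real_of_rat q) < g x} \<in> sets M" for q
    using g by (intro borel_measurable_less) auto
  then have "\<exists>B. B \<in> sets borel \<and> {x \<in> space M. ennreal (real_of_rat q) < g x} \<subseteq> B \<and>
      B - {x \<in> space M. ennreal (real_of_rat q) < g x} \<in> null_sets M" for q
    by (rule hull)
  then have "\<exists>B. \<forall>q. B q \<in> sets borel \<and> {x \<in> space M. ennreal (real_of_rat q) < g x} \<subseteq> B q \<and>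
      B q - {x \<in> space M. ennreal (real_of_rat q) < g x} \<in> null_sets M"
    by (intro choice allI)
  then obtain B where B: "\<And>q::rat. B q \<in> sets borel"
    "\<And>q. {x \<in> space M. ennreal (of_rat q) < g x} \<subseteq> B q"
    "\<And>q. B q - {x \<in> space M. ennreal (of_rat q) < g x} \<in> null_sets M" by auto
  define g' where "g' x = (SUP q::rat. ennreal (of_rat q) * indicator (B q) x)" for x
  have SUP_g: "y = (SUP q::rat. if ennreal (of_rat q) < y then ennreal (of_rat q) else 0)" for y
  proof (rule antisym)
    show "y \<le> (SUP q::rat. if ennreal (of_rat q) < y then ennreal (of_rat q) else 0)"
    proof (rule dense_le)
      fix z assume "z < y"
      then obtain z' where z: "z < z'" "z' < y" using dense by blast
      then obtain q :: rat where q: "z < ennreal (of_rat q)" "ennreal (of_rat q) < z'"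
        using ennreal_rat_dense[of z z'] by auto
      then have "z \<le> (if ennreal (of_rat q) < y then ennreal (of_rat q) else 0)"
        using z by auto
      also have "\<dots> \<le> (SUP q::rat. if ennreal (of_rat q) < y then ennreal (of_rat q) else 0)"
        by (rule SUP_upper) simp
      finally show "z \<le> \<dots>" .
    qed
  qed (rule SUP_least, auto)
  have "g' \<in> borel_measurable borel"
    unfolding g'_def using B(1) by (intro borel_measurable_SUP) auto
  moreover have "g x \<le> g' x" for x
  proof -
    have "(SUP q::rat. if ennreal (of_rat q) < g x then ennreal (of_rat q) else 0) \<le> g' x"
      unfolding g'_def using B(2) by (intro SUP_mono') (auto simp: indicator_def subset_iff)
    then show ?thesis using SUP_g[of "g x"] by simp
  qed
  moreover have "AE x in M. g' x = g x"
  proof -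
    have "AE x in M. \<forall>q. x \<notin> B q - {x \<in> space M. ennreal (of_rat q) < g x}"
      unfolding AE_all_countable using B(3) AE_not_in by blast
    then show ?thesis
    proof eventually_elim
      case (elim x)
      then have "g' x = (SUP q::rat. if ennreal (of_rat q) < g x then ennreal (of_rat q) else 0)"
        unfolding g'_def using B(2) by (intro SUP_cong) (auto simp: indicator_def subset_iff)
      then show ?case using SUP_g[of "g x"] by simp
    qed
  qed
  ultimately show ?thesis by blast
qed

end

section \<open>Passing from the outer measure to its Caratheodory measure\<close>

lemma caratheodory_measure_props:
  assumes "borel_regular_outer_measure \<mu>"
  shows "space (caratheodory_measure \<mu>) = UNIV"
    and "sets (caratheodory_measure \<mu>) = lambda_system UNIV UNIV \<mu>"
    and "A \<in> lambda_system UNIV UNIV \<mu> \<Longrightarrow> emeasure (caratheodory_measure \<mu>) A = \<mu> A"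
proof -
  have o: "outer_measure_space (Pow UNIV) \<mu>" using assms by (simp add: borel_regular_outer_measure_def)
  interpret sigma_algebra UNIV "Pow UNIV" by (rule sigma_algebra_Pow)
  have ms: "measure_space UNIV (lambda_system UNIV UNIV \<mu>) \<mu>"
    using caratheodory_lemma[OF o] by simp
  then have sa: "sigma_algebra UNIV (lambda_system UNIV UNIV \<mu>)" by (simp add: measure_space_def)
  show "space (caratheodory_measure \<mu>) = UNIV"
    by (simp add: caratheodory_measure_def space_measure_of_conv)
  show "sets (caratheodory_measure \<mu>) = lambda_system UNIV UNIV \<mu>"
    unfolding caratheodory_measure_def using sa
    by (simp add: sigma_algebra.sigma_sets_eq)
  show "emeasure (caratheodory_measure \<mu>) A = \<mu> A" if "A \<in> lambda_system UNIV UNIV \<mu>"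
    unfolding caratheodory_measure_def
    using ms that by (intro emeasure_measure_of_sigma) (auto simp: measure_space_def)
qed

text \<open>Completeness holds because a set of outer measure 0 splits every set additively. All
  other properties concern Borel or measurable sets, on which the measure and the outer measure
  coincide.\<close>

lemma doubling_space_caratheodory:
  assumes \<mu>: "borel_regular_outer_measure \<mu>" and "doubling \<mu>"
  shows "\<exists>D. doubling_space (caratheodory_measure \<mu>) D"
proof -
  let ?M = "caratheodory_measure \<mu>"
  note props = caratheodory_measure_props[OF \<mu>]
  have om: "outer_measure_space UNIV \<mu>" using \<mu> by (simp add: borel_regular_outer_measure_def)
  have bs: "A \<in> sets borel \<Longrightarrow> A \<in> sets ?M" for A
    using \<mu> by (auto simp: props(2) borel_regular_outer_measure_def)
  have em: "A \<in> sets ?M \<Longrightarrow> emeasure ?M A = \<mu> A" for A using props(2,3) by auto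
  have ball: "emeasure ?M (ball x r) = \<mu> (ball x r)" for x r by (intro em bs) simp
  obtain C where C: "C \<ge> 1" "\<And>x r. r > 0 \<Longrightarrow> 0 < \<mu> (ball x (2 * r)) \<and>
        \<mu> (ball x (2 * r)) \<le> ennreal C * \<mu> (ball x r) \<and> ennreal C * \<mu> (ball x r) < \<infinity>"
    using assms(2) unfolding doubling_def by blast
  have fin: "\<mu> (ball x r) < \<infinity>" if "r > 0" for x r
    using C(2)[OF that, of x] C(1) by (auto simp: ennreal_mult_less_top)
  have "doubling_space ?M C"
  proof
    show "space ?M = UNIV" by (rule props)
    show "A \<in> sets ?M" if N: "N \<in> null_sets ?M" and A: "A \<subseteq> N" for N A
    proof -
      have "\<mu> N = 0" using N em by (auto simp: null_sets_def)
      have inc: "\<mu> X \<le> \<mu> Y" if "X \<subseteq> Y" for X Y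
        using om that by (auto simp: outer_measure_space_def increasing_def)
      have sub: "\<mu> (X \<union> Y) \<le> \<mu> X + \<mu> Y" for X Y
      proof -
        have "subadditive UNIV \<mu>"
          using om ring_of_sets.countably_subadditive_subadditive[of UNIV UNIV \<mu>]
          by (auto simp: outer_measure_space_def ring_of_sets_iff)
        then have "\<mu> (X \<union> (Y - X)) \<le> \<mu> X + \<mu> (Y - X)"
          unfolding subadditive_def by blast
        also have "\<dots> \<le> \<mu> X + \<mu> Y" by (intro add_left_mono inc) auto
        finally show ?thesis by simp
      qed
      show ?thesis unfolding props(2) lambda_system_def
      proof (intro CollectI conjI ballI UNIV_I)
        fix x
        have "\<mu> (A \<inter> x) = 0" using inc[of "A \<inter> x" N] A \<open>\<mu> N = 0\<close> by auto
        moreover have "\<mu> x \<le> \<mu> (A \<inter> x) + \<mu> ((UNIV - A) \<inter> x)"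
          using sub[of "A \<inter> x" "(UNIV - A) \<inter> x"] by (simp flip: Int_Un_distrib2)
        moreover have "\<mu> ((UNIV - A) \<inter> x) \<le> \<mu> x" by (rule inc) auto
        ultimately show "\<mu> (A \<inter> x) + \<mu> ((UNIV - A) \<inter> x) = \<mu> x" by auto
      qed
    qed
    show "\<exists>B\<in>sets borel. A \<subseteq> B \<and> emeasure ?M B = emeasure ?M A" if "A \<in> sets ?M" for A
      using \<mu> em bs that unfolding borel_regular_outer_measure_def by metis
    show "0 < emeasure ?M (ball x r)" if "0 < r" for x r
      using C(2)[of "r / 2" x] that by (simp add: ball)
    show "emeasure ?M (ball x r) < \<infinity>" for x r
      using fin[of r x] om
      by (cases "0 < r") (auto simp: ball ball_empty not_less outer_measure_space_def positive_def)
    show "emeasure ?M (ball x (2 * r)) \<le> ennreal C * emeasure ?M (ball x r)" if "0 < r" for x r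
      using C(2)[OF that, of x] by (simp add: ball)
  qed (use C bs in auto)
  then show ?thesis by blast
qed

section \<open>Averages over balls inside a domain\<close>

lemma ennreal_inverse_le:
  fixes a b :: ennreal
  assumes "a \<le> ennreal c * b" "0 < a" "0 < b" "b < \<infinity>"
  shows "inverse b \<le> ennreal c * inverse a"
proof (cases "a = \<infinity>")
  case True
  with assms(1) assms(4) show ?thesis by (auto simp: ennreal_mult_eq_top_iff top_unique)
next
  case False
  then obtain a' b' where "a = ennreal a'" "0 < a'" "b = ennreal b'" "0 < b'"
    using assms by (cases a; cases b) (auto simp: ennreal_less_zero_iff)
  moreover have "0 \<le> c"
    using assms(1,2) by (metis ennreal_neg linear mult_zero_left not_le)
  ultimately show ?thesis
    using assms(1) by (simp add: inverse_ennreal field_simps ennreal_le_iff flip: ennreal_mult)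
qed

locale domain_space = doubling_space M D for M :: "'a::metric_space measure" and D +
  fixes \<Omega> :: "'a set"
  assumes open_dom: "open \<Omega>" and compl_ne: "- \<Omega> \<noteq> {}"
begin

definition \<delta> :: "'a \<Rightarrow> real" where "\<delta> x = infdist x (- \<Omega>)"

text \<open>The volume of the largest ball around \<open>x\<close> inside \<Omega>. Off \<Omega> it
  is 0 and its inverse infinite; this is harmless where the inverse is multiplied by the indicator
  of \<open>ball x (a * \<delta> x)\<close>, which is then empty.\<close>

definition V :: "'a \<Rightarrow> ennreal" where "V x = emeasure M (ball x (\<delta> x))"

lemma \<delta>_nonneg [simp]: "0 \<le> \<delta> x" by (simp add: \<delta>_def infdist_nonneg)

lemma \<delta>_lip: "\<delta> x \<le> \<delta> y + dist x y" unfolding \<delta>_def by (rule infdist_triangle)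

lemma \<delta>_lip': "\<delta> x \<le> \<delta> y + dist y x" using \<delta>_lip[of x y] by (simp add: dist_commute)

lemma \<delta>_pos_iff: "0 < \<delta> x \<longleftrightarrow> x \<in> \<Omega>"
proof -
  have "closed (- \<Omega>)" using open_dom by auto
  then have "x \<in> - \<Omega> \<longleftrightarrow> \<delta> x = 0"
    unfolding \<delta>_def using compl_ne by (rule in_closed_iff_infdist_zero)
  then show ?thesis by (auto simp: less_le)
qed

lemma \<delta>_eq_0: "x \<notin> \<Omega> \<Longrightarrow> \<delta> x = 0"
  using \<delta>_pos_iff[of x] \<delta>_nonneg[of x] by simp

lemma \<delta>_le_dist: "y \<notin> \<Omega> \<Longrightarrow> \<delta> x \<le> dist x y"
  unfolding \<delta>_def by (rule infdist_le) simp

lemma ball_\<delta>_subset: "a \<le> 1 \<Longrightarrow> ball x (a * \<delta> x) \<subseteq> \<Omega>"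
proof
  fix y assume "a \<le> 1" "y \<in> ball x (a * \<delta> x)"
  moreover have "a * \<delta> x \<le> 1 * \<delta> x" using \<open>a \<le> 1\<close> by (intro mult_right_mono) auto
  ultimately have "dist x y < \<delta> x" by simp
  then show "y \<in> \<Omega>" using \<delta>_le_dist[of y x] by force
qed

lemma \<delta>_continuous: "continuous_on A \<delta>"
  unfolding \<delta>_def by (intro continuous_intros)

lemma \<delta>_measurable [measurable]: "\<delta> \<in> borel_measurable M"
  by (intro continuous_measurable \<delta>_continuous)

lemma V_measurable [measurable]: "V \<in> borel_measurable M"
  unfolding V_def by (intro emeasure_ball_measurable) simp

lemma dom_sets [measurable, simp]: "\<Omega> \<in> sets M" by (simp add: open_sets open_dom)

lemma V_pos: "x \<in> \<Omega> \<Longrightarrow> 0 < V x" unfolding V_def using \<delta>_pos_iff by (intro ball_pos) auto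

lemma V_finite: "V x < \<infinity>" unfolding V_def by (rule ball_finite)

lemma V_inverse: "x \<in> \<Omega> \<Longrightarrow> V x * inverse (V x) = 1"
  using V_pos[of x] V_finite[of x] by (cases "V x") (auto simp: inverse_ennreal ennreal_less_zero_iff simp flip: ennreal_mult)

text \<open>Exchanges integration over the points of the balls \<open>ball w (r w)\<close> with
  integration over the centres of those balls that contain a given point. The integral bounds for
  \<open>v\<close>, for its gradient and for \<open>u - v\<close> all come down to this.\<close>

lemma tonelli_balls:
  assumes [measurable]: "F \<in> borel_measurable M" "c \<in> borel_measurable M" "r \<in> borel_measurable M"
  shows "(\<integral>\<^sup>+y. F y * (\<integral>\<^sup>+w. c w * indicator (ball w (r w)) y \<partial>M) \<partial>M) =
    (\<integral>\<^sup>+w. c w * (\<integral>\<^sup>+y. F y * indicator (ball w (r w)) y \<partial>M) \<partial>M)"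
proof -
  interpret pair_sigma_finite M M ..
  have ind: "indicator (ball w (r w)) y = (if dist w y < r w then 1 else 0::ennreal)" for w y
    by (auto simp: indicator_def)
  have m: "(\<lambda>(w, y). indicator (ball w (r w)) y :: ennreal) \<in> borel_measurable (M \<Otimes>\<^sub>M M)"
    unfolding ind case_prod_beta' using pred_dist_less_fst[OF assms(3), unfolded case_prod_beta'] by measurable
  have m1: "(\<lambda>w. indicator (ball w (r w)) y :: ennreal) \<in> borel_measurable M" for y
    using measurable_compose[OF measurable_Pair1'[of y M M] measurable_compose[OF measurable_pair_swap' m]]
      measurable_compose[OF measurable_Pair2'[of y M M] m] by simp
  have m2: "(\<lambda>(w, y). F y * c w * indicator (ball w (r w)) y) \<in> borel_measurable (M \<Otimes>\<^sub>M M)"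
    using m unfolding case_prod_beta' by measurable
  have "(\<integral>\<^sup>+y. F y * (\<integral>\<^sup>+w. c w * indicator (ball w (r w)) y \<partial>M) \<partial>M) =
    (\<integral>\<^sup>+y. \<integral>\<^sup>+w. F y * c w * indicator (ball w (r w)) y \<partial>M \<partial>M)"
    using m1 by (intro nn_integral_cong) (simp add: nn_integral_cmult[symmetric] mult.assoc)
  also have "\<dots> = (\<integral>\<^sup>+w. \<integral>\<^sup>+y. F y * c w * indicator (ball w (r w)) y \<partial>M \<partial>M)"
    by (rule Fubini'[OF m2])
  also have "\<dots> = (\<integral>\<^sup>+w. c w * (\<integral>\<^sup>+y. F y * indicator (ball w (r w)) y \<partial>M) \<partial>M)"
    by (intro nn_integral_cong) (simp add: nn_integral_cmult[symmetric] mult_ac)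
  finally show ?thesis .
qed

lemma ball_integral_measurable':
  assumes "r \<in> borel_measurable M" "c \<in> borel_measurable M"
  shows "(\<lambda>y. \<integral>\<^sup>+w. c w * indicator (ball w (r w)) y \<partial>M) \<in> borel_measurable M"
proof -
  have ind: "indicator (ball w (r w)) y = (if dist w y < r w then 1 else 0::ennreal)" for w y
    by (auto simp: indicator_def)
  note [measurable] = assms
  have m: "(\<lambda>(w, y). c w * indicator (ball w (r w)) y :: ennreal) \<in> borel_measurable (M \<Otimes>\<^sub>M M)"
    unfolding ind case_prod_beta' using pred_dist_less_fst[OF assms(1), unfolded case_prod_beta'] by measurable
  from measurable_compose[OF measurable_pair_swap' this]
  show ?thesis by (intro borel_measurable_nn_integral) (simp add: case_prod_beta')
qed

lemma ball_integral_measurable: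
  assumes [measurable]: "F \<in> borel_measurable M" and r: "r \<in> borel_measurable M"
  shows "(\<lambda>w. \<integral>\<^sup>+y. F y * indicator (ball w (r w)) y \<partial>M) \<in> borel_measurable M"
proof -
  have ind: "indicator (ball w (r w)) y = (if dist w y < r w then 1 else 0::ennreal)" for w y
    by (auto simp: indicator_def)
  have "(\<lambda>(w, y). F y * indicator (ball w (r w)) y :: ennreal) \<in> borel_measurable (M \<Otimes>\<^sub>M M)"
    unfolding ind case_prod_beta' using pred_dist_less_fst[OF r, unfolded case_prod_beta'] by measurable
  then show ?thesis by (rule borel_measurable_nn_integral)
qed

text \<open>The analogue of bounded overlap. If \<open>y\<close> lies in
  \<open>ball w (a * \<delta> w)\<close>, then \<open>w\<close> lies in
  \<open>ball y (\<delta> y)\<close> and \<open>V y \<le> D * V w\<close>; so the weights of all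
  such centres add up to at most \<open>D / V y * V y\<close>.\<close>

lemma inverse_V_upper:
  assumes "a \<le> 1/2"
  shows "(\<integral>\<^sup>+w. inverse (V w) * indicator (ball w (a * \<delta> w)) y \<partial>M) \<le> ennreal D"
proof (cases "y \<in> \<Omega>")
  case False
  then have "y \<notin> ball w (a * \<delta> w)" for w using ball_\<delta>_subset[of a w] assms by auto
  then show ?thesis by simp
next
  case y: True
  have "(\<integral>\<^sup>+w. inverse (V w) * indicator (ball w (a * \<delta> w)) y \<partial>M) \<le>
      (\<integral>\<^sup>+w. ennreal D * inverse (V y) * indicator (ball y (\<delta> y)) w \<partial>M)"
  proof (rule nn_integral_mono)
    fix w
    show "inverse (V w) * indicator (ball w (a * \<delta> w)) y \<le>
        ennreal D * inverse (V y) * indicator (ball y (\<delta> y)) w"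
    proof (cases "y \<in> ball w (a * \<delta> w)")
      case True
      then have d: "dist w y < a * \<delta> w" by simp
      have "a * \<delta> w \<le> 1/2 * \<delta> w" using assms by (intro mult_right_mono) auto
      with d have d2: "dist w y < \<delta> w / 2" by simp
      then have dw: "0 < \<delta> w" using zero_le_dist[of w y] by linarith
      have "w \<in> ball y (\<delta> y)" using d2 \<delta>_lip[of w y] by (simp add: dist_commute)
      moreover have "V y \<le> ennreal (D ^ 1) * V w"
        unfolding V_def using dw d2 \<delta>_lip'[of y w] by (intro ball_le_ball) (auto simp: dist_commute)
      then have "inverse (V w) \<le> ennreal D * inverse (V y)"
        using y V_pos V_finite dw by (intro ennreal_inverse_le) (auto simp: \<delta>_pos_iff)
      ultimately show ?thesis by (simp add: indicator_def)
    qed simp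
  qed
  also have "\<dots> = ennreal D * inverse (V y) * V y"
    unfolding V_def by (subst nn_integral_cmult_indicator) auto
  also have "\<dots> = ennreal D" using V_inverse[OF y] by (simp add: mult_ac)
  finally show ?thesis .
qed

text \<open>Centres \<open>w\<close> in \<open>ball y (a / 2 * \<delta> y)\<close> satisfy
  \<open>\<delta> y / 2 \<le> \<delta> w\<close>, so their balls contain \<open>y\<close>. The
  assumption on \<open>n\<close> says that \<open>n\<close> doublings of the radius
  \<open>a / 2 * \<delta> y\<close> reach \<open>\<delta> y\<close>; the additional factor
  \<open>D\<close> compares \<open>V w\<close> with \<open>V y\<close>.\<close>

lemma inverse_V_lower:
  assumes a: "a \<le> 1/2" "2 \<le> 2 ^ n * a" and y: "y \<in> \<Omega>"
  shows "1 \<le> ennreal (D ^ Suc n) * (\<integral>\<^sup>+w. inverse (V w) * indicator (ball w (a * \<delta> w)) y \<partial>M)"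
proof -
  have a0: "0 < a" using a(2) zero_less_mult_pos[of "2 ^ n" a] by auto
  let ?B = "ball y (a / 2 * \<delta> y)"
  have dy: "0 < \<delta> y" using y \<delta>_pos_iff by auto
  have Vy: "V y \<le> ennreal (D ^ n) * emeasure M ?B"
    unfolding V_def using a a0 dy mult_right_mono[of 2 "2 ^ n * a" "\<delta> y"] by (intro ball_le_ball) auto
  have "ennreal (1 / D) * inverse (V y) * emeasure M ?B =
      (\<integral>\<^sup>+w. ennreal (1 / D) * inverse (V y) * indicator ?B w \<partial>M)"
    by (subst nn_integral_cmult_indicator) auto
  also have "\<dots> \<le> (\<integral>\<^sup>+w. inverse (V w) * indicator (ball w (a * \<delta> w)) y \<partial>M)"
  proof (rule nn_integral_mono)
    fix w
    show "ennreal (1 / D) * inverse (V y) * indicator ?B w \<le> inverse (V w) * indicator (ball w (a * \<delta> w)) y"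
    proof (cases "w \<in> ?B")
      case True
      then have d: "dist y w < a / 2 * \<delta> y" by simp
      have "a / 2 * \<delta> y \<le> 1/4 * \<delta> y" using a by (intro mult_right_mono) auto
      with d have d2: "dist y w < \<delta> y / 4" by simp
      have dw: "\<delta> y / 2 \<le> \<delta> w" using \<delta>_lip[of y w] d2 dy by linarith
      have "a * (\<delta> y / 2) \<le> a * \<delta> w" using dw a0 by (intro mult_left_mono) auto
      with d have mem: "y \<in> ball w (a * \<delta> w)" by (simp add: dist_commute)
      have "V w \<le> ennreal (D ^ 1) * V y"
        unfolding V_def using dy d2 \<delta>_lip'[of w y] by (intro ball_le_ball) (auto simp: dist_commute)
      then have "inverse (V y) \<le> ennreal D * inverse (V w)"
        using y V_pos V_finite dw dy by (intro ennreal_inverse_le) (auto simp: \<delta>_pos_iff[symmetric])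
      then have "ennreal (1 / D) * inverse (V y) \<le> ennreal (1 / D) * (ennreal D * inverse (V w))"
        by (intro mult_left_mono) auto
      also have "\<dots> = inverse (V w)"
        using D_ge_1 by (simp add: mult.assoc[symmetric] flip: ennreal_mult)
      finally have "ennreal (1 / D) * inverse (V y) \<le> inverse (V w)" .
      with mem show ?thesis by (simp add: indicator_def)
    qed simp
  qed
  finally have "ennreal (D ^ Suc n) * (ennreal (1 / D) * inverse (V y) * emeasure M ?B) \<le>
    ennreal (D ^ Suc n) * (\<integral>\<^sup>+w. inverse (V w) * indicator (ball w (a * \<delta> w)) y \<partial>M)"
    by (intro mult_left_mono) auto
  moreover have "1 \<le> ennreal (D ^ Suc n) * (ennreal (1 / D) * inverse (V y) * emeasure M ?B)"
  proof -
    have "1 = inverse (V y) * V y" using V_inverse[OF y] by (simp add: mult_ac)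
    also have "\<dots> \<le> inverse (V y) * (ennreal (D ^ n) * emeasure M ?B)" by (intro mult_left_mono Vy) simp
    also have "ennreal (D ^ n) = ennreal (D ^ Suc n) * ennreal (1 / D)"
      using D_ge_1 by (simp flip: ennreal_mult)
    finally show ?thesis by (simp add: mult_ac)
  qed
  ultimately show ?thesis by (rule order_trans[rotated])
qed

end

section \<open>Smoothing at the scale of the distance to the complement\<close>

context doubling_space
begin

lemma ball_emeasure_eq: "emeasure M (ball x r) = ennreal (measure M (ball x r))"
  using ball_finite[of x r] by (simp add: emeasure_eq_ennreal_measure less_top[symmetric])

lemma ball_measure_pos: "0 < r \<Longrightarrow> 0 < measure M (ball x r)"
  using ball_pos[of r x] unfolding ball_emeasure_eq by simp

lemma ball_measure_le:
  assumes "0 < r" "dist x y + s \<le> 2 ^ n * r"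
  shows "measure M (ball x s) \<le> D ^ n * measure M (ball y r)"
  using ball_le_ball[OF assms] D_ge_1
  by (simp add: ball_emeasure_eq ennreal_le_iff flip: ennreal_mult)

lemma integrable_indicator_ball: "integrable M (indicator (ball x r) :: 'a \<Rightarrow> real)"
  using ball_finite[of x r] by (intro integrable_real_indicator) auto

end

text \<open>\<open>oscillation\<close> is the Poincare inequality on a ball of twice the averaging
  radius, cleared of denominators and with some constant \<open>c\<close> in place of the mean. The
  doubled radius leaves room for the averaging balls of all points near \<open>p\<close>;
  \<open>\<epsilon> \<le> 1/16\<close> makes the averaging radius vary slowly from point to
  point.\<close>

locale smoothing = domain_space M D \<Omega> for M :: "'a::metric_space measure" and D \<Omega> +
  fixes u :: "'a \<Rightarrow> real" and G :: "'a \<Rightarrow> ennreal" and \<epsilon> K :: real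
  assumes u_int: "integrable M u"
    and G_meas [measurable]: "G \<in> borel_measurable M"
    and G_fin: "(\<integral>\<^sup>+z\<in>\<Omega>. G z \<partial>M) < \<infinity>"
    and eps: "0 < \<epsilon>" "\<epsilon> \<le> 1/16"
    and K: "0 \<le> K"
    and oscillation: "p \<in> \<Omega> \<Longrightarrow> \<exists>c. (\<integral>\<^sup>+y\<in>ball p (2 * (\<epsilon> * \<delta> p)). ennreal \<bar>u y - c\<bar> \<partial>M) \<le>
      ennreal (K * (\<epsilon> * \<delta> p) / measure M (ball p (\<delta> p / 8)) * measure M (ball p (2 * (\<epsilon> * \<delta> p)))) *
      (\<integral>\<^sup>+z\<in>ball p (\<delta> p / 8). G z \<partial>M)"
begin

definition \<rho> :: "'a \<Rightarrow> real" where "\<rho> p = \<epsilon> * \<delta> p"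

text \<open>A tent and not the indicator of a ball: it is Lipschitz in \<open>p\<close> as well as
  in \<open>y\<close>, and \<open>v\<close> inherits its local Lipschitz continuity from
  this.\<close>

definition kern :: "'a \<Rightarrow> 'a \<Rightarrow> real" where "kern p y = max 0 (\<rho> p - dist p y)"

definition mass :: "'a \<Rightarrow> real" where "mass p = (LINT y|M. kern p y)"

text \<open>Off \<Omega> the kernel vanishes and the quotient \<open>0 / 0\<close> is 0, which makes
  \<open>v\<close> a measurable function on the whole space.\<close>

definition v :: "'a \<Rightarrow> real" where "v p = (LINT y|M. kern p y * u y) / mass p"

definition avg :: "'a \<Rightarrow> real" where
  "avg p = enn2real (\<integral>\<^sup>+z\<in>ball p (\<delta> p / 8). G z \<partial>M) / measure M (ball p (\<delta> p / 8))"

section \<open>Local regularity of the smoothed function\<close>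

lemma \<rho>_nonneg: "0 \<le> \<rho> p" using eps by (simp add: \<rho>_def)

lemma \<rho>_pos: "p \<in> \<Omega> \<Longrightarrow> 0 < \<rho> p" using eps \<delta>_pos_iff by (simp add: \<rho>_def)

lemma \<rho>_lip: "\<rho> p \<le> \<rho> q + dist p q / 16"
proof -
  have "\<rho> p \<le> \<epsilon> * (\<delta> q + dist p q)" unfolding \<rho>_def using eps by (intro mult_left_mono \<delta>_lip) auto
  also have "\<dots> \<le> \<rho> q + 1/16 * dist p q"
    unfolding \<rho>_def distrib_left using eps by (intro add_left_mono mult_right_mono) auto
  finally show ?thesis by simp
qed

lemma \<rho>_le: "\<rho> p \<le> \<delta> p / 16"
  unfolding \<rho>_def using mult_right_mono[OF eps(2), of "\<delta> p"] by simp

lemma \<rho>_measurable [measurable]: "\<rho> \<in> borel_measurable M"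
  unfolding \<rho>_def[abs_def] by measurable

lemma kern_nonneg: "0 \<le> kern p y" by (simp add: kern_def)

lemma kern_le: "kern p y \<le> \<rho> p * indicator (ball p (\<rho> p)) y"
  using \<rho>_nonneg[of p] by (auto simp: kern_def indicator_def)

lemma kern_lip: "\<bar>kern p y - kern q y\<bar> \<le> 2 * dist p q"
proof -
  have "\<bar>\<rho> p - \<rho> q\<bar> \<le> dist p q"
    using \<rho>_lip[of p q] \<rho>_lip[of q p] zero_le_dist[of p q] unfolding dist_commute[of q p] by linarith
  moreover have "\<bar>dist p y - dist q y\<bar> \<le> dist p q" by (metis abs_dist_diff_le dist_commute)
  ultimately show ?thesis unfolding kern_def by linarith
qed

lemma kern_measurable [measurable]: "kern p \<in> borel_measurable M"
  unfolding kern_def[abs_def] by measurable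

lemma kern_integrable: "integrable M (kern p)"
proof (rule Bochner_Integration.integrable_bound)
  show "integrable M (\<lambda>y. \<rho> p * indicator (ball p (\<rho> p)) y)"
    by (intro integrable_mult_right integrable_indicator_ball)
  show "AE y in M. norm (kern p y) \<le> norm (\<rho> p * indicator (ball p (\<rho> p)) y)"
    using kern_le kern_nonneg by (intro AE_I2) (auto intro: order_trans[OF _ abs_ge_self])
qed simp

lemma u_measurable [measurable]: "u \<in> borel_measurable M" using u_int by auto

lemma kern_u_integrable: "integrable M (\<lambda>y. kern p y * u y)"
proof (rule Bochner_Integration.integrable_bound)
  show "integrable M (\<lambda>y. \<rho> p * u y)" by (intro integrable_mult_right u_int)
  have "kern p y \<le> \<rho> p" for y using \<rho>_nonneg[of p] by (simp add: kern_def)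
  then show "AE y in M. norm (kern p y * u y) \<le> norm (\<rho> p * u y)"
    using kern_nonneg \<rho>_nonneg by (intro AE_I2) (auto simp: abs_mult intro!: mult_right_mono)
qed simp

lemma mass_ge: "\<rho> p / 2 * measure M (ball p (\<rho> p / 2)) \<le> mass p"
proof -
  have "\<rho> p / 2 * measure M (ball p (\<rho> p / 2)) = (LINT y|M. \<rho> p / 2 * indicator (ball p (\<rho> p / 2)) y)"
    by simp
  also have "\<dots> \<le> mass p" unfolding mass_def
  proof (rule integral_mono)
    show "\<rho> p / 2 * indicator (ball p (\<rho> p / 2)) y \<le> kern p y" for y
      using kern_nonneg[of p y] by (auto simp: kern_def indicator_def max_def)
  qed (intro integrable_mult_right integrable_indicator_ball kern_integrable)+
  finally show ?thesis .
qed

lemma mass_pos: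
  assumes "p \<in> \<Omega>"
  shows "0 < mass p"
proof -
  have "0 < \<rho> p / 2" using \<rho>_pos[OF assms] by simp
  then have "0 < \<rho> p / 2 * measure M (ball p (\<rho> p / 2))"
    by (intro mult_pos_pos ball_measure_pos)
  then show ?thesis using mass_ge[of p] by linarith
qed

lemma mass_v: "p \<in> \<Omega> \<Longrightarrow> mass p * (v p - c) = (LINT y|M. kern p y * (u y - c))"
  using mass_pos[of p]
  by (simp add: v_def right_diff_distrib Bochner_Integration.integral_diff kern_u_integrable
      kern_integrable mass_def)

lemma abs_u_integrable: "integrable M (\<lambda>y. indicator (ball p r) y * \<bar>u y - c\<bar>)"
proof (rule Bochner_Integration.integrable_bound)
  show "integrable M (\<lambda>y. \<bar>u y\<bar> + \<bar>c\<bar> * indicator (ball p r) y)"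
    by (intro Bochner_Integration.integrable_add integrable_abs u_int integrable_mult_right
        integrable_indicator_ball)
  show "AE y in M. norm (indicator (ball p r) y * \<bar>u y - c\<bar>) \<le> norm (\<bar>u y\<bar> + \<bar>c\<bar> * indicator (ball p r) y)"
    by (intro AE_I2) (auto simp: indicator_def)
qed simp

definition osc :: "'a \<Rightarrow> real \<Rightarrow> real" where
  "osc p c = (LINT y|M. indicator (ball p (2 * \<rho> p)) y * \<bar>u y - c\<bar>)"

lemma osc_nonneg: "0 \<le> osc p c" unfolding osc_def by (rule integral_nonneg_AE) auto

lemma kern_diff_integrable: "integrable M (\<lambda>y. kern p y * (u y - c))"
  using kern_u_integrable kern_integrable by (simp add: right_diff_distrib)

lemma osc_bound:
  assumes "f \<in> borel_measurable M" "\<And>y. \<bar>f y\<bar> \<le> b * indicator (ball p (2 * \<rho> p)) y"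
  shows "\<bar>LINT y|M. f y * (u y - c)\<bar> \<le> b * osc p c"
proof -
  have le: "\<bar>f y * (u y - c)\<bar> \<le> b * (indicator (ball p (2 * \<rho> p)) y * \<bar>u y - c\<bar>)" for y
    unfolding abs_mult mult.assoc[symmetric] using assms(2) by (intro mult_right_mono) auto
  have int: "integrable M (\<lambda>y. b * (indicator (ball p (2 * \<rho> p)) y * \<bar>u y - c\<bar>))"
    by (intro integrable_mult_right abs_u_integrable)
  have int2: "integrable M (\<lambda>y. f y * (u y - c))"
    using assms(1) le by (intro Bochner_Integration.integrable_bound[OF int]) (auto intro: order_trans[OF _ abs_ge_self])
  have "\<bar>LINT y|M. f y * (u y - c)\<bar> \<le> (LINT y|M. \<bar>f y * (u y - c)\<bar>)"
    by (rule integral_abs_bound)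
  also have "\<dots> \<le> (LINT y|M. b * (indicator (ball p (2 * \<rho> p)) y * \<bar>u y - c\<bar>))"
    using le int int2 by (intro integral_mono) auto
  also have "\<dots> = b * osc p c" by (simp add: osc_def)
  finally show ?thesis .
qed

lemma near:
  assumes "dist p q < \<rho> p / 2"
  shows "\<rho> q \<le> 33 / 32 * \<rho> p" "31 / 32 * \<rho> p \<le> \<rho> q" "ball q (\<rho> q) \<subseteq> ball p (2 * \<rho> p)"
proof -
  show 1: "\<rho> q \<le> 33 / 32 * \<rho> p" and "31 / 32 * \<rho> p \<le> \<rho> q"
    using \<rho>_lip[of q p] \<rho>_lip[of p q] assms unfolding dist_commute[of q p] by linarith+
  show "ball q (\<rho> q) \<subseteq> ball p (2 * \<rho> p)"
  proof
    fix y assume "y \<in> ball q (\<rho> q)"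
    then show "y \<in> ball p (2 * \<rho> p)"
      using dist_triangle[of p y q] assms 1 zero_le_dist[of p q] unfolding mem_ball by linarith
  qed
qed

text \<open>\<open>v q - c\<close> is a weighted mean of \<open>u - c\<close> over a ball inside
  \<open>ball p (2 * \<rho> p)\<close>, hence controlled by the oscillation there. Three doublings
  of the ball of radius \<open>\<rho> q / 2\<close> around \<open>q\<close> cover
  \<open>ball p (2 * \<rho> p)\<close>; the factor 2 inverts the one half in
  \<open>mass_ge\<close>.\<close>

lemma v_near:
  assumes p: "p \<in> \<Omega>" and q: "q \<in> \<Omega>" "dist p q < \<rho> p / 2"
  shows "\<bar>v q - c\<bar> * measure M (ball p (2 * \<rho> p)) \<le> 2 * D ^ 3 * osc p c"
proof -
  note n = near[OF q(2)]
  have \<rho>q: "0 < \<rho> q" by (rule \<rho>_pos[OF q(1)])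
  have m: "measure M (ball p (2 * \<rho> p)) \<le> D ^ 3 * measure M (ball q (\<rho> q / 2))"
    using n q(2) \<rho>q by (intro ball_measure_le) auto
  have "\<rho> q / 2 * measure M (ball q (\<rho> q / 2)) * \<bar>v q - c\<bar> \<le> mass q * \<bar>v q - c\<bar>"
    by (intro mult_right_mono mass_ge) simp
  also have "\<dots> = \<bar>mass q * (v q - c)\<bar>" using mass_pos[OF q(1)] by (simp add: abs_mult)
  also have "\<dots> \<le> \<rho> q * osc p c"
    unfolding mass_v[OF q(1)]
  proof (rule osc_bound)
    show "\<bar>kern q y\<bar> \<le> \<rho> q * indicator (ball p (2 * \<rho> p)) y" for y
    proof -
      have "\<rho> q * indicator (ball q (\<rho> q)) y \<le> \<rho> q * indicator (ball p (2 * \<rho> p)) y"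
        using n(3) \<rho>q by (intro mult_left_mono) (auto simp: indicator_def)
      then show ?thesis using kern_le[of q y] kern_nonneg[of q y] by linarith
    qed
  qed simp
  finally have "\<rho> q * (measure M (ball q (\<rho> q / 2)) * \<bar>v q - c\<bar>) \<le> \<rho> q * (2 * osc p c)" by simp
  then have *: "measure M (ball q (\<rho> q / 2)) * \<bar>v q - c\<bar> \<le> 2 * osc p c" using \<rho>q by simp
  have "\<bar>v q - c\<bar> * measure M (ball p (2 * \<rho> p)) \<le> \<bar>v q - c\<bar> * (D ^ 3 * measure M (ball q (\<rho> q / 2)))"
    by (intro mult_left_mono m) simp
  also have "\<dots> = D ^ 3 * (measure M (ball q (\<rho> q / 2)) * \<bar>v q - c\<bar>)" by simp
  also have "\<dots> \<le> D ^ 3 * (2 * osc p c)" using D_ge_1 by (intro mult_left_mono *) auto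
  finally show ?thesis by simp
qed

lemma G_ball_finite: "(\<integral>\<^sup>+z\<in>ball p (\<delta> p / 8). G z \<partial>M) < \<infinity>"
proof -
  have "(\<integral>\<^sup>+z\<in>ball p (\<delta> p / 8). G z \<partial>M) \<le> (\<integral>\<^sup>+z\<in>\<Omega>. G z \<partial>M)"
    using ball_\<delta>_subset[of "1/8" p] by (intro nn_integral_mono mult_left_mono) (auto simp: indicator_def)
  then show ?thesis using G_fin by (rule order_le_less_trans)
qed

lemma osc_small:
  assumes "p \<in> \<Omega>"
  shows "\<exists>c. osc p c \<le> K * \<rho> p * avg p * measure M (ball p (2 * \<rho> p))"
proof -
  obtain c where c: "(\<integral>\<^sup>+y\<in>ball p (2 * \<rho> p). ennreal \<bar>u y - c\<bar> \<partial>M) \<le>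
      ennreal (K * \<rho> p / measure M (ball p (\<delta> p / 8)) * measure M (ball p (2 * \<rho> p))) *
      (\<integral>\<^sup>+z\<in>ball p (\<delta> p / 8). G z \<partial>M)"
    using oscillation[OF assms] unfolding \<rho>_def by blast
  have "ennreal (osc p c) = (\<integral>\<^sup>+y. ennreal (indicator (ball p (2 * \<rho> p)) y * \<bar>u y - c\<bar>) \<partial>M)"
    unfolding osc_def by (intro nn_integral_eq_integral[symmetric] abs_u_integrable) auto
  also have "\<dots> = (\<integral>\<^sup>+y\<in>ball p (2 * \<rho> p). ennreal \<bar>u y - c\<bar> \<partial>M)"
    by (intro nn_integral_cong) (auto simp: indicator_def)
  also note c
  also have "(\<integral>\<^sup>+z\<in>ball p (\<delta> p / 8). G z \<partial>M) = ennreal (enn2real (\<integral>\<^sup>+z\<in>ball p (\<delta> p / 8). G z \<partial>M))"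
    using G_ball_finite[of p] by simp
  also have "ennreal (K * \<rho> p / measure M (ball p (\<delta> p / 8)) * measure M (ball p (2 * \<rho> p))) * \<dots> =
      ennreal (K * \<rho> p * avg p * measure M (ball p (2 * \<rho> p)))"
    using K \<rho>_nonneg[of p] unfolding avg_def by (subst ennreal_mult[symmetric]) (auto simp: mult_ac)
  finally have "osc p c \<le> K * \<rho> p * avg p * measure M (ball p (2 * \<rho> p))"
    using K \<rho>_nonneg[of p] by (subst (asm) ennreal_le_iff) (auto simp: avg_def)
  then show ?thesis by blast
qed

text \<open>One factor 2 is the Lipschitz constant of the tent, the other inverts the one half in
  \<open>mass_ge\<close>. \<open>D ^ 2\<close> compares the balls of radius
  \<open>2 * \<rho> p\<close> and \<open>\<rho> p / 2\<close>. The summands 1 and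
  \<open>2 * D ^ 3\<close> come from varying the kernel in the numerator of \<open>v\<close> and in
  its mass.\<close>

definition "lip_const = 4 * D ^ 2 * (1 + 2 * D ^ 3) * K"

lemma lip_const_nonneg: "0 \<le> lip_const" using K D_ge_1 by (simp add: lip_const_def)

lemma avg_nonneg: "0 \<le> avg p" by (simp add: avg_def)

text \<open>After subtraction of \<open>c\<close>, only the oscillation of \<open>u\<close> is
  tested against differences of kernels, which are of size \<open>dist p q\<close>. The oscillation
  is at most a multiple of \<open>\<rho> p * avg p\<close> times the volume, while
  \<open>mass p\<close> is at least a multiple of \<open>\<rho> p\<close> times the volume, so the
  radius cancels.\<close>

lemma v_local_lipschitz:
  assumes p: "p \<in> \<Omega>" and q: "q \<in> \<Omega>" "dist p q < \<rho> p / 2"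
  shows "\<bar>v p - v q\<bar> \<le> lip_const * avg p * dist p q"
proof -
  let ?m = "measure M (ball p (2 * \<rho> p))"
  obtain c where c: "osc p c \<le> K * \<rho> p * avg p * ?m" using osc_small[OF p] by blast
  have \<rho>p: "0 < \<rho> p" by (rule \<rho>_pos[OF p])
  have m: "0 < ?m" using \<rho>p by (intro ball_measure_pos) simp
  have m2: "?m \<le> D ^ 2 * measure M (ball p (\<rho> p / 2))"
    using \<rho>p by (intro ball_measure_le) auto
  have supp: "\<bar>kern p y - kern q y\<bar> \<le> 2 * dist p q * indicator (ball p (2 * \<rho> p)) y" for y
  proof (cases "y \<in> ball p (2 * \<rho> p)")
    case False
    then have "y \<notin> ball q (\<rho> q)" "y \<notin> ball p (\<rho> p)" using near(3)[OF q(2)] \<rho>p by auto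
    then have "kern q y = 0" "kern p y = 0" by (auto simp: kern_def)
    then show ?thesis using False by simp
  qed (use kern_lip in simp)
  \<comment> \<open>The two means have different normalizations; the last summand accounts for
    replacing \<open>mass q\<close> by \<open>mass p\<close>.\<close>
  have "mass p * (v p - v q) = mass p * (v p - c) - mass q * (v q - c) + (mass q - mass p) * (v q - c)"
    by (simp add: algebra_simps)
  also have "mass p * (v p - c) - mass q * (v q - c) = (LINT y|M. (kern p y - kern q y) * (u y - c))"
    unfolding mass_v[OF p] mass_v[OF q(1)] left_diff_distrib
    by (rule Bochner_Integration.integral_diff[symmetric]) (rule kern_diff_integrable)+
  finally have "\<bar>mass p * (v p - v q)\<bar> \<le>
      \<bar>LINT y|M. (kern p y - kern q y) * (u y - c)\<bar> + \<bar>(mass q - mass p) * (v q - c)\<bar>"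
    by (simp add: abs_triangle_ineq)
  also have "\<bar>LINT y|M. (kern p y - kern q y) * (u y - c)\<bar> \<le> 2 * dist p q * osc p c"
    using supp by (intro osc_bound) auto
  also have "\<bar>(mass q - mass p) * (v q - c)\<bar> \<le> 2 * dist p q * (2 * D ^ 3 * osc p c)"
  proof -
    have "\<bar>mass q - mass p\<bar> = \<bar>LINT y|M. kern p y - kern q y\<bar>"
      unfolding mass_def using kern_integrable by (simp add: Bochner_Integration.integral_diff abs_minus_commute)
    also have "\<dots> \<le> (LINT y|M. \<bar>kern p y - kern q y\<bar>)" by (rule integral_abs_bound)
    also have "\<dots> \<le> (LINT y|M. 2 * dist p q * indicator (ball p (2 * \<rho> p)) y)"
      using supp kern_integrable integrable_indicator_ball by (intro integral_mono) auto
    also have "\<dots> = 2 * dist p q * ?m" by simp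
    finally have "\<bar>mass q - mass p\<bar> * \<bar>v q - c\<bar> \<le> 2 * dist p q * ?m * \<bar>v q - c\<bar>"
      by (intro mult_right_mono) auto
    also have "\<dots> = 2 * dist p q * (\<bar>v q - c\<bar> * ?m)" by simp
    also have "\<dots> \<le> 2 * dist p q * (2 * D ^ 3 * osc p c)"
      by (intro mult_left_mono v_near[OF p q]) simp
    finally show ?thesis by (simp add: abs_mult)
  qed
  finally have "\<bar>mass p * (v p - v q)\<bar> \<le> 2 * dist p q * (1 + 2 * D ^ 3) * osc p c"
    by (simp add: algebra_simps)
  also have "\<dots> \<le> 2 * dist p q * (1 + 2 * D ^ 3) * (K * \<rho> p * avg p * ?m)"
    using D_ge_1 by (intro mult_left_mono c) auto
  also have "\<dots> \<le> 2 * dist p q * (1 + 2 * D ^ 3) * (K * \<rho> p * avg p * (D ^ 2 * measure M (ball p (\<rho> p / 2))))"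
    using D_ge_1 K \<rho>p avg_nonneg by (intro mult_left_mono m2) auto
  also have "\<dots> = (\<rho> p / 2 * measure M (ball p (\<rho> p / 2))) * (lip_const * avg p * dist p q)"
    by (simp add: lip_const_def)
  finally have "\<bar>mass p * (v p - v q)\<bar> \<le> \<dots>" .
  moreover have "(\<rho> p / 2 * measure M (ball p (\<rho> p / 2))) * \<bar>v p - v q\<bar> \<le> \<bar>mass p * (v p - v q)\<bar>"
    using mass_pos[OF p] unfolding abs_mult by (intro mult_right_mono) (use mass_ge[of p] in auto)
  ultimately have "(\<rho> p / 2 * measure M (ball p (\<rho> p / 2))) * \<bar>v p - v q\<bar> \<le>
      (\<rho> p / 2 * measure M (ball p (\<rho> p / 2))) * (lip_const * avg p * dist p q)" by linarith
  then show ?thesis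
    using \<rho>p ball_measure_pos[of "\<rho> p / 2" p] by (simp add: mult_le_cancel_left_pos)
qed

lemma v_zero: "p \<notin> \<Omega> \<Longrightarrow> v p = 0"
proof -
  assume "p \<notin> \<Omega>"
  then have "kern p y = 0" for y using \<delta>_eq_0[of p] by (simp add: kern_def \<rho>_def)
  then show ?thesis by (simp add: v_def)
qed

lemma v_continuous: "continuous_on \<Omega> v"
  unfolding continuous_on_iff
proof (intro ballI allI impI)
  fix p and e :: real assume p: "p \<in> \<Omega>" and e: "0 < e"
  define L where "L = lip_const * avg p + 1"
  have L: "0 < L" using lip_const_nonneg avg_nonneg[of p] by (simp add: L_def add_nonneg_pos)
  show "\<exists>d>0. \<forall>q\<in>\<Omega>. dist q p < d \<longrightarrow> dist (v q) (v p) < e"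
  proof (intro exI[of _ "min (\<rho> p / 2) (e / L)"] conjI ballI impI)
    show "0 < min (\<rho> p / 2) (e / L)" using \<rho>_pos[OF p] e L by simp
    fix q assume q: "q \<in> \<Omega>" "dist q p < min (\<rho> p / 2) (e / L)"
    have "dist (v q) (v p) = \<bar>v p - v q\<bar>" by (simp add: dist_real_def)
    also have "\<dots> \<le> lip_const * avg p * dist p q"
      using q by (intro v_local_lipschitz p) (auto simp: dist_commute)
    also have "\<dots> \<le> L * dist p q" by (intro mult_right_mono) (auto simp: L_def)
    also have "\<dots> < L * (e / L)" using q L by (intro mult_strict_left_mono) (auto simp: dist_commute)
    finally show "dist (v q) (v p) < e" using L by simp
  qed
qed

lemma v_measurable [measurable]: "v \<in> borel_measurable M"
proof -
  have "(\<lambda>x. indicator \<Omega> x *\<^sub>R v x) \<in> borel_measurable borel"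
    using borel_measurable_continuous_on_indicator[OF _ v_continuous] open_dom by auto
  moreover have "(\<lambda>x. indicator \<Omega> x *\<^sub>R v x) = v" using v_zero by (intro ext) (auto simp: indicator_def)
  ultimately show ?thesis by (auto intro: measurable_from_borel)
qed

text \<open>On the small ball \<open>u\<close> and \<open>v\<close> are close to the same constant
  \<open>c\<close>: \<open>u\<close> in the mean by \<open>osc_small\<close>, \<open>v\<close>
  pointwise by \<open>v_near\<close>. As \<open>2 * \<rho> w \<le> \<delta> w / 8\<close>, the
  volume in \<open>osc_small\<close> is absorbed by the denominator of \<open>avg w\<close>, which
  leaves a plain integral of \<open>G\<close>.\<close>

lemma v_approx:
  assumes w: "w \<in> \<Omega>"
  shows "(\<integral>\<^sup>+y\<in>ball w (\<rho> w / 2). ennreal \<bar>u y - v y\<bar> \<partial>M) \<le>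
    ennreal ((1 + 2 * D ^ 3) * K * \<rho> w) * (\<integral>\<^sup>+z\<in>ball w (\<delta> w / 8). G z \<partial>M)"
proof -
  let ?m = "measure M (ball w (2 * \<rho> w))"
  obtain c where c: "osc w c \<le> K * \<rho> w * avg w * ?m" using osc_small[OF w] by blast
  have \<rho>w: "0 < \<rho> w" by (rule \<rho>_pos[OF w])
  have m: "0 < ?m" using \<rho>w by (intro ball_measure_pos) simp
  have "ball w (\<rho> w / 2) \<subseteq> ball w (1/2 * \<delta> w)"
    using \<rho>_le[of w] \<delta>_nonneg[of w] by (intro subset_ball) linarith
  then have sub: "ball w (\<rho> w / 2) \<subseteq> \<Omega>" using ball_\<delta>_subset[of "1/2" w] by auto
  have pt: "indicator (ball w (\<rho> w / 2)) y * \<bar>u y - v y\<bar> \<le>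
     indicator (ball w (2 * \<rho> w)) y * \<bar>u y - c\<bar> + 2 * D ^ 3 * osc w c / ?m * indicator (ball w (2 * \<rho> w)) y" for y
  proof (cases "y \<in> ball w (\<rho> w / 2)")
    case True
    then have "\<bar>v y - c\<bar> * ?m \<le> 2 * D ^ 3 * osc w c" using w sub by (intro v_near) auto
    then have "\<bar>v y - c\<bar> \<le> 2 * D ^ 3 * osc w c / ?m" using m by (simp add: pos_le_divide_eq)
    moreover have "y \<in> ball w (2 * \<rho> w)" using True \<rho>w by simp
    ultimately show ?thesis using True by simp
  qed (use osc_nonneg[of w c] D_ge_1 in auto)
  have "(\<integral>\<^sup>+y\<in>ball w (\<rho> w / 2). ennreal \<bar>u y - v y\<bar> \<partial>M) =
      (\<integral>\<^sup>+y. ennreal (indicator (ball w (\<rho> w / 2)) y * \<bar>u y - v y\<bar>) \<partial>M)"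
    by (intro nn_integral_cong) (auto simp: indicator_def)
  also have "\<dots> \<le> (\<integral>\<^sup>+y. ennreal (indicator (ball w (2 * \<rho> w)) y * \<bar>u y - c\<bar> +
       2 * D ^ 3 * osc w c / ?m * indicator (ball w (2 * \<rho> w)) y) \<partial>M)"
    using pt by (intro nn_integral_mono ennreal_leI)
  also have "\<dots> = ennreal (LINT y|M. indicator (ball w (2 * \<rho> w)) y * \<bar>u y - c\<bar> +
       2 * D ^ 3 * osc w c / ?m * indicator (ball w (2 * \<rho> w)) y)"
    using osc_nonneg[of w c] D_ge_1
    by (intro nn_integral_eq_integral Bochner_Integration.integrable_add abs_u_integrable integrable_mult_right
        integrable_indicator_ball AE_I2 add_nonneg_nonneg mult_nonneg_nonneg) auto
  also have "\<dots> = ennreal (osc w c + 2 * D ^ 3 * osc w c / ?m * ?m)"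
    unfolding osc_def
    by (subst Bochner_Integration.integral_add)
       (auto intro!: abs_u_integrable integrable_mult_right integrable_indicator_ball)
  also have "\<dots> = ennreal ((1 + 2 * D ^ 3) * osc w c)" using m by (simp add: algebra_simps)
  also have "\<dots> \<le> ennreal ((1 + 2 * D ^ 3) * (K * \<rho> w * enn2real (\<integral>\<^sup>+z\<in>ball w (\<delta> w / 8). G z \<partial>M)))"
  proof (intro ennreal_leI mult_left_mono order_trans[OF c])
    let ?g = "enn2real (\<integral>\<^sup>+z\<in>ball w (\<delta> w / 8). G z \<partial>M)"
    let ?m' = "measure M (ball w (\<delta> w / 8))"
    have "0 < \<delta> w" using w \<delta>_pos_iff by simp
    then have m': "0 < ?m'" by (intro ball_measure_pos) simp
    have "?m \<le> ?m'"
      using \<rho>_le[of w] ball_finite[of w "\<delta> w / 8"]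
      by (intro measure_mono_fmeasurable subset_ball) (auto simp: fmeasurable_def)
    then have "avg w * ?m \<le> avg w * ?m'" by (intro mult_left_mono avg_nonneg)
    also have "\<dots> = ?g" using m' by (simp add: avg_def)
    finally have "K * \<rho> w * (avg w * ?m) \<le> K * \<rho> w * ?g"
      using K \<rho>w by (intro mult_left_mono) auto
    then show "K * \<rho> w * avg w * ?m \<le> K * \<rho> w * ?g" by (simp add: mult_ac)
  qed (use D_ge_1 in auto)
  also have "\<dots> = ennreal ((1 + 2 * D ^ 3) * K * \<rho> w) * ennreal (enn2real (\<integral>\<^sup>+z\<in>ball w (\<delta> w / 8). G z \<partial>M))"
    using K \<rho>w D_ge_1 by (subst ennreal_mult[symmetric]) (auto simp: mult_ac)
  also have "ennreal (enn2real (\<integral>\<^sup>+z\<in>ball w (\<delta> w / 8). G z \<partial>M)) = (\<integral>\<^sup>+z\<in>ball w (\<delta> w / 8). G z \<partial>M)"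
    using G_ball_finite[of w] by simp
  finally show ?thesis .
qed

end

section \<open>Integral estimates for the smoothed function and its gradient\<close>

context smoothing
begin

text \<open>\<open>n\<close> counts the doublings from radius \<open>\<rho> q / 2\<close> to
  \<open>\<delta> q\<close>. They express the mean over the averaging ball through the weight
  \<open>1 / V q\<close>, to which \<open>tonelli_balls\<close> and \<open>inverse_V_upper\<close>
  apply.\<close>

lemma v_pointwise:
  assumes n: "2 \<le> 2 ^ n * \<epsilon>" and q: "q \<in> \<Omega>"
  shows "ennreal \<bar>v q\<bar> \<le> ennreal (2 * D ^ n) *
    (inverse (V q) * (\<integral>\<^sup>+y. ennreal \<bar>u y\<bar> * indicator (ball q (\<epsilon> * \<delta> q)) y \<partial>M))"
proof -
  define U where "U = (LINT y|M. indicator (ball q (\<rho> q)) y * \<bar>u y\<bar>)"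
  have Uint: "integrable M (\<lambda>y. indicator (ball q (\<rho> q)) y * \<bar>u y\<bar>)"
    using abs_u_integrable[of q "\<rho> q" 0] by simp
  have U: "ennreal U = (\<integral>\<^sup>+y. ennreal \<bar>u y\<bar> * indicator (ball q (\<epsilon> * \<delta> q)) y \<partial>M)"
  proof -
    have "ennreal U = (\<integral>\<^sup>+y. ennreal (indicator (ball q (\<rho> q)) y * \<bar>u y\<bar>) \<partial>M)"
      unfolding U_def by (intro nn_integral_eq_integral[symmetric] Uint) auto
    also have "\<dots> = (\<integral>\<^sup>+y. ennreal \<bar>u y\<bar> * indicator (ball q (\<epsilon> * \<delta> q)) y \<partial>M)"
      by (intro nn_integral_cong) (auto simp: indicator_def \<rho>_def)
    finally show ?thesis .
  qed
  have U0: "0 \<le> U" unfolding U_def by (rule integral_nonneg_AE) auto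
  let ?m = "measure M (ball q (\<rho> q / 2))"
  have \<rho>q: "0 < \<rho> q" by (rule \<rho>_pos[OF q])
  have "\<rho> q / 2 * ?m * \<bar>v q\<bar> \<le> mass q * \<bar>v q\<bar>" by (intro mult_right_mono mass_ge) simp
  also have "\<dots> = \<bar>LINT y|M. kern q y * u y\<bar>"
    using mass_pos[OF q] by (simp add: v_def abs_mult)
  also have "\<dots> \<le> (LINT y|M. \<bar>kern q y * u y\<bar>)" by (rule integral_abs_bound)
  also have "\<dots> \<le> (LINT y|M. \<rho> q * (indicator (ball q (\<rho> q)) y * \<bar>u y\<bar>))"
  proof (rule integral_mono)
    show "integrable M (\<lambda>y. \<bar>kern q y * u y\<bar>)" by (intro integrable_abs kern_u_integrable)
    show "integrable M (\<lambda>y. \<rho> q * (indicator (ball q (\<rho> q)) y * \<bar>u y\<bar>))"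
      by (intro integrable_mult_right Uint)
    show "\<bar>kern q y * u y\<bar> \<le> \<rho> q * (indicator (ball q (\<rho> q)) y * \<bar>u y\<bar>)" for y
      using mult_right_mono[OF kern_le[of q y], of "\<bar>u y\<bar>"] kern_nonneg[of q y] by (simp add: abs_mult mult.assoc)
  qed
  also have "\<dots> = \<rho> q * U" by (simp add: U_def)
  finally have "\<rho> q * (?m * \<bar>v q\<bar>) \<le> \<rho> q * (2 * U)" by simp
  then have 1: "?m * \<bar>v q\<bar> \<le> 2 * U" using \<rho>q by simp
  have "measure M (ball q (\<delta> q)) \<le> D ^ n * ?m"
    using \<rho>q mult_right_mono[OF n, of "\<delta> q"] by (intro ball_measure_le) (auto simp: \<rho>_def)
  then have "measure M (ball q (\<delta> q)) * \<bar>v q\<bar> \<le> D ^ n * ?m * \<bar>v q\<bar>" by (intro mult_right_mono) auto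
  also have "\<dots> = D ^ n * (?m * \<bar>v q\<bar>)" by simp
  also have "\<dots> \<le> D ^ n * (2 * U)" using D_ge_1 by (intro mult_left_mono 1) auto
  finally have "ennreal (measure M (ball q (\<delta> q)) * \<bar>v q\<bar>) \<le> ennreal (2 * D ^ n * U)"
    by (intro ennreal_leI) (simp add: mult_ac)
  then have 2: "V q * ennreal \<bar>v q\<bar> \<le> ennreal (2 * D ^ n) * ennreal U"
    unfolding V_def ball_emeasure_eq using D_ge_1 U0 by (simp add: ennreal_mult)
  have "ennreal \<bar>v q\<bar> = inverse (V q) * (V q * ennreal \<bar>v q\<bar>)"
    using V_inverse[OF q] by (simp add: mult.assoc[symmetric] mult.commute[of "inverse _"])
  also have "\<dots> \<le> inverse (V q) * (ennreal (2 * D ^ n) * ennreal U)"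
    by (intro mult_left_mono 2) simp
  finally show ?thesis by (simp add: U mult_ac)
qed

lemma v_L1:
  assumes n: "2 \<le> 2 ^ n * \<epsilon>"
  shows "(\<integral>\<^sup>+q. ennreal \<bar>v q\<bar> \<partial>M) \<le> ennreal (2 * D ^ Suc n) * (\<integral>\<^sup>+y. ennreal \<bar>u y\<bar> \<partial>M)"
proof -
  have [measurable]: "(\<lambda>q. \<epsilon> * \<delta> q) \<in> borel_measurable M" by measurable
  have m: "(\<lambda>q. inverse (V q) * (\<integral>\<^sup>+y. ennreal \<bar>u y\<bar> * indicator (ball q (\<epsilon> * \<delta> q)) y \<partial>M)) \<in> borel_measurable M"
    using ball_integral_measurable[of "\<lambda>y. ennreal \<bar>u y\<bar>" "\<lambda>q. \<epsilon> * \<delta> q"]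
    by (intro borel_measurable_times_ennreal) auto
  have "(\<integral>\<^sup>+q. ennreal \<bar>v q\<bar> \<partial>M) \<le> (\<integral>\<^sup>+q. ennreal (2 * D ^ n) *
      (inverse (V q) * (\<integral>\<^sup>+y. ennreal \<bar>u y\<bar> * indicator (ball q (\<epsilon> * \<delta> q)) y \<partial>M)) \<partial>M)"
  proof (rule nn_integral_mono)
    fix q
    show "ennreal \<bar>v q\<bar> \<le> ennreal (2 * D ^ n) *
      (inverse (V q) * (\<integral>\<^sup>+y. ennreal \<bar>u y\<bar> * indicator (ball q (\<epsilon> * \<delta> q)) y \<partial>M))"
      using v_pointwise[OF n] v_zero[of q] by (cases "q \<in> \<Omega>") auto
  qed
  also have "\<dots> = ennreal (2 * D ^ n) * (\<integral>\<^sup>+q.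
      inverse (V q) * (\<integral>\<^sup>+y. ennreal \<bar>u y\<bar> * indicator (ball q (\<epsilon> * \<delta> q)) y \<partial>M) \<partial>M)"
    by (intro nn_integral_cmult m)
  also have "\<dots> = ennreal (2 * D ^ n) * (\<integral>\<^sup>+y. ennreal \<bar>u y\<bar> *
      (\<integral>\<^sup>+q. inverse (V q) * indicator (ball q (\<epsilon> * \<delta> q)) y \<partial>M) \<partial>M)"
    by (subst tonelli_balls) auto
  also have "\<dots> \<le> ennreal (2 * D ^ n) * (\<integral>\<^sup>+y. ennreal \<bar>u y\<bar> * ennreal D \<partial>M)"
    using eps by (intro mult_left_mono nn_integral_mono inverse_V_upper) auto
  also have "\<dots> = ennreal (2 * D ^ n) * ((\<integral>\<^sup>+y. ennreal \<bar>u y\<bar> \<partial>M) * ennreal D)"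
    by (subst nn_integral_multc) auto
  also have "\<dots> = ennreal (2 * D ^ Suc n) * (\<integral>\<^sup>+y. ennreal \<bar>u y\<bar> \<partial>M)"
    using D_ge_1 by (simp add: ennreal_mult mult_ac)
  finally show ?thesis .
qed

text \<open>The left-hand side is spread over balls of radius
  \<open>\<epsilon>/2 * \<delta> w\<close> by \<open>inverse_V_lower\<close>, estimated ball by ball
  by \<open>v_approx\<close>, and collected over balls of radius \<open>\<delta> w / 8\<close> by
  \<open>inverse_V_upper\<close>. Since \<open>x\<close> lies outside \<Omega>,
  \<open>\<delta> w \<le> dist w x\<close>; so a ball meeting \<open>ball x r\<close> has averaging
  radius at most \<open>r\<close>, which is the factor gained, and its enlargement stays in
  \<open>ball x (2 * r)\<close>.\<close>

lemma boundary_approx: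
  assumes n: "4 \<le> 2 ^ n * \<epsilon>" and x: "x \<notin> \<Omega>" and r: "0 < r"
  shows "(\<integral>\<^sup>+y\<in>ball x r \<inter> \<Omega>. ennreal \<bar>u y - v y\<bar> \<partial>M) \<le>
    ennreal (D ^ (n + 2) * ((1 + 2 * D ^ 3) * K) * r) * (\<integral>\<^sup>+z\<in>ball x (2 * r) \<inter> \<Omega>. G z \<partial>M)"
proof -
  let ?F = "\<lambda>y. ennreal \<bar>u y - v y\<bar> * indicator (ball x r \<inter> \<Omega>) y"
  let ?G = "\<lambda>z. G z * indicator (ball x (2 * r) \<inter> \<Omega>) z"
  let ?C = "(1 + 2 * D ^ 3) * K"
  have [measurable]: "(\<lambda>q. a * \<delta> q) \<in> borel_measurable M" for a by measurable
  have inner: "(\<integral>\<^sup>+y. ?F y * indicator (ball w (\<epsilon>/2 * \<delta> w)) y \<partial>M) \<le>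
      ennreal (?C * r) * (\<integral>\<^sup>+z. ?G z * indicator (ball w (1/8 * \<delta> w)) z \<partial>M)" for w
  proof (cases "ball x r \<inter> ball w (\<epsilon>/2 * \<delta> w) = {}")
    case True
    then have "?F y * indicator (ball w (\<epsilon>/2 * \<delta> w)) y = 0" for y
      by (cases "y \<in> ball x r") (auto simp: indicator_def)
    then have "(\<integral>\<^sup>+y. ?F y * indicator (ball w (\<epsilon>/2 * \<delta> w)) y \<partial>M) = (\<integral>\<^sup>+y. 0 \<partial>M)"
      by (intro nn_integral_cong)
    then show ?thesis by simp
  next
    case False
    then obtain y where y: "dist x y < r" "dist w y < \<epsilon>/2 * \<delta> w" by auto
    have e: "\<epsilon>/2 * \<delta> w \<le> \<delta> w / 32" using \<rho>_le[of w] by (simp add: \<rho>_def)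
    have dw: "\<delta> w \<le> dist w x" by (rule \<delta>_le_dist[OF x])
    have "dist w x < r + \<delta> w / 32"
      using y e dist_triangle[of w x y] by (simp add: dist_commute)
    \<comment> \<open>From \<open>\<delta> w \<le> dist w x < r + \<delta> w / 32\<close>. The
      enlarged ball then reaches at most \<open>(1 + 1/8) * 32/31 * r\<close> from \<open>x\<close>,
      which is below \<open>2 * r\<close>.\<close>
    with dw have wr: "dist w x < 32 / 31 * r" "\<delta> w < 32/31 * r" by linarith+
    have "0 < \<delta> w" using y(2) e zero_le_dist[of w y] by linarith
    then have w: "w \<in> \<Omega>" by (simp add: \<delta>_pos_iff)
    have "(\<integral>\<^sup>+y. ?F y * indicator (ball w (\<epsilon>/2 * \<delta> w)) y \<partial>M) \<le>
        (\<integral>\<^sup>+y\<in>ball w (\<rho> w / 2). ennreal \<bar>u y - v y\<bar> \<partial>M)"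
      by (intro nn_integral_mono) (auto simp: indicator_def \<rho>_def)
    also have "\<dots> \<le> ennreal (?C * \<rho> w) * (\<integral>\<^sup>+z\<in>ball w (\<delta> w / 8). G z \<partial>M)"
      by (rule v_approx[OF w])
    also have "\<dots> \<le> ennreal (?C * r) * (\<integral>\<^sup>+z. ?G z * indicator (ball w (1/8 * \<delta> w)) z \<partial>M)"
    proof (rule mult_mono)
      have "\<rho> w \<le> r" using \<rho>_le[of w] wr r by linarith
      then show "ennreal (?C * \<rho> w) \<le> ennreal (?C * r)"
        using K D_ge_1 by (intro ennreal_leI mult_left_mono) auto
      show "(\<integral>\<^sup>+z\<in>ball w (\<delta> w / 8). G z \<partial>M) \<le> (\<integral>\<^sup>+z. ?G z * indicator (ball w (1/8 * \<delta> w)) z \<partial>M)"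
      proof (rule nn_integral_mono)
        fix z
        have "z \<in> ball x (2 * r) \<inter> \<Omega>" if "z \<in> ball w (\<delta> w / 8)"
        proof
          show "z \<in> ball x (2 * r)"
            using that wr r dist_triangle[of x z w] unfolding mem_ball dist_commute[of x w] by linarith
          show "z \<in> \<Omega>" using that ball_\<delta>_subset[of "1/8" w] by auto
        qed
        then show "G z * indicator (ball w (\<delta> w / 8)) z \<le> ?G z * indicator (ball w (1/8 * \<delta> w)) z"
          by (cases "z \<in> ball w (\<delta> w / 8)") auto
      qed
    qed auto
    finally show ?thesis .
  qed
  have m: "(\<lambda>w. inverse (V w) * (\<integral>\<^sup>+z. ?G z * indicator (ball w (1/8 * \<delta> w)) z \<partial>M)) \<in> borel_measurable M"
    using ball_integral_measurable[of ?G "\<lambda>w. 1/8 * \<delta> w"]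
    by (intro borel_measurable_times_ennreal) auto
  have "(\<integral>\<^sup>+y. ?F y \<partial>M) \<le> (\<integral>\<^sup>+y. ?F y * (ennreal (D ^ Suc n) *
      (\<integral>\<^sup>+w. inverse (V w) * indicator (ball w (\<epsilon>/2 * \<delta> w)) y \<partial>M)) \<partial>M)"
  proof (rule nn_integral_mono)
    fix y
    have "1 \<le> ennreal (D ^ Suc n) * (\<integral>\<^sup>+w. inverse (V w) * indicator (ball w (\<epsilon>/2 * \<delta> w)) y \<partial>M)"
      if "y \<in> \<Omega>"
      using n eps that by (intro inverse_V_lower) auto
    then show "?F y \<le> ?F y * (ennreal (D ^ Suc n) *
      (\<integral>\<^sup>+w. inverse (V w) * indicator (ball w (\<epsilon>/2 * \<delta> w)) y \<partial>M))"
      using mult_left_mono[of 1 _ "?F y"] by (cases "y \<in> \<Omega>") auto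
  qed
  also have "\<dots> = ennreal (D ^ Suc n) * (\<integral>\<^sup>+y. ?F y *
      (\<integral>\<^sup>+w. inverse (V w) * indicator (ball w (\<epsilon>/2 * \<delta> w)) y \<partial>M) \<partial>M)"
    using ball_integral_measurable'[of "\<lambda>w. \<epsilon>/2 * \<delta> w" "\<lambda>w. inverse (V w)"]
    by (subst nn_integral_cmult[symmetric]) (auto simp: mult_ac)
  also have "(\<integral>\<^sup>+y. ?F y * (\<integral>\<^sup>+w. inverse (V w) * indicator (ball w (\<epsilon>/2 * \<delta> w)) y \<partial>M) \<partial>M) =
      (\<integral>\<^sup>+w. inverse (V w) * (\<integral>\<^sup>+y. ?F y * indicator (ball w (\<epsilon>/2 * \<delta> w)) y \<partial>M) \<partial>M)"
    by (intro tonelli_balls) auto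
  also have "\<dots> \<le> (\<integral>\<^sup>+w. inverse (V w) * (ennreal (?C * r) *
      (\<integral>\<^sup>+z. ?G z * indicator (ball w (1/8 * \<delta> w)) z \<partial>M)) \<partial>M)"
    by (intro nn_integral_mono mult_left_mono inner) simp
  also have "\<dots> = ennreal (?C * r) * (\<integral>\<^sup>+w. inverse (V w) *
      (\<integral>\<^sup>+z. ?G z * indicator (ball w (1/8 * \<delta> w)) z \<partial>M) \<partial>M)"
    using m by (subst nn_integral_cmult[symmetric]) (auto simp: mult_ac)
  also have "(\<integral>\<^sup>+w. inverse (V w) * (\<integral>\<^sup>+z. ?G z * indicator (ball w (1/8 * \<delta> w)) z \<partial>M) \<partial>M) =
      (\<integral>\<^sup>+z. ?G z * (\<integral>\<^sup>+w. inverse (V w) * indicator (ball w (1/8 * \<delta> w)) z \<partial>M) \<partial>M)"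
    by (intro tonelli_balls[symmetric]) auto
  also have "\<dots> \<le> (\<integral>\<^sup>+z. ?G z * ennreal D \<partial>M)"
    by (intro nn_integral_mono mult_left_mono inverse_V_upper) auto
  also have "\<dots> = (\<integral>\<^sup>+z. ?G z \<partial>M) * ennreal D" by (intro nn_integral_multc) auto
  finally have "(\<integral>\<^sup>+y. ?F y \<partial>M) \<le>
      ennreal (D ^ Suc n) * (ennreal (?C * r) * ((\<integral>\<^sup>+z. ?G z \<partial>M) * ennreal D))"
    by (simp add: mult_left_mono)
  also have "\<dots> = ennreal (D ^ (n + 2) * ?C * r) * (\<integral>\<^sup>+z. ?G z \<partial>M)"
  proof -
    have "ennreal (D ^ (n + 2) * ?C * r) = ennreal (D ^ Suc n) * (ennreal (?C * r) * ennreal D)"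
      using D_ge_1 K r by (simp add: mult_ac flip: ennreal_mult)
    then show ?thesis by (simp add: mult_ac)
  qed
  finally show ?thesis .
qed

text \<open>A single integral that dominates all averages at scale \<delta> seen from
  \<open>x\<close>. The Hardy-Littlewood maximal function would dominate them too, but need not be
  integrable for an integrable \<open>G\<close>, whereas here Tonelli gives the integral.\<close>

definition grad :: "real \<Rightarrow> 'a \<Rightarrow> ennreal" where
  "grad A x = (\<integral>\<^sup>+z. G z * inverse (V z) * indicator (ball z (A * \<delta> z)) x \<partial>M)"

lemma grad_measurable [measurable]: "grad A \<in> borel_measurable M"
  unfolding grad_def[abs_def] by (intro ball_integral_measurable') measurable

text \<open>After Tonelli the inner integral is the measure of
  \<open>ball z (A * \<delta> z)\<close>; \<open>k\<close> doublings bound it by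
  \<open>D ^ k * V z\<close>, which cancels the weight.\<close>

lemma grad_integral:
  assumes "1 \<le> A" "A \<le> 2 ^ k"
  shows "(\<integral>\<^sup>+x. grad A x \<partial>M) \<le> ennreal (D ^ k) * (\<integral>\<^sup>+z\<in>\<Omega>. G z \<partial>M)"
proof -
  have "(\<integral>\<^sup>+x. grad A x \<partial>M) = (\<integral>\<^sup>+z. G z * inverse (V z) * (\<integral>\<^sup>+x. 1 * indicator (ball z (A * \<delta> z)) x \<partial>M) \<partial>M)"
    unfolding grad_def[abs_def]
    using tonelli_balls[of "\<lambda>_. 1" "\<lambda>z. G z * inverse (V z)" "\<lambda>z. A * \<delta> z"] by simp
  also have "\<dots> \<le> (\<integral>\<^sup>+z. ennreal (D ^ k) * (G z * indicator \<Omega> z) \<partial>M)"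
  proof (rule nn_integral_mono)
    fix z
    show "G z * inverse (V z) * (\<integral>\<^sup>+x. 1 * indicator (ball z (A * \<delta> z)) x \<partial>M) \<le>
      ennreal (D ^ k) * (G z * indicator \<Omega> z)"
    proof (cases "z \<in> \<Omega>")
      case True
      then have dz: "0 < \<delta> z" by (simp add: \<delta>_pos_iff)
      have "(\<integral>\<^sup>+x. 1 * indicator (ball z (A * \<delta> z)) x \<partial>M) \<le> ennreal (D ^ k) * V z"
        unfolding V_def using dz assms mult_right_mono[OF assms(2), of "\<delta> z"]
        by (auto intro!: ball_le_ball)
      then have "G z * inverse (V z) * (\<integral>\<^sup>+x. 1 * indicator (ball z (A * \<delta> z)) x \<partial>M) \<le>
          G z * inverse (V z) * (ennreal (D ^ k) * V z)" by (intro mult_left_mono) auto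
      also have "\<dots> = ennreal (D ^ k) * G z * (V z * inverse (V z))" by (simp add: mult_ac)
      finally show ?thesis using True by (simp add: V_inverse)
    next
      case False
      then show ?thesis by (simp add: \<delta>_eq_0)
    qed
  qed
  also have "\<dots> = ennreal (D ^ k) * (\<integral>\<^sup>+z\<in>\<Omega>. G z \<partial>M)" by (intro nn_integral_cmult) measurable
  finally show ?thesis .
qed

text \<open>For \<open>z\<close> in \<open>ball p (\<delta> p / 8)\<close>,
  \<open>\<delta> z\<close> lies between 7/8 and 9/8 of \<open>\<delta> p\<close>, so
  \<open>c * dist z x \<le> 9/8 * \<delta> p < 2 * \<delta> z\<close>; this is the origin of
  \<open>2 / c\<close>. Four doublings of the radius \<open>\<delta> p / 8\<close> compare
  \<open>V z\<close> with the volume in \<open>avg\<close>.\<close>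

lemma avg_le_grad:
  assumes c: "0 < c" "c \<le> 1" and p: "p \<in> \<Omega>" "c * dist x p \<le> \<delta> p"
  shows "ennreal (avg p) \<le> ennreal (D ^ 4) * grad (2 / c) x"
proof -
  let ?B = "ball p (\<delta> p / 8)"
  have dp: "0 < \<delta> p" using p by (simp add: \<delta>_pos_iff)
  have m: "0 < measure M ?B" using dp by (intro ball_measure_pos) simp
  have "ennreal (avg p) = (\<integral>\<^sup>+z\<in>?B. G z \<partial>M) * ennreal (1 / measure M ?B)"
  proof -
    let ?I = "\<integral>\<^sup>+z\<in>?B. G z \<partial>M"
    have "avg p = enn2real ?I * (1 / measure M ?B)" by (simp add: avg_def)
    then have "ennreal (avg p) = ennreal (enn2real ?I) * ennreal (1 / measure M ?B)"
      using m by (simp only: ennreal_mult enn2real_nonneg zero_le_divide_1_iff less_imp_le)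
    moreover have "ennreal (enn2real ?I) = ?I" using G_ball_finite[of p] by simp
    ultimately show ?thesis by simp
  qed
  also have "\<dots> = (\<integral>\<^sup>+z. G z * indicator ?B z * ennreal (1 / measure M ?B) \<partial>M)"
    by (intro nn_integral_multc[symmetric]) auto
  also have "\<dots> \<le> (\<integral>\<^sup>+z. ennreal (D ^ 4) * (G z * inverse (V z) * indicator (ball z (2 / c * \<delta> z)) x) \<partial>M)"
  proof (rule nn_integral_mono)
    fix z
    show "G z * indicator ?B z * ennreal (1 / measure M ?B) \<le>
        ennreal (D ^ 4) * (G z * inverse (V z) * indicator (ball z (2 / c * \<delta> z)) x)"
    proof (cases "z \<in> ?B")
      case True
      have z: "z \<in> \<Omega>" using True ball_\<delta>_subset[of "1/8" p] by auto
      have d: "dist p z < \<delta> p / 8" using True by simp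
      have dz: "\<delta> z \<le> 9/8 * \<delta> p" "7/8 * \<delta> p \<le> \<delta> z"
        using \<delta>_lip[of p z] \<delta>_lip'[of z p] d by linarith+
      have "0 < \<delta> p / 8" "dist z p + \<delta> z \<le> 2 ^ 4 * (\<delta> p / 8)"
        using dp dz d by (simp_all add: dist_commute)
      then have "V z \<le> ennreal (D ^ 4) * emeasure M ?B"
        unfolding V_def by (rule ball_le_ball)
      then have "inverse (emeasure M ?B) \<le> ennreal (D ^ 4) * inverse (V z)"
        using V_pos[OF z] ball_pos[OF \<open>0 < \<delta> p / 8\<close>, of p] ball_finite[of p "\<delta> p / 8"]
        by (rule ennreal_inverse_le)
      moreover have "ennreal (1 / measure M ?B) = inverse (emeasure M ?B)"
        unfolding ball_emeasure_eq inverse_ennreal[OF m] by (simp only: divide_inverse mult_1)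
      moreover have "x \<in> ball z (2 / c * \<delta> z)"
      proof -
        have "c * dist z x \<le> c * dist p z + c * dist x p"
          using dist_triangle[of z x p] c by (simp add: dist_commute mult_left_mono flip: distrib_left)
        moreover have "c * dist p z \<le> 1 * dist p z" using c by (intro mult_right_mono) auto
        ultimately have "c * dist z x < 2 * \<delta> z" using p(2) d dz dp by linarith
        then show ?thesis using c by (simp add: field_simps)
      qed
      ultimately show ?thesis using True
        by (auto simp: mult_ac intro!: mult_left_mono)
    qed simp
  qed
  also have "\<dots> = ennreal (D ^ 4) * grad (2 / c) x"
  proof -
    have ind: "indicator (ball z (2 / c * \<delta> z)) x = indicator {z. dist z x < 2 / c * \<delta> z} z" for z
      by (auto simp: indicator_def)
    have "{z. dist z x < 2 / c * \<delta> z} \<in> sets M"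
      by (intro open_sets open_Collect_less continuous_intros \<delta>_continuous)
    then show ?thesis unfolding grad_def ind by (intro nn_integral_cmult) auto
  qed
  finally show ?thesis .
qed

text \<open>Bisection in the form of \<open>Bolzano\<close>: the estimate is additive over adjacent
  intervals and holds on short ones by \<open>v_local_lipschitz\<close>.\<close>

lemma v_along_path:
  assumes \<gamma>: "lip_path \<gamma> s" "\<gamma> ` {0..s} \<subseteq> \<Omega>" and H: "\<And>t. t \<in> {0..s} \<Longrightarrow> avg (\<gamma> t) \<le> H"
  shows "\<bar>v (\<gamma> 0) - v (\<gamma> s)\<bar> \<le> lip_const * H * s"
proof -
  let ?L = "lip_const * H"
  have s: "0 \<le> s" using \<gamma>(1) by (simp add: lip_path_def)
  define P where "P a b \<longleftrightarrow> (0 \<le> a \<and> b \<le> s \<longrightarrow> \<bar>v (\<gamma> a) - v (\<gamma> b)\<bar> \<le> ?L * (b - a))" for a b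
  have "P 0 s"
    using s
  proof (rule Bolzano)
    show "P a c" if "P a b" "P b c" "a \<le> b" "b \<le> c" for a b c
      using that unfolding P_def by (auto simp: algebra_simps)
    fix x assume x': "0 \<le> x" "x \<le> s"
    then have x: "\<gamma> x \<in> \<Omega>" using \<gamma>(2) by auto
    have *: "\<bar>v (\<gamma> x) - v (\<gamma> t)\<bar> \<le> ?L * \<bar>x - t\<bar>"
      if t: "t \<in> {0..s}" "\<bar>x - t\<bar> < \<rho> (\<gamma> x) / 2" for t
    proof -
      have d: "dist (\<gamma> x) (\<gamma> t) \<le> \<bar>x - t\<bar>" using lip_pathD[OF \<gamma>(1)] x' t by auto
      have "\<bar>v (\<gamma> x) - v (\<gamma> t)\<bar> \<le> lip_const * avg (\<gamma> x) * dist (\<gamma> x) (\<gamma> t)"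
        using x t d \<gamma>(2) by (intro v_local_lipschitz) auto
      also have "\<dots> \<le> ?L * \<bar>x - t\<bar>"
        using H[of x] x' d lip_const_nonneg avg_nonneg[of "\<gamma> x"]
        by (intro mult_mono mult_left_mono mult_nonneg_nonneg) auto
      finally show ?thesis .
    qed
    show "\<exists>d>0. \<forall>a b. a \<le> x \<and> x \<le> b \<and> b - a < d \<longrightarrow> P a b"
    proof (intro exI[of _ "\<rho> (\<gamma> x) / 2"] conjI allI impI)
      show "0 < \<rho> (\<gamma> x) / 2" using \<rho>_pos[OF x] by simp
      fix a b assume ab: "a \<le> x \<and> x \<le> b \<and> b - a < \<rho> (\<gamma> x) / 2"
      show "P a b" unfolding P_def
      proof
        assume "0 \<le> a \<and> b \<le> s"
        then have "\<bar>v (\<gamma> x) - v (\<gamma> a)\<bar> \<le> ?L * (x - a)" "\<bar>v (\<gamma> x) - v (\<gamma> b)\<bar> \<le> ?L * (b - x)"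
          using *[of a] *[of b] ab by auto
        then have "\<bar>v (\<gamma> a) - v (\<gamma> b)\<bar> \<le> ?L * (x - a) + ?L * (b - x)" by linarith
        also have "\<dots> = ?L * (b - a)" by (simp add: algebra_simps)
        finally show "\<bar>v (\<gamma> a) - v (\<gamma> b)\<bar> \<le> ?L * (b - a)" .
      qed
    qed
  qed
  then show ?thesis by (simp add: P_def)
qed

text \<open>The curve is cut in the middle. On the half next to \<open>x\<close> the minimum of
  \<open>t\<close> and \<open>l - t\<close> is \<open>t\<close>, which is at least the distance to
  \<open>x\<close>, so \<open>avg_le_grad\<close> bounds \<open>avg\<close> by the same number at
  all its points; the other half is treated by reversal. The summand 1 in \<open>B\<close> makes it
  positive, so that an infinite gradient stays infinite when multiplied by \<open>B\<close>.\<close>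

lemma v_hajlasz:
  assumes c: "0 < c" "c \<le> 1"
    and curves: "\<And>x y. x \<in> \<Omega> \<Longrightarrow> y \<in> \<Omega> \<Longrightarrow> x \<noteq> y \<Longrightarrow>
      \<exists>\<gamma> l. lip_path \<gamma> l \<and> \<gamma> ` {0..l} \<subseteq> \<Omega> \<and> \<gamma> 0 = x \<and> \<gamma> l = y \<and> l \<le> inverse c * dist x y \<and>
        (\<forall>t\<in>{0..l}. c * min t (l - t) \<le> \<delta> (\<gamma> t))"
    and x: "x \<in> \<Omega>" and y: "y \<in> \<Omega>"
  defines "B \<equiv> lip_const * D ^ 4 / c + 1"
  shows "ennreal \<bar>v x - v y\<bar> \<le> ennreal (dist x y) * (ennreal B * grad (2 / c) x + ennreal B * grad (2 / c) y)"
proof (cases "x = y")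
  case True
  then show ?thesis by simp
next
  case False
  have Bpos: "0 < B" using lip_const_nonneg D_ge_1 c by (simp add: B_def add_nonneg_pos)
  have dpos: "0 < dist x y" using False by simp
  show ?thesis
  proof (cases "grad (2 / c) x = \<infinity> \<or> grad (2 / c) y = \<infinity>")
    case True
    then have *: "ennreal B * grad (2 / c) x + ennreal B * grad (2 / c) y = \<infinity>"
      using Bpos by (auto simp: ennreal_mult_eq_top_iff)
    show ?thesis unfolding * using dpos by (simp add: ennreal_mult_top)
  next
    case fin: False
    define hx hy where "hx = enn2real (grad (2 / c) x)" and "hy = enn2real (grad (2 / c) y)"
    have hx: "grad (2 / c) x = ennreal hx" "0 \<le> hx" and hy: "grad (2 / c) y = ennreal hy" "0 \<le> hy"
      using fin by (auto simp: hx_def hy_def less_top)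
    obtain \<gamma> l where \<gamma>: "lip_path \<gamma> l" "\<gamma> ` {0..l} \<subseteq> \<Omega>" "\<gamma> 0 = x" "\<gamma> l = y"
      "l \<le> inverse c * dist x y" "\<And>t. t \<in> {0..l} \<Longrightarrow> c * min t (l - t) \<le> \<delta> (\<gamma> t)"
      using curves[OF x y False] by blast
    have l: "0 \<le> l" using \<gamma>(1) by (simp add: lip_path_def)
    have half: "\<bar>v (\<eta> 0) - v (\<eta> (l/2))\<bar> \<le> lip_const * (D ^ 4 * h) * (l / 2)"
      if \<eta>: "lip_path \<eta> l" "\<eta> ` {0..l} \<subseteq> \<Omega>" "\<And>t. t \<in> {0..l} \<Longrightarrow> c * min t (l - t) \<le> \<delta> (\<eta> t)"
        and h: "grad (2 / c) (\<eta> 0) = ennreal h" "0 \<le> h" for \<eta> h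
    proof (rule v_along_path)
      show "lip_path \<eta> (l / 2)" using lip_path_restrict(1)[OF \<eta>(1)] l by auto
      show "\<eta> ` {0..l/2} \<subseteq> \<Omega>" using \<eta>(2) l by auto
      fix t assume t: "t \<in> {0..l/2}"
      then have tl: "t \<in> {0..l}" using l by auto
      have "dist (\<eta> 0) (\<eta> t) \<le> t" using lip_pathD[OF \<eta>(1), of 0 t] tl l by auto
      then have "c * dist (\<eta> 0) (\<eta> t) \<le> c * t" using c by (intro mult_left_mono) auto
      also have "\<dots> = c * min t (l - t)" using t by (simp add: min_def)
      also have "\<dots> \<le> \<delta> (\<eta> t)" by (rule \<eta>(3)[OF tl])
      finally have "ennreal (avg (\<eta> t)) \<le> ennreal (D ^ 4) * grad (2 / c) (\<eta> 0)"
        using \<eta>(2) tl c by (intro avg_le_grad) auto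
      also have "\<dots> = ennreal (D ^ 4 * h)" using h D_ge_1 by (simp add: ennreal_mult)
      finally show "avg (\<eta> t) \<le> D ^ 4 * h" using h D_ge_1 by (simp add: ennreal_le_iff)
    qed
    have "\<bar>v x - v (\<gamma> (l/2))\<bar> \<le> lip_const * (D ^ 4 * hx) * (l / 2)"
      using half[of \<gamma> hx] \<gamma> hx by auto
    moreover have "\<bar>v y - v (\<gamma> (l/2))\<bar> \<le> lip_const * (D ^ 4 * hy) * (l / 2)"
    proof -
      have "lip_path (\<lambda>t. \<gamma> (l - t)) l" using lip_path_reverse(1)[OF \<gamma>(1), of "\<lambda>_. 0"] by simp
      moreover have "(\<lambda>t. \<gamma> (l - t)) ` {0..l} \<subseteq> \<Omega>" using \<gamma>(2) by auto
      moreover have "c * min t (l - t) \<le> \<delta> (\<gamma> (l - t))" if "t \<in> {0..l}" for t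
        using \<gamma>(6)[of "l - t"] that by (simp add: min.commute)
      moreover have "l - l / 2 = l / 2" by simp
      ultimately show ?thesis
        using half[of "\<lambda>t. \<gamma> (l - t)" hy] \<gamma>(4) hy by simp
    qed
    ultimately have "\<bar>v x - v y\<bar> \<le> lip_const * (D ^ 4 * hx) * (l / 2) + lip_const * (D ^ 4 * hy) * (l / 2)"
      by linarith
    also have "\<dots> = lip_const * D ^ 4 * (hx + hy) / 2 * l" by (simp add: algebra_simps)
    also have "\<dots> \<le> lip_const * D ^ 4 * (hx + hy) / 2 * (inverse c * dist x y)"
      using lip_const_nonneg D_ge_1 hx hy by (intro mult_left_mono \<gamma>) auto
    also have "\<dots> = dist x y * (lip_const * D ^ 4 / c / 2 * (hx + hy))" by (simp add: field_simps)
    also have "\<dots> \<le> dist x y * (B * (hx + hy))"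
    proof (intro mult_left_mono mult_right_mono)
      have "0 \<le> lip_const * D ^ 4 / c" using lip_const_nonneg D_ge_1 c by simp
      then show "lip_const * D ^ 4 / c / 2 \<le> B" by (simp add: B_def)
    qed (use hx hy in auto)
    finally have "\<bar>v x - v y\<bar> \<le> dist x y * (B * hx + B * hy)" by (simp add: distrib_left)
    then have "ennreal \<bar>v x - v y\<bar> \<le> ennreal (dist x y * (B * hx + B * hy))" by (rule ennreal_leI)
    then show ?thesis using hx hy Bpos by (simp add: ennreal_mult)
  qed
qed

end

section \<open>Upper gradients and the local Poincare inequality\<close>

lemma arclength_param_surj:
  assumes "is_curve \<gamma> a b"
  shows "\<gamma> ` {a..b} \<subseteq> arclength_param \<gamma> a b ` {0..enn2real (curve_length \<gamma> a b)}"
proof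
  fix x assume "x \<in> \<gamma> ` {a..b}"
  then obtain t where t: "t \<in> {a..b}" "x = \<gamma> t" by blast
  have fin: "curve_length \<gamma> a b < \<infinity>" using assms by (simp add: is_curve_def)
  have le: "curve_length \<gamma> a t \<le> curve_length \<gamma> a b" using t by (intro curve_length_mono) auto
  define s where "s = enn2real (curve_length \<gamma> a t)"
  have s: "curve_length \<gamma> a t = ennreal s" "0 \<le> s"
    using le fin by (auto simp: s_def intro!: ennreal_enn2real[symmetric] elim: order_le_less_trans)
  obtain t' where t': "t' \<in> {a..b}" "curve_length \<gamma> a t' = ennreal s" "arclength_param \<gamma> a b s = \<gamma> t'"
    using arclength_param_obtain[OF assms, of s] le s by auto
  have "dist (\<gamma> t) (\<gamma> t') \<le> \<bar>s - s\<bar>" using t t' s by (intro dist_le_length_diff) auto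
  then have "x = arclength_param \<gamma> a b s" using t t' by simp
  moreover have "s \<le> enn2real (curve_length \<gamma> a b)"
    unfolding s_def using le fin by (intro enn2real_mono) auto
  ultimately show "x \<in> arclength_param \<gamma> a b ` {0..enn2real (curve_length \<gamma> a b)}" using s by auto
qed

lemma curve_integral_mono:
  assumes "is_curve \<gamma> a b" "\<And>x. x \<in> \<gamma> ` {a..b} \<Longrightarrow> f x \<le> g x"
  shows "curve_integral f \<gamma> a b \<le> curve_integral g \<gamma> a b"
  unfolding curve_integral_def
proof (rule nn_integral_mono)
  fix s
  show "f (arclength_param \<gamma> a b s) * indicator {0..enn2real (curve_length \<gamma> a b)} s
      \<le> g (arclength_param \<gamma> a b s) * indicator {0..enn2real (curve_length \<gamma> a b)} s"
  proof (cases "s \<in> {0..enn2real (curve_length \<gamma> a b)}")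
    case True
    then have "arclength_param \<gamma> a b s \<in> \<gamma> ` {a..b}"
      using arclength_param_lip_path(4)[OF assms(1)] by blast
    then show ?thesis using assms(2) by (intro mult_right_mono) auto
  qed simp
qed

text \<open>Between the two notions of gradient: confined to curves in \<Omega> like
  \<open>weak_upper_gradient\<close>, but Borel and without exceptional curves like
  \<open>upper_gradient\<close>. In this form it can be extended to the whole space.\<close>

definition upper_gradient_on :: "'a::metric_space set \<Rightarrow> ('a \<Rightarrow> ereal) \<Rightarrow> ('a \<Rightarrow> ennreal) \<Rightarrow> bool" where
  "upper_gradient_on \<Omega> u g \<longleftrightarrow> g \<in> borel_measurable borel \<and>
     (\<forall>\<gamma> a b. nonconstant_curve \<gamma> a b \<longrightarrow> \<gamma> ` {a..b} \<subseteq> \<Omega> \<longrightarrow>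
        ext_absdiff (u (\<gamma> a)) (u (\<gamma> b)) \<le> curve_integral g \<gamma> a b)"

text \<open>A curve that leaves \<open>ball p R\<close> has positive length outside \<open>ball p (R / 2)\<close>, where the
  gradient is set to infinity. This would fail with one and the same ball, which the curve could
  leave just to touch the complement in a single point.\<close>

lemma upper_gradient_localize:
  assumes g: "upper_gradient_on \<Omega> u g" and R: "0 < R" "ball p R \<subseteq> \<Omega>"
  shows "upper_gradient (\<lambda>x. if x \<in> ball p R then u x else 0)
    (\<lambda>x. if x \<in> ball p (R / 2) then g x else \<infinity>)"
  unfolding upper_gradient_def
proof (intro conjI allI impI)
  let ?u = "\<lambda>x. if x \<in> ball p R then u x else 0"
  let ?g = "\<lambda>x. if x \<in> ball p (R / 2) then g x else \<infinity>"
  have [measurable]: "g \<in> borel_measurable borel" using g by (simp add: upper_gradient_on_def)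
  show "?g \<in> borel_measurable borel" by (intro measurable_If_set) auto
  fix \<gamma> :: "real \<Rightarrow> 'a" and a b assume nc: "nonconstant_curve \<gamma> a b"
  then have c: "is_curve \<gamma> a b" by (simp add: nonconstant_curve_def)
  then have ab: "a \<le> b" by (simp add: is_curve_def)
  show "ext_absdiff (?u (\<gamma> a)) (?u (\<gamma> b)) \<le> curve_integral ?g \<gamma> a b"
  proof (cases "\<gamma> ` {a..b} \<subseteq> ball p R")
    case True
    then have "\<gamma> a \<in> ball p R" "\<gamma> b \<in> ball p R" using ab by (meson atLeastAtMost_iff image_subset_iff order_refl)+
    then have "ext_absdiff (?u (\<gamma> a)) (?u (\<gamma> b)) = ext_absdiff (u (\<gamma> a)) (u (\<gamma> b))" by simp
    also have "\<dots> \<le> curve_integral g \<gamma> a b"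
      using g nc True R unfolding upper_gradient_on_def by blast
    also have "\<dots> \<le> curve_integral ?g \<gamma> a b" by (intro curve_integral_mono c) auto
    finally show ?thesis .
  next
    case False
    define l where "l = enn2real (curve_length \<gamma> a b)"
    define \<sigma> where "\<sigma> = arclength_param \<gamma> a b"
    have l: "0 < l" unfolding l_def by (rule nonconstant_curve_length_pos[OF nc])
    have lip: "lip_path \<sigma> l" unfolding l_def \<sigma>_def by (rule arclength_param_lip_path(1)[OF c])
    have "\<not> \<sigma> ` {0..l} \<subseteq> ball p R"
      using arclength_param_surj[OF c] False unfolding l_def \<sigma>_def by (meson order_trans)
    then obtain s where s: "s \<in> {0..l}" "\<sigma> s \<notin> ball p R" by (meson image_subsetI)
    \<comment> \<open>Arc-length parameters within \<open>R / 4\<close> of a parameter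
      \<open>s\<close> outside the ball, cut to \<open>{0..l}\<close>; the interval is nondegenerate
      since \<open>0 < l\<close>. On it the curve stays at distance at least \<open>3/4 * R\<close>
      from \<open>p\<close>, where the gradient is infinite.\<close>
    define m n where "m = max 0 (s - R / 4)" and "n = min l (s + R / 4)"
    have mn: "m < n" using s(1) R(1) l by (auto simp: m_def n_def)
    have "ext_absdiff (?u (\<gamma> a)) (?u (\<gamma> b)) \<le> \<infinity>" by simp
    also have "\<infinity> = (\<integral>\<^sup>+t. \<infinity> * indicator {m..n} t \<partial>lborel)"
      using mn by (subst nn_integral_cmult_indicator) (auto simp: ennreal_top_mult)
    also have "\<dots> \<le> path_nn_integral ?g \<sigma> l"
      unfolding path_nn_integral_def
    proof (rule nn_integral_mono)
      fix t
      show "\<infinity> * indicator {m..n} t \<le> ?g (\<sigma> t) * indicator {0..l} t"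
      proof (cases "t \<in> {m..n}")
        case True
        then have "t \<in> {0..l}" "s - R / 4 \<le> t" "t \<le> s + R / 4" by (auto simp: m_def n_def)
        then have t: "t \<in> {0..l}" "\<bar>s - t\<bar> \<le> R / 4" by (simp_all only: abs_le_iff) linarith
        have "dist (\<sigma> s) (\<sigma> t) \<le> R / 4" using lip_pathD[OF lip s(1) t(1)] t(2) by linarith
        then have "\<sigma> t \<notin> ball p (R / 2)"
          using s(2) R(1) dist_triangle[of p "\<sigma> s" "\<sigma> t"] by (auto simp: dist_commute)
        then show ?thesis using t(1) True by simp
      qed simp
    qed
    also have "\<dots> = curve_integral ?g \<gamma> a b"
      unfolding l_def \<sigma>_def by (rule curve_integral_eq_path[symmetric])
    finally show ?thesis .
  qed
qed

lemma e2ennreal_zero [simp]: "e2ennreal 0 = 0"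
  by (metis e2ennreal_ereal ennreal_0 zero_ereal_def)

section \<open>Preparing a function on the domain for the Poincare inequality\<close>

lemma L1_mono_set:
  assumes "A \<in> sets M" "H \<in> sets M" "A \<subseteq> H" "space M = UNIV" "u \<in> L1 M H"
  shows "(\<lambda>x. if x \<in> A then u x else 0) \<in> L1 M B"
    and "(\<lambda>x. if x \<in> A then u x else 0) \<in> borel_measurable M"
proof -
  have "u \<in> borel_measurable (restrict_space M A)"
    by (rule measurable_restrict_mono[OF _ assms(3)]) (use assms(5) in \<open>simp add: L1_def\<close>)
  then show meas: "(\<lambda>x. if x \<in> A then u x else 0) \<in> borel_measurable M"
    using assms(1,4) by (subst measurable_If_restrict_space_iff[where P="\<lambda>x. x \<in> A"]) auto
  have "L1_norm M B (\<lambda>x. if x \<in> A then u x else 0) \<le> L1_norm M H u"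
    unfolding L1_norm_def using assms(3) by (intro nn_integral_mono) (auto simp: indicator_def)
  then show "(\<lambda>x. if x \<in> A then u x else 0) \<in> L1 M B" using assms(5) meas
    unfolding L1_def by (auto intro: measurable_restrict_space1 order_le_less_trans)
qed

text \<open>To a Borel majorant of \<open>g\<close> a small multiple of a density with infinite
  integral along the exceptional curves is added; this makes the inequality trivial on them. The 1
  in \<open>e / (R + 1)\<close> prevents division by 0.\<close>

lemma (in doubling_space) weak_to_borel:
  assumes "weak_upper_gradient M \<Omega> u g" and e: "0 < e" and \<Omega>: "\<Omega> \<in> sets M"
  shows "\<exists>G. upper_gradient_on \<Omega> u G \<and> (\<integral>\<^sup>+x\<in>\<Omega>. G x \<partial>M) \<le> (\<integral>\<^sup>+x\<in>\<Omega>. g x \<partial>M) + ennreal e"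
proof -
  obtain \<Gamma> where g: "g \<in> borel_measurable (restrict_space M \<Omega>)" and \<Gamma>: "zero_modulus M \<Gamma>"
    and ug: "\<And>\<gamma> a b. nonconstant_curve \<gamma> a b \<Longrightarrow> \<gamma> ` {a..b} \<subseteq> \<Omega> \<Longrightarrow> (\<gamma>, a, b) \<notin> \<Gamma> \<Longrightarrow>
           ext_absdiff (u (\<gamma> a)) (u (\<gamma> b)) \<le> curve_integral g \<gamma> a b"
    using assms(1) unfolding weak_upper_gradient_def by blast
  obtain \<rho> where \<rho>: "\<rho> \<in> borel_measurable borel" "(\<integral>\<^sup>+x. \<rho> x \<partial>M) < \<infinity>"
    "\<And>\<gamma> a b. (\<gamma>, a, b) \<in> \<Gamma> \<Longrightarrow> curve_integral \<rho> \<gamma> a b = \<infinity>"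
    using \<Gamma> unfolding zero_modulus_def by blast
  have "(\<lambda>x. g x * indicator \<Omega> x) \<in> borel_measurable M"
    using g \<Omega> by (subst (asm) borel_measurable_restrict_space_iff_ennreal) auto
  then obtain g' where g': "g' \<in> borel_measurable borel" "\<And>x. g x * indicator \<Omega> x \<le> g' x"
    "AE x in M. g' x = g x * indicator \<Omega> x" using borel_majorant by blast
  define R where "R = enn2real (\<integral>\<^sup>+x. \<rho> x \<partial>M)"
  have R: "(\<integral>\<^sup>+x. \<rho> x \<partial>M) = ennreal R" "0 \<le> R" using \<rho>(2) by (auto simp: R_def)
  define \<eta> where "\<eta> = e / (R + 1)"
  have \<eta>: "0 < \<eta>" "\<eta> * R \<le> e" using e R(2) by (auto simp: \<eta>_def field_simps)
  define G where "G x = g' x + ennreal \<eta> * \<rho> x" for x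
  note [measurable] = g'(1) \<rho>(1) measurable_from_borel[OF g'(1)] measurable_from_borel[OF \<rho>(1)]
  have "G \<in> borel_measurable borel" unfolding G_def[abs_def] by measurable
  moreover have "ext_absdiff (u (\<gamma> a)) (u (\<gamma> b)) \<le> curve_integral G \<gamma> a b"
    if nc: "nonconstant_curve \<gamma> a b" and sub: "\<gamma> ` {a..b} \<subseteq> \<Omega>" for \<gamma> a b
  proof -
    have c: "is_curve \<gamma> a b" using nc by (simp add: nonconstant_curve_def)
    show ?thesis
    proof (cases "(\<gamma>, a, b) \<in> \<Gamma>")
      case True
      have "\<infinity> = ennreal \<eta> * curve_integral \<rho> \<gamma> a b"
        using \<rho>(3)[OF True] \<eta>(1) by (simp add: ennreal_mult_top)
      also have "\<dots> = curve_integral (\<lambda>x. ennreal \<eta> * \<rho> x) \<gamma> a b"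
        by (rule curve_integral_cmult[OF c \<rho>(1), symmetric])
      also have "\<dots> \<le> curve_integral G \<gamma> a b" by (intro curve_integral_mono c) (simp add: G_def)
      finally show ?thesis by (simp add: top_unique)
    next
      case False
      have "curve_integral g \<gamma> a b \<le> curve_integral G \<gamma> a b"
      proof (rule curve_integral_mono[OF c])
        fix x assume "x \<in> \<gamma> ` {a..b}"
        then have "g x \<le> g' x" using g'(2)[of x] sub by (auto simp: indicator_def split: if_splits)
        then show "g x \<le> G x" unfolding G_def by (rule order_trans) simp
      qed
      with ug[OF nc sub False] show ?thesis by (rule order_trans)
    qed
  qed
  moreover have "(\<integral>\<^sup>+x\<in>\<Omega>. G x \<partial>M) \<le> (\<integral>\<^sup>+x\<in>\<Omega>. g x \<partial>M) + ennreal e"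
  proof -
    have "(\<integral>\<^sup>+x\<in>\<Omega>. G x \<partial>M) \<le> (\<integral>\<^sup>+x. g' x * indicator \<Omega> x + ennreal \<eta> * \<rho> x \<partial>M)"
      by (intro nn_integral_mono) (auto simp: G_def indicator_def)
    also have "\<dots> = (\<integral>\<^sup>+x\<in>\<Omega>. g' x \<partial>M) + ennreal \<eta> * (\<integral>\<^sup>+x. \<rho> x \<partial>M)"
      using \<Omega> by (subst nn_integral_add) (auto simp: nn_integral_cmult)
    also have "(\<integral>\<^sup>+x\<in>\<Omega>. g' x \<partial>M) = (\<integral>\<^sup>+x\<in>\<Omega>. g x \<partial>M)"
      using g'(3) by (intro nn_integral_cong_AE) (auto simp: indicator_def)
    also have "ennreal \<eta> * (\<integral>\<^sup>+x. \<rho> x \<partial>M) \<le> ennreal e"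
      using \<eta> R by (simp add: ennreal_leI flip: ennreal_mult)
    finally show ?thesis by (simp add: add_left_mono)
  qed
  ultimately show ?thesis unfolding upper_gradient_on_def by blast
qed

lemma ext_absdiff_ereal: "ext_absdiff (ereal x) (ereal y) = ennreal \<bar>x - y\<bar>"
  by (simp add: ext_absdiff_def e2ennreal_ereal)

lemma ext_absdiff_ge: "ennreal \<bar>real_of_ereal p - c\<bar> \<le> ext_absdiff p (ereal c)"
  by (cases p) (auto simp: ext_absdiff_ereal ext_absdiff_def)

lemma ext_absdiff_eq: "\<bar>p\<bar> \<noteq> \<infinity> \<Longrightarrow> ext_absdiff p (ereal c) = ennreal \<bar>real_of_ereal p - c\<bar>"
  by (cases p) (auto simp: ext_absdiff_ereal)

definition real_on :: "'a set \<Rightarrow> ('a \<Rightarrow> ereal) \<Rightarrow> 'a \<Rightarrow> real" where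
  "real_on \<Omega> u x = (if x \<in> \<Omega> then real_of_ereal (u x) else 0)"

lemma (in doubling_space) L1_real_on:
  assumes u: "u \<in> L1 M \<Omega>" and \<Omega>: "\<Omega> \<in> sets M"
  shows "integrable M (real_on \<Omega> u)" "(\<integral>\<^sup>+x. ennreal \<bar>real_on \<Omega> u x\<bar> \<partial>M) \<le> L1_norm M \<Omega> u"
    "AE x in M. x \<in> \<Omega> \<longrightarrow> \<bar>u x\<bar> \<noteq> \<infinity>"
proof -
  have um: "(\<lambda>x. if x \<in> \<Omega> then u x else 0) \<in> borel_measurable M" and fin: "L1_norm M \<Omega> u < \<infinity>"
    using L1_mono_set(2)[OF \<Omega> \<Omega> _ _ u] u by (auto simp: L1_def)
  have eq: "real_on \<Omega> u = (\<lambda>x. real_of_ereal (if x \<in> \<Omega> then u x else 0))"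
    by (auto simp: real_on_def)
  have meas: "real_on \<Omega> u \<in> borel_measurable M" unfolding eq using um by measurable
  have "ennreal \<bar>real_of_ereal p\<bar> \<le> e2ennreal \<bar>p\<bar>" for p
    by (cases p) (auto simp: e2ennreal_ereal)
  then show le: "(\<integral>\<^sup>+x. ennreal \<bar>real_on \<Omega> u x\<bar> \<partial>M) \<le> L1_norm M \<Omega> u"
    unfolding L1_norm_def by (intro nn_integral_mono) (auto simp: real_on_def indicator_def)
  show "integrable M (real_on \<Omega> u)"
    using meas le fin by (intro integrableI_bounded) (auto intro: order_le_less_trans)
  have eq2: "e2ennreal \<bar>u x\<bar> * indicator \<Omega> x = e2ennreal \<bar>if x \<in> \<Omega> then u x else 0\<bar>" for x
    by (simp add: indicator_def)
  have "AE x in M. e2ennreal \<bar>if x \<in> \<Omega> then u x else 0\<bar> \<noteq> \<infinity>"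
  proof (rule nn_integral_PInf_AE)
    show "(\<lambda>x. e2ennreal \<bar>if x \<in> \<Omega> then u x else 0\<bar>) \<in> borel_measurable M" using um by measurable
    show "(\<integral>\<^sup>+x. e2ennreal \<bar>if x \<in> \<Omega> then u x else 0\<bar> \<partial>M) \<noteq> \<infinity>"
      using fin unfolding L1_norm_def eq2 by simp
  qed
  then show "AE x in M. x \<in> \<Omega> \<longrightarrow> \<bar>u x\<bar> \<noteq> \<infinity>" by eventually_elim auto
qed

lemma ennreal_average_le:
  assumes "E / ennreal m \<le> ennreal a * (I / ennreal n)" "0 < m" "0 < n" "0 \<le> a"
  shows "E \<le> ennreal (a / n * m) * I"
proof -
  have "E = E / ennreal m * ennreal m"
    unfolding divide_ennreal_def inverse_ennreal[OF assms(2)]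
    using assms(2) by (simp add: mult.assoc flip: ennreal_mult)
  also have "\<dots> \<le> ennreal a * (I / ennreal n) * ennreal m" by (intro mult_right_mono assms(1)) simp
  also have "\<dots> = ennreal (a / n * m) * I"
    unfolding divide_ennreal_def inverse_ennreal[OF assms(3)] divide_inverse
    using assms(2-4) by (simp add: ennreal_mult mult_ac)
  finally show ?thesis .
qed

text \<open>The radii fit exactly: \<open>r\<close>, twice the averaging radius, belongs to the
  oscillation, \<open>\<Lambda> * r = \<delta> p / 8\<close> to the gradient, and the latter is half
  of the cut-off radius \<open>R = \<delta> p / 4\<close>. So the Poincare inequality never sees
  where the cut-off gradient is infinite, and this determines \<open>1 / (16 * \<Lambda>)\<close>.
  The constant becomes \<open>2 * C\<close> because \<open>r\<close> is twice the averaging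
  radius.\<close>

lemma (in doubling_space) smoothing_instance:
  assumes \<Omega>: "open \<Omega>" "- \<Omega> \<noteq> {}" and u: "u \<in> L1 M \<Omega>" and G: "upper_gradient_on \<Omega> u G"
    and fin: "(\<integral>\<^sup>+x\<in>\<Omega>. G x \<partial>M) < \<infinity>" and C: "0 < C" and \<Lambda>: "1 \<le> \<Lambda>"
    and P: "\<And>x r u g. r > 0 \<Longrightarrow> u \<in> L1_loc M \<Longrightarrow> upper_gradient u g \<Longrightarrow>
           (\<integral>\<^sup>+y\<in>ball x r. ext_absdiff (u y) (ereal (mean_on M (ball x r) u)) \<partial>M)
               / emeasure M (ball x r)
           \<le> ennreal (C * r) *
              ((\<integral>\<^sup>+y\<in>ball x (\<Lambda> * r). g y \<partial>M) / emeasure M (ball x (\<Lambda> * r)))"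
  shows "smoothing M D \<Omega> (real_on \<Omega> u) G (1 / (16 * \<Lambda>)) (2 * C)"
proof -
  interpret domain_space M D \<Omega> using \<Omega> by unfold_locales
  show ?thesis
  proof
    show "integrable M (real_on \<Omega> u)" by (rule L1_real_on[OF u]) simp
    show "G \<in> borel_measurable M" using G by (intro measurable_from_borel) (simp add: upper_gradient_on_def)
    show "0 < 1 / (16 * \<Lambda>)" "1 / (16 * \<Lambda>) \<le> 1 / 16" using \<Lambda> by (auto simp: field_simps)
    fix p assume p: "p \<in> \<Omega>"
    have d: "0 < \<delta> p" using p by (simp add: \<delta>_pos_iff)
    define r where "r = 2 * (1 / (16 * \<Lambda>) * \<delta> p)"
    have r: "0 < r" "\<Lambda> * r = \<delta> p / 8" "r \<le> \<delta> p / 8" using d \<Lambda> by (auto simp: r_def field_simps)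
    define R where "R = \<delta> p / 4"
    have R: "0 < R" "R / 2 = \<Lambda> * r" using d r by (auto simp: R_def)
    have sub: "ball p R \<subseteq> \<Omega>" using ball_\<delta>_subset[of "1/4" p] by (simp add: R_def)
    let ?u = "\<lambda>x. if x \<in> ball p R then u x else 0"
    let ?g = "\<lambda>x. if x \<in> ball p (R / 2) then G x else \<infinity>"
    let ?c = "mean_on M (ball p r) ?u"
    have "?u \<in> L1_loc M"
      unfolding L1_loc_def using L1_mono_set(1)[OF _ _ sub _ u] by (auto intro!: exI[of _ 1])
    from P[OF r(1) this upper_gradient_localize[OF G R(1) sub], of p]
    have *: "(\<integral>\<^sup>+y\<in>ball p r. ext_absdiff (?u y) (ereal ?c) \<partial>M) / emeasure M (ball p r) \<le>
        ennreal (C * r) * ((\<integral>\<^sup>+y\<in>ball p (\<Lambda> * r). ?g y \<partial>M) / emeasure M (ball p (\<Lambda> * r)))" .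
    have I: "(\<integral>\<^sup>+y\<in>ball p (\<Lambda> * r). ?g y \<partial>M) = (\<integral>\<^sup>+z\<in>ball p (\<delta> p / 8). G z \<partial>M)"
      using R r by (intro nn_integral_cong) (auto simp: indicator_def)
    have m: "0 < measure M (ball p r)" "0 < measure M (ball p (\<delta> p / 8))"
      using r d by (simp_all add: ball_measure_pos)
    have "(\<integral>\<^sup>+y\<in>ball p r. ennreal \<bar>real_on \<Omega> u y - ?c\<bar> \<partial>M) \<le>
        (\<integral>\<^sup>+y\<in>ball p r. ext_absdiff (?u y) (ereal ?c) \<partial>M)"
    proof (rule nn_integral_mono)
      fix y
      have "y \<in> ball p R" if "y \<in> ball p r" using that r by (auto simp: R_def)
      then show "ennreal \<bar>real_on \<Omega> u y - ?c\<bar> * indicator (ball p r) y \<le>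
          ext_absdiff (?u y) (ereal ?c) * indicator (ball p r) y"
        using sub ext_absdiff_ge[of "u y" ?c] by (cases "y \<in> ball p r") (auto simp: real_on_def)
    qed
    also have "\<dots> \<le> ennreal (C * r / measure M (ball p (\<delta> p / 8)) * measure M (ball p r)) *
        (\<integral>\<^sup>+z\<in>ball p (\<delta> p / 8). G z \<partial>M)"
      using *[unfolded I, unfolded r(2) ball_emeasure_eq] m C r(1) by (intro ennreal_average_le) auto
    also have "C * r = 2 * C * (1 / (16 * \<Lambda>) * \<delta> p)" by (simp add: r_def)
    finally show "\<exists>c. (\<integral>\<^sup>+y\<in>ball p (2 * (1 / (16 * \<Lambda>) * \<delta> p)). ennreal \<bar>real_on \<Omega> u y - c\<bar> \<partial>M) \<le>
      ennreal (2 * C * (1 / (16 * \<Lambda>) * \<delta> p) / measure M (ball p (\<delta> p / 8)) *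
        measure M (ball p (2 * (1 / (16 * \<Lambda>) * \<delta> p)))) * (\<integral>\<^sup>+z\<in>ball p (\<delta> p / 8). G z \<partial>M)"
      unfolding r_def by blast
  qed (use fin C in auto)
qed

lemma uniform_domain_curves:
  assumes "uniform_domain \<Omega>" "- \<Omega> \<noteq> {}"
  obtains c where "0 < c" "c \<le> 1" "\<And>x y. x \<in> \<Omega> \<Longrightarrow> y \<in> \<Omega> \<Longrightarrow> x \<noteq> y \<Longrightarrow>
      \<exists>\<gamma> l. lip_path \<gamma> l \<and> \<gamma> ` {0..l} \<subseteq> \<Omega> \<and> \<gamma> 0 = x \<and> \<gamma> l = y \<and> l \<le> inverse c * dist x y \<and>
        (\<forall>t\<in>{0..l}. c * min t (l - t) \<le> infdist (\<gamma> t) (- \<Omega>))"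
proof -
  obtain c where c: "0 < c" "c \<le> 1" "\<forall>x\<in>\<Omega>. \<forall>y\<in>\<Omega>. x \<noteq> y \<longrightarrow>
           (\<exists>\<gamma> l. is_curve \<gamma> 0 l \<and>
              (\<forall>t\<in>{0..l}. curve_length \<gamma> 0 t = ennreal t) \<and>
              \<gamma> ` {0..l} \<subseteq> \<Omega> \<and> \<gamma> 0 = x \<and> \<gamma> l = y \<and>
              l \<le> inverse c * dist x y \<and>
              (\<forall>t\<in>{0..l}. - \<Omega> = {} \<or> infdist (\<gamma> t) (- \<Omega>) \<ge> c * min t (l - t)))"
    using assms(1) unfolding uniform_domain_def by (elim conjE exE) (rule that)
  have lip: "lip_path \<gamma> l" if "is_curve \<gamma> 0 l" "\<forall>t\<in>{0..l}. curve_length \<gamma> 0 t = ennreal t" for \<gamma> :: "real \<Rightarrow> 'a" and l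
    unfolding lip_path_def
    using that by (auto simp: is_curve_def intro!: dist_le_length_diff[of _ 0 l])
  show ?thesis
  proof (rule that[OF c(1,2)])
    fix x y assume "x \<in> \<Omega>" "y \<in> \<Omega>" "x \<noteq> y"
    then obtain \<gamma> l where \<gamma>: "is_curve \<gamma> 0 l" "\<forall>t\<in>{0..l}. curve_length \<gamma> 0 t = ennreal t"
      "\<gamma> ` {0..l} \<subseteq> \<Omega>" "\<gamma> 0 = x" "\<gamma> l = y" "l \<le> inverse c * dist x y"
      "\<forall>t\<in>{0..l}. - \<Omega> = {} \<or> infdist (\<gamma> t) (- \<Omega>) \<ge> c * min t (l - t)"
      using c(3) by blast
    show "\<exists>\<gamma> l. lip_path \<gamma> l \<and> \<gamma> ` {0..l} \<subseteq> \<Omega> \<and> \<gamma> 0 = x \<and> \<gamma> l = y \<and> l \<le> inverse c * dist x y \<and>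
        (\<forall>t\<in>{0..l}. c * min t (l - t) \<le> infdist (\<gamma> t) (- \<Omega>))"
      using lip[OF \<gamma>(1,2)] \<gamma>(3-7) assms(2) by (intro exI[of _ \<gamma>] exI[of _ l]) blast
  qed
qed

section \<open>The two smoothing theorems\<close>

lemma ext_absdiff_ge': "ennreal \<bar>real_of_ereal p - real_of_ereal q\<bar> \<le> ext_absdiff p q"
  by (cases p; cases q) (auto simp: ext_absdiff_ereal ext_absdiff_def)

context doubling_space
begin

text \<open>\<open>C\<close> is chosen before \<open>u\<close> and \<open>e\<close>, so that the
  trace bound is uniform and \<open>e\<close> can be sent to 0. The gradient \<open>G\<close> is
  returned along with \<open>v\<close> because it locates the boundary points at which the traces of
  \<open>u\<close> and \<open>v\<close> might differ.\<close>

theorem N11_smoothing: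
  assumes P: "poincare_1_1 M" and unif: "uniform_domain \<Omega>" and compl: "- \<Omega> \<noteq> {}"
  obtains C where "0 < C"
    "\<And>u e. u \<in> N11 M \<Omega> \<Longrightarrow> 0 < e \<Longrightarrow> \<exists>v G. (\<lambda>x. ereal (v x)) \<in> M11 M \<Omega> \<and>
        M11_norm M \<Omega> (\<lambda>x. ereal (v x)) \<le> ennreal C * (N11_norm M \<Omega> u + ennreal e) \<and>
        G \<in> borel_measurable M \<and> (\<integral>\<^sup>+z\<in>\<Omega>. G z \<partial>M) < \<infinity> \<and>
        (\<forall>x r. x \<notin> \<Omega> \<longrightarrow> 0 < r \<longrightarrow> (\<integral>\<^sup>+y\<in>ball x r \<inter> \<Omega>. ext_absdiff (u y) (ereal (v y)) \<partial>M) \<le>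
           ennreal (C * r) * (\<integral>\<^sup>+z\<in>ball x (2 * r) \<inter> \<Omega>. G z \<partial>M))"
proof -
  obtain C\<^sub>P \<Lambda> where C\<^sub>P: "C\<^sub>P > 0" and \<Lambda>: "\<Lambda> \<ge> 1"
    and poin: "\<And>x r u g. r > 0 \<Longrightarrow> u \<in> L1_loc M \<Longrightarrow> upper_gradient u g \<Longrightarrow>
           (\<integral>\<^sup>+y\<in>ball x r. ext_absdiff (u y) (ereal (mean_on M (ball x r) u)) \<partial>M)
               / emeasure M (ball x r)
           \<le> ennreal (C\<^sub>P * r) *
              ((\<integral>\<^sup>+y\<in>ball x (\<Lambda> * r). g y \<partial>M) / emeasure M (ball x (\<Lambda> * r)))"
    using P unfolding poincare_1_1_def by (elim exE conjE) (rule that, assumption, assumption, blast)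
  have opn: "open \<Omega>" using unif by (simp add: uniform_domain_def)
  then have \<Omega>s: "\<Omega> \<in> sets M" by (rule open_sets)
  obtain c where c: "0 < c" "c \<le> 1"
    and curves: "\<And>x y. x \<in> \<Omega> \<Longrightarrow> y \<in> \<Omega> \<Longrightarrow> x \<noteq> y \<Longrightarrow>
      \<exists>\<gamma> l. lip_path \<gamma> l \<and> \<gamma> ` {0..l} \<subseteq> \<Omega> \<and> \<gamma> 0 = x \<and> \<gamma> l = y \<and> l \<le> inverse c * dist x y \<and>
        (\<forall>t\<in>{0..l}. c * min t (l - t) \<le> infdist (\<gamma> t) (- \<Omega>))"
    using uniform_domain_curves[OF unif compl] by blast
  define \<epsilon> where "\<epsilon> = 1 / (16 * \<Lambda>)"
  define K where "K = 2 * C\<^sub>P"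
  have \<epsilon>: "0 < \<epsilon>" using \<Lambda> by (simp add: \<epsilon>_def)
  have K: "0 < K" using C\<^sub>P by (simp add: K_def)
  \<comment> \<open>\<open>n\<close> and \<open>k\<close> count doublings: from radius
    \<open>\<epsilon>/4 * \<delta>\<close> to \<delta> in \<open>boundary_approx\<close>, and from
    \<delta> to \<open>2 / c * \<delta>\<close> in \<open>grad_integral\<close>.\<close>
  obtain n where "4 / \<epsilon> < 2 ^ n" using real_arch_pow[of 2 "4 / \<epsilon>"] by auto
  then have n: "4 \<le> 2 ^ n * \<epsilon>" using \<epsilon> by (simp add: field_simps)
  obtain k where k: "2 / c \<le> 2 ^ k" using real_arch_pow[of 2 "2 / c"] by (auto intro: less_imp_le)
  have c1: "1 \<le> 2 / c" using c by simp
  \<comment> \<open>The constant of \<open>v_hajlasz\<close> with \<open>lip_const\<close> written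
    out: it has to be fixed before \<open>u\<close>, hence before \<open>smoothing\<close> can be
    interpreted.\<close>
  define B where "B = 4 * D ^ 2 * (1 + 2 * D ^ 3) * K * D ^ 4 / c + 1"
  have B: "0 < B" using D_ge_1 K c by (simp add: B_def add_nonneg_pos)
  define C1 C2 C3 where "C1 = 2 * D ^ Suc n" and "C2 = B * D ^ k"
    and "C3 = D ^ (n + 2) * ((1 + 2 * D ^ 3) * K)"
  have C123: "0 < C1" "0 < C2" "0 < C3" using D_ge_1 K B by (auto simp: C1_def C2_def C3_def add_pos_pos)
  define C where "C = C1 + C2 + C3"
  show ?thesis
  proof (rule that[of C])
    show "0 < C" using C123 by (simp add: C_def)
    fix u e assume u: "u \<in> N11 M \<Omega>" and e: "0 < (e::real)"
    let ?I = "INF g\<in>{g. weak_upper_gradient M \<Omega> u g}. \<integral>\<^sup>+x\<in>\<Omega>. g x \<partial>M"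
    have fin: "L1_norm M \<Omega> u < \<infinity>" "?I < \<infinity>"
      using u by (auto simp: N11_def N11_norm_def)
    then have uL1: "u \<in> L1 M \<Omega>" using u by (simp add: L1_def N11_def)
    have "x < x + ennreal (e / 2)" if "x < \<infinity>" for x
      using that e by (cases x) (auto simp: ennreal_less_iff simp flip: ennreal_plus)
    from this[OF fin(2)] have "?I < ?I + ennreal (e / 2)" .
    \<comment> \<open>Half of \<open>e\<close> is spent on a nearly optimal weak gradient, the other
      half on making it Borel.\<close>
    then obtain g where g: "weak_upper_gradient M \<Omega> u g" "(\<integral>\<^sup>+x\<in>\<Omega>. g x \<partial>M) < ?I + ennreal (e / 2)"
      unfolding INF_less_iff by blast
    obtain G where G: "upper_gradient_on \<Omega> u G"
      "(\<integral>\<^sup>+x\<in>\<Omega>. G x \<partial>M) \<le> (\<integral>\<^sup>+x\<in>\<Omega>. g x \<partial>M) + ennreal (e / 2)"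
      using weak_to_borel[OF g(1) _ \<Omega>s, of "e / 2"] e by auto
    have "(\<integral>\<^sup>+x\<in>\<Omega>. G x \<partial>M) \<le> ?I + ennreal (e / 2) + ennreal (e / 2)"
      using G(2) g(2) by (meson add_right_mono less_imp_le order_trans)
    also have "\<dots> = ?I + ennreal e" using e by (simp add: add.assoc flip: ennreal_plus)
    finally have GI: "(\<integral>\<^sup>+x\<in>\<Omega>. G x \<partial>M) \<le> ?I + ennreal e" .
    then have Gfin: "(\<integral>\<^sup>+x\<in>\<Omega>. G x \<partial>M) < \<infinity>"
      using fin(2) by (auto intro: order_le_less_trans)
    interpret smoothing M D \<Omega> "real_on \<Omega> u" G \<epsilon> K
      unfolding \<epsilon>_def K_def by (rule smoothing_instance[OF opn compl uL1 G(1) Gfin C\<^sub>P \<Lambda> poin])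
    let ?v = "\<lambda>x. ereal (v x)"
    let ?h = "\<lambda>x. ennreal B * grad (2 / c) x"
    have B_eq: "lip_const * D ^ 4 / c + 1 = B" by (simp add: B_def lip_const_def)
    have h_int: "(\<integral>\<^sup>+x\<in>\<Omega>. ?h x \<partial>M) \<le> ennreal C2 * (\<integral>\<^sup>+x\<in>\<Omega>. G x \<partial>M)"
    proof -
      have "(\<integral>\<^sup>+x\<in>\<Omega>. ?h x \<partial>M) \<le> (\<integral>\<^sup>+x. ?h x \<partial>M)"
        by (intro nn_integral_mono) (auto simp: indicator_def)
      also have "\<dots> = ennreal B * (\<integral>\<^sup>+x. grad (2 / c) x \<partial>M)" by (intro nn_integral_cmult) measurable
      also have "\<dots> \<le> ennreal B * (ennreal (D ^ k) * (\<integral>\<^sup>+x\<in>\<Omega>. G x \<partial>M))"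
        by (intro mult_left_mono grad_integral c1 k) simp
      also have "\<dots> = ennreal C2 * (\<integral>\<^sup>+x\<in>\<Omega>. G x \<partial>M)"
        using B D_ge_1 by (simp add: C2_def ennreal_mult mult.assoc)
      finally show ?thesis .
    qed
    have v_int: "L1_norm M \<Omega> ?v \<le> ennreal C1 * L1_norm M \<Omega> u"
    proof -
      have "L1_norm M \<Omega> ?v \<le> (\<integral>\<^sup>+x. ennreal \<bar>v x\<bar> \<partial>M)"
        unfolding L1_norm_def by (intro nn_integral_mono) (auto simp: indicator_def e2ennreal_ereal)
      also have "\<dots> \<le> ennreal C1 * (\<integral>\<^sup>+x. ennreal \<bar>real_on \<Omega> u x\<bar> \<partial>M)"
        unfolding C1_def using n by (intro v_L1) simp
      also have "\<dots> \<le> ennreal C1 * L1_norm M \<Omega> u"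
        by (intro mult_left_mono L1_real_on(2)[OF uL1 \<Omega>s]) simp
      finally show ?thesis .
    qed
    have hg: "hajlasz_gradient M \<Omega> ?v ?h"
      unfolding hajlasz_gradient_def
    proof (intro conjI)
      show "?h \<in> borel_measurable (restrict_space M \<Omega>)" by (intro measurable_restrict_space1) measurable
      show "(\<integral>\<^sup>+x\<in>\<Omega>. ?h x \<partial>M) < \<infinity>"
        using h_int Gfin by (auto intro: order_le_less_trans simp: ennreal_mult_less_top)
      have "ext_absdiff (?v x) (?v y) \<le> ennreal (dist x y) * (?h x + ?h y)" if "x \<in> \<Omega>" "y \<in> \<Omega>" for x y
        using v_hajlasz[OF c _ that, unfolded B_eq] curves unfolding \<delta>_def ext_absdiff_ereal by blast
      then show "\<exists>A. A \<subseteq> \<Omega> \<and> A \<in> null_sets M \<and>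
          (\<forall>x\<in>\<Omega> - A. \<forall>y\<in>\<Omega> - A. ext_absdiff (?v x) (?v y) \<le> ennreal (dist x y) * (?h x + ?h y))"
        by (intro exI[of _ "{}"]) auto
    qed
    have "?v \<in> borel_measurable (restrict_space M \<Omega>)" by (intro measurable_restrict_space1) measurable
    moreover have "L1_norm M \<Omega> ?v < \<infinity>"
      using v_int fin(1) by (auto intro: order_le_less_trans simp: ennreal_mult_less_top)
    ultimately have M11: "?v \<in> M11 M \<Omega>" using hg by (auto simp: M11_def L1_def)
    have "M11_norm M \<Omega> ?v \<le> L1_norm M \<Omega> ?v + (\<integral>\<^sup>+x\<in>\<Omega>. ?h x \<partial>M)"
      unfolding M11_norm_def using hg by (intro add_left_mono INF_lower) auto
    also have "\<dots> \<le> ennreal C1 * L1_norm M \<Omega> u + ennreal C2 * (?I + ennreal e)"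
      by (intro add_mono v_int order_trans[OF h_int] mult_left_mono GI) simp
    also have "\<dots> \<le> ennreal C * L1_norm M \<Omega> u + ennreal C * (?I + ennreal e)"
      using C123 by (intro add_mono mult_right_mono ennreal_leI) (auto simp: C_def)
    also have "\<dots> = ennreal C * (N11_norm M \<Omega> u + ennreal e)"
      by (simp add: N11_norm_def distrib_left add.assoc)
    finally have norm: "M11_norm M \<Omega> ?v \<le> ennreal C * (N11_norm M \<Omega> u + ennreal e)" .
    have "(\<integral>\<^sup>+y\<in>ball x r \<inter> \<Omega>. ext_absdiff (u y) (ereal (v y)) \<partial>M) \<le>
           ennreal (C * r) * (\<integral>\<^sup>+z\<in>ball x (2 * r) \<inter> \<Omega>. G z \<partial>M)" if "x \<notin> \<Omega>" "0 < r" for x r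
    proof -
      have "(\<integral>\<^sup>+y\<in>ball x r \<inter> \<Omega>. ext_absdiff (u y) (ereal (v y)) \<partial>M) =
          (\<integral>\<^sup>+y\<in>ball x r \<inter> \<Omega>. ennreal \<bar>real_on \<Omega> u y - v y\<bar> \<partial>M)"
        using L1_real_on(3)[OF uL1 \<Omega>s]
        by (intro nn_integral_cong_AE) (auto elim!: eventually_mono simp: indicator_def real_on_def ext_absdiff_eq)
      also have "\<dots> \<le> ennreal (C3 * r) * (\<integral>\<^sup>+z\<in>ball x (2 * r) \<inter> \<Omega>. G z \<partial>M)"
        unfolding C3_def by (rule boundary_approx[OF n that])
      also have "\<dots> \<le> ennreal (C * r) * (\<integral>\<^sup>+z\<in>ball x (2 * r) \<inter> \<Omega>. G z \<partial>M)"
        using C123 that(2) by (intro mult_right_mono ennreal_leI) (auto simp: C_def)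
      finally show ?thesis .
    qed
    with M11 norm Gfin show "\<exists>v G. (\<lambda>x. ereal (v x)) \<in> M11 M \<Omega> \<and>
        M11_norm M \<Omega> (\<lambda>x. ereal (v x)) \<le> ennreal C * (N11_norm M \<Omega> u + ennreal e) \<and>
        G \<in> borel_measurable M \<and> (\<integral>\<^sup>+z\<in>\<Omega>. G z \<partial>M) < \<infinity> \<and>
        (\<forall>x r. x \<notin> \<Omega> \<longrightarrow> 0 < r \<longrightarrow> (\<integral>\<^sup>+y\<in>ball x r \<inter> \<Omega>. ext_absdiff (u y) (ereal (v y)) \<partial>M) \<le>
           ennreal (C * r) * (\<integral>\<^sup>+z\<in>ball x (2 * r) \<inter> \<Omega>. G z \<partial>M))"
      by (intro exI[of _ v] exI[of _ G]) (simp add: G_meas)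
  qed
qed

text \<open>By completeness of the measure, whatever the modification adds to a preimage is a
  measurable subset of the null set.\<close>

lemma measurable_off_null_set:
  assumes f: "f \<in> measurable M L" and N: "N \<in> null_sets M" and eq: "\<And>x. x \<notin> N \<Longrightarrow> f x = g x"
    and range: "\<And>x. g x \<in> space L"
  shows "g \<in> measurable M L"
proof (rule measurableI)
  fix A assume A: "A \<in> sets L"
  have "g -` A \<inter> space M = (f -` A \<inter> space M - N) \<union> (g -` A \<inter> N)"
    using eq by auto
  moreover have "g -` A \<inter> N \<in> sets M" by (rule null_subset[OF N]) auto
  moreover have "f -` A \<inter> space M - N \<in> sets M" using measurable_sets[OF f A] N by auto
  ultimately show "g -` A \<inter> space M \<in> sets M" by (simp only: sets.Un)
qed (rule range)

text \<open>The representative is real-valued, and \<open>4 * h\<close> is an upper gradient along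
  all curves in \<Omega>, so the exceptional curve family is empty. Within \<Omega> it can differ
  from \<open>u\<close> only where the Borel majorant \<open>h\<close> is infinite.\<close>

theorem M11_representative:
  assumes \<Omega>: "\<Omega> \<in> sets M" and u: "u \<in> M11 M \<Omega>" and g: "hajlasz_gradient M \<Omega> u g"
  shows "\<exists>w. w \<in> N11 M \<Omega> \<and> (AE x in M. x \<in> \<Omega> \<longrightarrow> w x = u x) \<and>
    N11_norm M \<Omega> w \<le> 4 * (L1_norm M \<Omega> u + (\<integral>\<^sup>+x\<in>\<Omega>. g x \<partial>M))"
proof -
  obtain A where A: "A \<subseteq> \<Omega>" "A \<in> null_sets M"
    "\<And>x y. x \<in> \<Omega> - A \<Longrightarrow> y \<in> \<Omega> - A \<Longrightarrow> ext_absdiff (u x) (u y) \<le> ennreal (dist x y) * (g x + g y)"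
    using g unfolding hajlasz_gradient_def by blast
  have gfin: "(\<integral>\<^sup>+x\<in>\<Omega>. g x \<partial>M) < \<infinity>" using g by (simp add: hajlasz_gradient_def)
  have "(\<lambda>x. g x * indicator \<Omega> x) \<in> borel_measurable M"
    using g \<Omega> unfolding hajlasz_gradient_def
    by (subst (asm) borel_measurable_restrict_space_iff_ennreal) auto
  \<comment> \<open>The value \<infinity> on the exceptional set \<open>A\<close> is the encoding
    expected by \<open>hajlasz_pair\<close>; as \<open>A\<close> is null, the integral does not
    change.\<close>
  then have "(\<lambda>x. g x * indicator \<Omega> x + \<infinity> * indicator A x) \<in> borel_measurable M"
    using A(2) by (intro borel_measurable_add borel_measurable_times borel_measurable_indicator) auto
  then obtain h where h: "h \<in> borel_measurable borel" "\<And>x. g x * indicator \<Omega> x + \<infinity> * indicator A x \<le> h x"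
    "AE x in M. h x = g x * indicator \<Omega> x + \<infinity> * indicator A x" using borel_majorant by blast
  have hM: "h \<in> borel_measurable M" by (rule measurable_from_borel[OF h(1)])
  have h_ae: "AE x in M. h x = g x * indicator \<Omega> x"
    using h(3) AE_not_in[OF A(2)] by eventually_elim simp
  have h_int: "(\<integral>\<^sup>+x. h x \<partial>M) = (\<integral>\<^sup>+x\<in>\<Omega>. g x \<partial>M)"
    by (rule nn_integral_cong_AE[OF h_ae])
  have good: "x \<notin> A" "g x \<le> h x" if "x \<in> \<Omega>" "h x < \<infinity>" for x
  proof -
    show "x \<notin> A"
    proof
      assume "x \<in> A"
      then have "\<infinity> \<le> h x" using h(2)[of x] by (simp add: top_unique)
      then show False using that(2) by simp
    qed
    then show "g x \<le> h x" using h(2)[of x] that(1) by simp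
  qed
  have hajl: "ext_absdiff (u x) (u y) \<le> ennreal (dist x y) * (h x + h y)"
    if "x \<in> \<Omega>" "y \<in> \<Omega>" "h x < \<infinity>" "h y < \<infinity>" for x y
  proof -
    have "ext_absdiff (u x) (u y) \<le> ennreal (dist x y) * (g x + g y)"
      using good(1)[OF that(1,3)] good(1)[OF that(2,4)] that by (intro A(3)) auto
    also have "\<dots> \<le> ennreal (dist x y) * (h x + h y)"
      using good(2)[OF that(1,3)] good(2)[OF that(2,4)] by (intro mult_left_mono add_mono) auto
    finally show ?thesis .
  qed
  interpret hajlasz_pair \<Omega> "\<lambda>x. real_of_ereal (u x)" h
  proof
    show "h \<in> borel_measurable borel" by (rule h(1))
    show "ennreal \<bar>real_of_ereal (u x) - real_of_ereal (u y)\<bar> \<le> ennreal (dist x y) * (h x + h y)"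
      if "x \<in> \<Omega>" "y \<in> \<Omega>" "h x < \<infinity>" "h y < \<infinity>" for x y
      by (rule order_trans[OF ext_absdiff_ge' hajl[OF that]])
  qed
  let ?w = "\<lambda>x. ereal (repr x)"
  have w_eq: "?w x = u x" if "x \<in> \<Omega>" "h x < \<infinity>" for x
  proof -
    \<comment> \<open>An infinite value has infinite \<open>ext_absdiff\<close> from itself, so the
      Hajlasz inequality with both points equal to \<open>x\<close> forces \<open>u x\<close> to be
      finite.\<close>
    have "ext_absdiff (u x) (u x) \<le> 0" using hajl[OF that(1,1) that(2,2)] by simp
    then have "\<bar>u x\<bar> \<noteq> \<infinity>" by (auto simp: ext_absdiff_def split: if_splits)
    then show ?thesis using repr_eq[OF that] by (simp add: ereal_real)
  qed
  define N where "N = {x \<in> space M. h x = \<infinity>}"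
  have N: "N \<in> null_sets M"
  proof -
    have "AE x in M. h x \<noteq> \<infinity>" by (rule nn_integral_PInf_AE[OF hM]) (use h_int gfin in auto)
    moreover have "N = h -` {\<infinity>} \<inter> space M" by (auto simp: N_def)
    then have "N \<in> sets M" using measurable_sets[OF hM, of "{\<infinity>}"] by simp
    moreover have "{x \<in> space M. \<not> h x \<noteq> \<infinity>} = N" by (auto simp: N_def)
    ultimately show ?thesis using AE_iff_null[of M "\<lambda>x. h x \<noteq> \<infinity>"] by (simp only:)
  qed
  have ae: "AE x in M. x \<in> \<Omega> \<longrightarrow> ?w x = u x"
    using AE_not_in[OF N] by eventually_elim (use w_eq in \<open>auto simp: N_def top.not_eq_extremum\<close>)
  have uL1: "u \<in> L1 M \<Omega>" using u by (simp add: M11_def)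
  have "(\<lambda>x. if x \<in> \<Omega> then ?w x else 0) \<in> borel_measurable M"
  proof (rule measurable_off_null_set[OF L1_mono_set(2)[OF \<Omega> \<Omega> order_refl _ uL1] N])
    show "(if x \<in> \<Omega> then u x else 0) = (if x \<in> \<Omega> then ?w x else 0)" if "x \<notin> N" for x
      using w_eq[of x] that by (auto simp: N_def top.not_eq_extremum)
  qed auto
  then have "(\<lambda>x. if x \<in> \<Omega> then ?w x else 0) \<in> borel_measurable (restrict_space M \<Omega>)"
    by (rule measurable_restrict_space1)
  then have wm: "?w \<in> borel_measurable (restrict_space M \<Omega>)"
    by (rule measurable_cong[THEN iffD1, rotated]) (simp add: space_restrict_space)
  have "weak_upper_gradient M \<Omega> ?w (\<lambda>x. 4 * h x)"
    unfolding weak_upper_gradient_def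
  proof (intro conjI exI[of _ "{}"] allI impI)
    show "(\<lambda>x. 4 * h x) \<in> borel_measurable (restrict_space M \<Omega>)"
      using hM by (intro measurable_restrict_space1) measurable
    show "zero_modulus M {}" by (auto simp: zero_modulus_def intro!: exI[of _ "\<lambda>_. 0"])
    show "ext_absdiff (?w (\<gamma> a)) (?w (\<gamma> b)) \<le> curve_integral (\<lambda>x. 4 * h x) \<gamma> a b"
      if "nonconstant_curve \<gamma> a b" "\<gamma> ` {a..b} \<subseteq> \<Omega>" for \<gamma> a b
      using repr_upper_gradient[OF that] by (simp add: ext_absdiff_ereal)
  qed
  then have "N11_norm M \<Omega> ?w \<le> L1_norm M \<Omega> ?w + (\<integral>\<^sup>+x\<in>\<Omega>. 4 * h x \<partial>M)"
    unfolding N11_norm_def by (intro add_left_mono INF_lower) simp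
  also have "L1_norm M \<Omega> ?w = L1_norm M \<Omega> u"
    unfolding L1_norm_def using ae
    by (intro nn_integral_cong_AE) (elim eventually_mono, metis indicator_simps(2) mult_zero_right)
  also have "(\<integral>\<^sup>+x\<in>\<Omega>. 4 * h x \<partial>M) \<le> (\<integral>\<^sup>+x. 4 * h x \<partial>M)"
    by (intro nn_integral_mono) (auto simp: indicator_def)
  also have "\<dots> = 4 * (\<integral>\<^sup>+x\<in>\<Omega>. g x \<partial>M)" using hM by (simp add: nn_integral_cmult h_int)
  also have "L1_norm M \<Omega> u + 4 * (\<integral>\<^sup>+x\<in>\<Omega>. g x \<partial>M) \<le> 4 * L1_norm M \<Omega> u + 4 * (\<integral>\<^sup>+x\<in>\<Omega>. g x \<partial>M)"
    using mult_right_mono[of 1 4 "L1_norm M \<Omega> u"] by (intro add_right_mono) simp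
  finally have norm: "N11_norm M \<Omega> ?w \<le> 4 * (L1_norm M \<Omega> u + (\<integral>\<^sup>+x\<in>\<Omega>. g x \<partial>M))"
    by (simp add: distrib_left add_left_mono)
  moreover have "N11_norm M \<Omega> ?w < \<infinity>"
    using norm uL1 gfin by (auto intro: order_le_less_trans simp: L1_def ennreal_mult_less_top)
  ultimately show ?thesis using wm ae by (intro exI[of _ ?w]) (simp add: N11_def)
qed

end

section \<open>Functions without trace on sets where mass concentrates\<close>

lemma borel_measurable_nn_integral_countable:
  assumes I: "countable I" and f: "\<And>i. i \<in> I \<Longrightarrow> f i \<in> borel_measurable M"
  shows "(\<lambda>x. \<integral>\<^sup>+i. f i x \<partial>count_space I) \<in> borel_measurable M"
proof (cases "finite I")
  case True
  then show ?thesis using f by (simp add: nn_integral_count_space_finite)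
next
  case False
  have b: "bij_betw (from_nat_into I) UNIV I" using I False by (rule bij_betw_from_nat_into)
  have "(\<integral>\<^sup>+i. f i x \<partial>count_space I) = (\<Sum>n. f (from_nat_into I n) x)" for x
    by (subst nn_integral_bij_count_space[OF b, symmetric]) (rule nn_integral_count_space_nat)
  moreover have "from_nat_into I n \<in> I" for n
    using False by (metis from_nat_into infinite_imp_nonempty)
  ultimately show ?thesis using f by (simp add: borel_measurable_suminf)
qed

text \<open>Equal to 1 on \<open>ball j (5 * r)\<close>, the enlargement in the Vitali lemma, and 0
  outside \<open>ball j (8 * r)\<close>, which three doublings reach from radius \<open>r\<close>;
  in between it decreases with slope \<open>1 / (3 * r)\<close>.\<close>

definition bump :: "('a::metric_space) \<Rightarrow> real \<Rightarrow> 'a \<Rightarrow> real" where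
  "bump j r y = max 0 (min 1 (8 / 3 - dist j y / (3 * r)))"

lemma bump_eq_1: "0 < r \<Longrightarrow> y \<in> ball j (5 * r) \<Longrightarrow> bump j r y = 1"
  by (auto simp: bump_def field_simps min_def max_def)

lemma bump_eq_0: "0 < r \<Longrightarrow> y \<notin> ball j (8 * r) \<Longrightarrow> bump j r y = 0"
  by (auto simp: bump_def field_simps min_def max_def)

lemma bump_lipschitz:
  assumes "0 < r"
  shows "\<bar>bump j r x - bump j r y\<bar> \<le> dist x y * (1 / r)"
proof -
  have "\<bar>bump j r x - bump j r y\<bar> \<le> \<bar>dist j x / (3 * r) - dist j y / (3 * r)\<bar>"
    unfolding bump_def by linarith
  also have "\<dots> = \<bar>dist j x - dist j y\<bar> / (3 * r)" using assms by (simp add: abs_divide flip: diff_divide_distrib)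
  also have "\<dots> \<le> dist x y / (3 * r)"
    using assms by (intro divide_right_mono) (metis abs_dist_diff_le dist_commute, simp)
  also have "\<dots> \<le> dist x y * (1 / r)" using assms by (simp add: field_simps)
  finally show ?thesis .
qed

text \<open>One-sided and with nonnegative terms only, so that it can be summed over infinitely many
  bumps without subtracting infinite values. Outside \<open>ball j (8 * r)\<close> the left-hand
  side is 0; inside, the first indicator carries the estimate.\<close>

lemma bump_hajlasz:
  assumes "0 < r"
  shows "ennreal (bump j r x) \<le> ennreal (bump j r y) + ennreal (dist x y) *
    (ennreal (1 / r) * indicator (ball j (8 * r)) x + ennreal (1 / r) * indicator (ball j (8 * r)) y)"
proof (cases "x \<in> ball j (8 * r)")
  case True
  have "bump j r x \<le> bump j r y + dist x y * (1 / r)"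
    using bump_lipschitz[OF assms, of j x y] by linarith
  then have "ennreal (bump j r x) \<le> ennreal (bump j r y + dist x y * (1 / r))" by (rule ennreal_leI)
  also have "\<dots> = ennreal (bump j r y) + ennreal (dist x y) * ennreal (1 / r)"
    using assms by (subst ennreal_plus) (auto simp: bump_def simp flip: ennreal_mult)
  also have "\<dots> \<le> ennreal (bump j r y) + ennreal (dist x y) *
    (ennreal (1 / r) * indicator (ball j (8 * r)) x + ennreal (1 / r) * indicator (ball j (8 * r)) y)"
    using True by (intro add_left_mono mult_left_mono) auto
  finally show ?thesis .
next
  case False
  then show ?thesis using bump_eq_0[OF assms False] by simp
qed

text \<open>\<open>r\<close> times the mean of \<open>G\<close> over
  \<open>ball x r \<inter> \<Omega>\<close> is at least \<open>e\<close> for arbitrarily small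
  \<open>r\<close>, multiplied out to avoid division. Off these sets for all \<open>e > 0\<close>,
  this quantity tends to 0.\<close>

definition concentration_set ::
    "'a::metric_space measure \<Rightarrow> 'a set \<Rightarrow> ('a \<Rightarrow> ennreal) \<Rightarrow> real \<Rightarrow> 'a set" where
  "concentration_set M \<Omega> G e = {x \<in> frontier \<Omega>. \<forall>s>0. \<exists>r. 0 < r \<and> r < s \<and>
     ennreal e * emeasure M (ball x r \<inter> \<Omega>) \<le> ennreal r * (\<integral>\<^sup>+z\<in>ball x r \<inter> \<Omega>. G z \<partial>M)}"

locale doubling_domain = domain_space M D \<Omega> for M :: "'a::metric_space measure" and D \<Omega> +
  fixes B :: real
  assumes B_ge_1: "1 \<le> B"
    and dom_pos: "x \<in> closure \<Omega> \<Longrightarrow> 0 < r \<Longrightarrow> 0 < emeasure M (ball x r \<inter> \<Omega>)"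
    and dom_double: "x \<in> closure \<Omega> \<Longrightarrow> 0 < r \<Longrightarrow>
      emeasure M (ball x (2 * r) \<inter> \<Omega>) \<le> ennreal B * emeasure M (ball x r \<inter> \<Omega>)"
begin

lemma ball_dom_sets [measurable, simp]: "ball x r \<inter> \<Omega> \<in> sets M" by simp

lemma dom_finite: "emeasure M (ball x r \<inter> \<Omega>) < \<infinity>"
proof -
  have "emeasure M (ball x r \<inter> \<Omega>) \<le> emeasure M (ball x r)" by (intro emeasure_mono) auto
  then show ?thesis using ball_finite by (rule order_le_less_trans)
qed

lemma frontier_notin: "x \<in> frontier \<Omega> \<Longrightarrow> x \<notin> \<Omega>" "x \<in> frontier \<Omega> \<Longrightarrow> x \<in> closure \<Omega>"
  using open_dom by (auto simp: frontier_def interior_open)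

text \<open>The measure with density \<open>G\<close> is finite on \<Omega>, hence continuous along
  the decreasing collars, and these shrink to the empty set because \<delta> is positive on
  \<Omega>.\<close>

lemma small_collar:
  assumes G: "G \<in> borel_measurable M" "(\<integral>\<^sup>+z\<in>\<Omega>. G z \<partial>M) < \<infinity>" and e: "0 < e"
  shows "\<exists>s. 0 < s \<and> s \<le> 1 \<and> (\<integral>\<^sup>+z\<in>{z \<in> \<Omega>. \<delta> z < s}. G z \<partial>M) < ennreal e"
proof -
  define \<nu> where "\<nu> = density M (\<lambda>z. G z * indicator \<Omega> z)"
  define S where "S n = {z \<in> \<Omega>. \<delta> z < 1 / real (Suc n)}" for n
  have Gm: "(\<lambda>z. G z * indicator \<Omega> z) \<in> borel_measurable M" using G(1) by measurable
  have "{z. \<delta> z < 1 / real (Suc n)} \<in> sets M" for n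
    by (intro open_sets open_Collect_less continuous_intros \<delta>_continuous)
  then have Ss: "S n \<in> sets M" for n unfolding S_def by (simp add: Collect_conj_eq)
  have \<nu>S: "emeasure \<nu> (S n) = (\<integral>\<^sup>+z\<in>S n. G z \<partial>M)" for n
    unfolding \<nu>_def using Ss[of n] Gm
    by (subst emeasure_density) (auto intro!: nn_integral_cong simp: S_def indicator_def)
  have fin: "emeasure \<nu> (S n) \<noteq> \<infinity>" for n
  proof -
    have "(\<integral>\<^sup>+z\<in>S n. G z \<partial>M) \<le> (\<integral>\<^sup>+z\<in>\<Omega>. G z \<partial>M)"
      by (intro nn_integral_mono) (auto simp: S_def indicator_def)
    then show ?thesis using G(2) \<nu>S[of n] by (auto simp: top_unique)
  qed
  have "(\<lambda>n. emeasure \<nu> (S n)) \<longlonglongrightarrow> emeasure \<nu> (\<Inter>n. S n)"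
  proof (rule Lim_emeasure_decseq)
    show "range S \<subseteq> sets \<nu>" using Ss by (auto simp: \<nu>_def)
    show "decseq S" unfolding decseq_def
    proof (intro allI impI)
      fix m n :: nat assume "m \<le> n"
      then have "1 / real (Suc n) \<le> 1 / real (Suc m)" by (intro divide_left_mono) auto
      then show "S n \<subseteq> S m" unfolding S_def by auto
    qed
  qed (rule fin)
  moreover have "(\<Inter>n. S n) = {}"
  proof (rule ccontr)
    assume "(\<Inter>n. S n) \<noteq> {}"
    then obtain z where z: "\<And>n. z \<in> S n" by blast
    then have "0 < \<delta> z" using \<delta>_pos_iff by (simp add: S_def)
    then obtain n where "inverse (real (Suc n)) < \<delta> z" using reals_Archimedean by blast
    then show False using z[of n] by (simp add: S_def inverse_eq_divide)
  qed
  ultimately have "(\<lambda>n. emeasure \<nu> (S n)) \<longlonglongrightarrow> 0" by simp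
  then have "\<forall>\<^sub>F n in sequentially. emeasure \<nu> (S n) < ennreal e"
    using e by (intro order_tendstoD(2)) auto
  then obtain n where "emeasure \<nu> (S n) < ennreal e" by (meson eventually_sequentially order_refl)
  then show ?thesis unfolding \<nu>S by (intro exI[of _ "1 / real (Suc n)"]) (auto simp: S_def)
qed

text \<open>The concentration condition bounds the measure of
  \<open>ball j (r j) \<inter> \<Omega>\<close>, divided by \<open>r j\<close>, by
  \<open>1 / e\<close> times the integral of \<open>G\<close> over the same set; three doublings
  within \<Omega> cost \<open>B ^ 3\<close>. The Vitali balls are disjoint with radii below
  \<open>s\<close>, so their parts in \<Omega> lie in a collar where the integral of
  \<open>G\<close> is below \<open>\<eta> * e / B ^ 3\<close>. Thus the set has content 0 in
  codimension one.\<close>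

lemma concentration_cover:
  assumes G: "G \<in> borel_measurable M" "(\<integral>\<^sup>+z\<in>\<Omega>. G z \<partial>M) < \<infinity>" and e: "0 < e" and \<eta>: "0 < \<eta>"
  shows "\<exists>C r. countable C \<and> (\<forall>j\<in>C. 0 < r j \<and> r j \<le> 1) \<and>
    (\<forall>x\<in>concentration_set M \<Omega> G e. \<exists>j\<in>C. x \<in> ball j (5 * r j)) \<and>
    (\<integral>\<^sup>+j. ennreal (1 / r j) * emeasure M (ball j (8 * r j) \<inter> \<Omega>) \<partial>count_space C) \<le> ennreal \<eta>"
proof -
  let ?E = "concentration_set M \<Omega> G e"
  obtain s where s: "0 < s" "s \<le> 1" "(\<integral>\<^sup>+z\<in>{z \<in> \<Omega>. \<delta> z < s}. G z \<partial>M) < ennreal (\<eta> * e / B ^ 3)"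
    using small_collar[OF G, of "\<eta> * e / B ^ 3"] e \<eta> B_ge_1 by auto
  have "\<exists>r. 0 < r \<and> r < s \<and> ennreal e * emeasure M (ball x r \<inter> \<Omega>) \<le> ennreal r * (\<integral>\<^sup>+z\<in>ball x r \<inter> \<Omega>. G z \<partial>M)"
    if "x \<in> ?E" for x using that s(1) unfolding concentration_set_def by blast
  then obtain r where r: "\<And>x. x \<in> ?E \<Longrightarrow> 0 < r x" "\<And>x. x \<in> ?E \<Longrightarrow> r x < s"
    "\<And>x. x \<in> ?E \<Longrightarrow> ennreal e * emeasure M (ball x (r x) \<inter> \<Omega>) \<le> ennreal (r x) * (\<integral>\<^sup>+z\<in>ball x (r x) \<inter> \<Omega>. G z \<partial>M)"
    by metis
  have cl: "x \<in> closure \<Omega>" "x \<notin> \<Omega>" if "x \<in> ?E" for x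
    using that frontier_notin by (auto simp: concentration_set_def)
  have rs: "0 < r i \<and> r i \<le> s" if "i \<in> ?E" for i using r(1,2)[OF that] by simp
  obtain C where C: "C \<subseteq> ?E" "disjoint_family_on (\<lambda>i. ball i (r i)) C"
    "\<And>i. i \<in> ?E \<Longrightarrow> \<exists>j\<in>C. ball i (r i) \<subseteq> ball j (5 * r j)"
    by (rule Vitali_covering_metric[of ?E r s "\<lambda>x. x", OF rs]) (auto intro: that)
  have disj: "disjoint_family_on (\<lambda>i. ball i (r i) \<inter> \<Omega>) C"
    using C(2) unfolding disjoint_family_on_def by blast
  have cnt: "countable C"
    using disj by (rule countable_disjoint_positive) (use C(1) cl r in \<open>auto intro!: dom_pos\<close>)
  define \<nu> where "\<nu> = density M G"
  have \<nu>: "emeasure \<nu> A = (\<integral>\<^sup>+z\<in>A. G z \<partial>M)" if "A \<in> sets M" for A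
    unfolding \<nu>_def using G(1) that by (rule emeasure_density)
  have col: "{z \<in> \<Omega>. \<delta> z < s} \<in> sets M"
  proof -
    have "{z. \<delta> z < s} \<in> sets M"
      by (intro open_sets open_Collect_less continuous_intros \<delta>_continuous)
    then show ?thesis by (simp add: Collect_conj_eq)
  qed
  have single: "ennreal (1 / r j) * emeasure M (ball j (8 * r j) \<inter> \<Omega>) \<le>
      ennreal (B ^ 3 / e) * emeasure \<nu> (ball j (r j) \<inter> \<Omega>)" if j: "j \<in> C" for j
  proof -
    have jE: "j \<in> ?E" using C(1) j by auto
    have rj: "0 < r j" by (rule r(1)[OF jE])
    have d: "emeasure M (ball j (2 * t) \<inter> \<Omega>) \<le> ennreal B * emeasure M (ball j t \<inter> \<Omega>)" if "0 < t" for t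
      using cl(1)[OF jE] that by (rule dom_double)
    have "emeasure M (ball j (8 * r j) \<inter> \<Omega>) \<le> ennreal B * emeasure M (ball j (4 * r j) \<inter> \<Omega>)"
      using d[of "4 * r j"] rj by simp
    also have "\<dots> \<le> ennreal B * (ennreal B * emeasure M (ball j (2 * r j) \<inter> \<Omega>))"
      using d[of "2 * r j"] rj by (intro mult_left_mono) simp_all
    also have "\<dots> \<le> ennreal B * (ennreal B * (ennreal B * emeasure M (ball j (r j) \<inter> \<Omega>)))"
      using d[of "r j"] rj by (intro mult_left_mono) simp_all
    also have "\<dots> = ennreal (B ^ 3) * emeasure M (ball j (r j) \<inter> \<Omega>)"
      using B_ge_1 by (simp add: power3_eq_cube ennreal_mult mult.assoc)
    finally have 1: "emeasure M (ball j (8 * r j) \<inter> \<Omega>) \<le> ennreal (B ^ 3) * emeasure M (ball j (r j) \<inter> \<Omega>)" .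
    have "emeasure M (ball j (r j) \<inter> \<Omega>) = ennreal (1 / e) * (ennreal e * emeasure M (ball j (r j) \<inter> \<Omega>))"
      using e by (simp add: mult.assoc[symmetric] flip: ennreal_mult)
    also have "\<dots> \<le> ennreal (1 / e) * (ennreal (r j) * emeasure \<nu> (ball j (r j) \<inter> \<Omega>))"
      using r(3)[OF jE] by (intro mult_left_mono) (simp_all add: \<nu>)
    finally have "emeasure M (ball j (8 * r j) \<inter> \<Omega>) \<le>
        ennreal (B ^ 3) * (ennreal (1 / e) * (ennreal (r j) * emeasure \<nu> (ball j (r j) \<inter> \<Omega>)))"
      by (intro order_trans[OF 1] mult_left_mono) auto
    then have "ennreal (1 / r j) * emeasure M (ball j (8 * r j) \<inter> \<Omega>) \<le> ennreal (1 / r j) *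
        (ennreal (B ^ 3) * (ennreal (1 / e) * (ennreal (r j) * emeasure \<nu> (ball j (r j) \<inter> \<Omega>))))"
      by (intro mult_left_mono) auto
    also have "\<dots> = (ennreal (1 / r j) * ennreal (r j)) * (ennreal (B ^ 3) * ennreal (1 / e)) * emeasure \<nu> (ball j (r j) \<inter> \<Omega>)"
      by (simp only: mult_ac)
    also have "ennreal (1 / r j) * ennreal (r j) = 1" using rj by (simp flip: ennreal_mult)
    also have "ennreal (B ^ 3) * ennreal (1 / e) = ennreal (B ^ 3 / e)"
      using e B_ge_1 by (simp flip: ennreal_mult)
    finally show ?thesis by simp
  qed
  have "(\<integral>\<^sup>+j. ennreal (1 / r j) * emeasure M (ball j (8 * r j) \<inter> \<Omega>) \<partial>count_space C) \<le>
      (\<integral>\<^sup>+j. ennreal (B ^ 3 / e) * emeasure \<nu> (ball j (r j) \<inter> \<Omega>) \<partial>count_space C)"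
    by (intro nn_integral_mono single) simp
  also have "\<dots> = ennreal (B ^ 3 / e) * (\<integral>\<^sup>+j. emeasure \<nu> (ball j (r j) \<inter> \<Omega>) \<partial>count_space C)"
    by (intro nn_integral_cmult) simp
  also have "(\<integral>\<^sup>+j. emeasure \<nu> (ball j (r j) \<inter> \<Omega>) \<partial>count_space C) = emeasure \<nu> (\<Union>j\<in>C. ball j (r j) \<inter> \<Omega>)"
    using cnt disj by (intro emeasure_UN_countable[symmetric]) (auto simp: \<nu>_def)
  also have "\<dots> \<le> emeasure \<nu> {z \<in> \<Omega>. \<delta> z < s}"
  proof (rule emeasure_mono)
    show "(\<Union>j\<in>C. ball j (r j) \<inter> \<Omega>) \<subseteq> {z \<in> \<Omega>. \<delta> z < s}"
    proof
      fix z assume "z \<in> (\<Union>j\<in>C. ball j (r j) \<inter> \<Omega>)"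
      then obtain j where j: "j \<in> C" "dist j z < r j" "z \<in> \<Omega>" by auto
      then have jE: "j \<in> ?E" using C(1) by auto
      have "\<delta> z \<le> dist z j" by (rule \<delta>_le_dist[OF cl(2)[OF jE]])
      also have "\<dots> < s" using j(2) r(2)[OF jE] by (simp add: dist_commute)
      finally show "z \<in> {z \<in> \<Omega>. \<delta> z < s}" using j(3) by simp
    qed
    show "{z \<in> \<Omega>. \<delta> z < s} \<in> sets \<nu>" using col by (simp add: \<nu>_def)
  qed
  also have "\<dots> \<le> ennreal (\<eta> * e / B ^ 3)" using s(3) by (simp add: \<nu>[OF col])
  finally have "(\<integral>\<^sup>+j. ennreal (1 / r j) * emeasure M (ball j (8 * r j) \<inter> \<Omega>) \<partial>count_space C) \<le>
      ennreal (B ^ 3 / e) * ennreal (\<eta> * e / B ^ 3)" by (simp add: mult_left_mono)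
  also have "\<dots> = ennreal \<eta>" using e \<eta> B_ge_1 by (simp flip: ennreal_mult)
  finally have sum: "(\<integral>\<^sup>+j. ennreal (1 / r j) * emeasure M (ball j (8 * r j) \<inter> \<Omega>) \<partial>count_space C) \<le> ennreal \<eta>" .
  have "\<exists>j\<in>C. x \<in> ball j (5 * r j)" if "x \<in> ?E" for x
    using C(3)[OF that] r(1)[OF that] by (meson centre_in_ball subsetD)
  moreover have "0 < r j \<and> r j \<le> 1" if "j \<in> C" for j
    using r(1,2)[of j] C(1) that s(2) by fastforce
  ultimately show ?thesis using cnt sum by blast
qed

end

section \<open>A function that blows up on the concentration set\<close>

context doubling_domain
begin

text \<open>The \<open>k\<close>-th cover contributes bumps whose gradients have total integral at
  most \<open>(1/2) ^ k\<close>, so the sum over all covers remains integrable, while each cover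
  adds at least 1 near every point of the set. Since radii are at most 1, a bump is at most
  \<open>1 / r\<close> on its support; hence \<open>w \<le> h\<close>, and \<open>w\<close> is
  integrable along with \<open>h\<close>.\<close>

theorem no_trace_function:
  assumes G: "G \<in> borel_measurable M" "(\<integral>\<^sup>+z\<in>\<Omega>. G z \<partial>M) < \<infinity>" and e: "0 < e"
  shows "\<exists>w\<in>M11 M \<Omega>. \<forall>x\<in>concentration_set M \<Omega> G e. \<forall>c. \<not> is_trace_at M \<Omega> w x c"
proof -
  let ?E = "concentration_set M \<Omega> G e"
  define Q where "Q k C r \<longleftrightarrow> countable C \<and> (\<forall>j\<in>C. 0 < r j \<and> r j \<le> 1) \<and> (\<forall>x\<in>?E. \<exists>j\<in>C. x \<in> ball j (5 * r j)) \<and>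
    (\<integral>\<^sup>+j. ennreal (1 / r j) * emeasure M (ball j (8 * r j) \<inter> \<Omega>) \<partial>count_space C) \<le> ennreal ((1/2) ^ k)"
    for k :: nat and C r
  have "\<forall>k. \<exists>C r. Q k C r"
    unfolding Q_def by (intro allI concentration_cover[OF G e]) simp
  then obtain C where "\<forall>k. \<exists>r. Q k (C k) r" by (rule choice[THEN exE])
  then obtain r where Q: "\<forall>k. Q k (C k) (r k)" by (rule choice[THEN exE])
  have cnt: "\<And>k. countable (C k)" and r: "\<And>k j. j \<in> C k \<Longrightarrow> 0 < r k j"
    "\<And>k j. j \<in> C k \<Longrightarrow> r k j \<le> 1" and cov: "\<And>k x. x \<in> ?E \<Longrightarrow> \<exists>j\<in>C k. x \<in> ball j (5 * r k j)"
    and small: "\<And>k. (\<integral>\<^sup>+j. ennreal (1 / r k j) * emeasure M (ball j (8 * r k j) \<inter> \<Omega>) \<partial>count_space (C k)) \<le> ennreal ((1/2) ^ k)"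
    using Q unfolding Q_def by blast+
  define W where "W k y = (\<integral>\<^sup>+j. ennreal (bump j (r k j) y) \<partial>count_space (C k))" for k y
  define H where "H k y = (\<integral>\<^sup>+j. ennreal (1 / r k j) * indicator (ball j (8 * r k j)) y \<partial>count_space (C k))" for k y
  define w where "w y = (\<Sum>k. W k y)" for y
  define h where "h y = (\<Sum>k. H k y)" for y
  have bump_m: "(\<lambda>y. ennreal (bump j t y)) \<in> borel_measurable M" for j t
    unfolding bump_def by measurable
  have Wm: "W k \<in> borel_measurable M" for k
    unfolding W_def[abs_def] using cnt bump_m by (rule borel_measurable_nn_integral_countable)
  have Hm: "H k \<in> borel_measurable M" for k
    unfolding H_def[abs_def] using cnt by (rule borel_measurable_nn_integral_countable) measurable
  have wm: "w \<in> borel_measurable M" unfolding w_def[abs_def] using Wm by measurable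
  have hm: "h \<in> borel_measurable M" unfolding h_def[abs_def] using Hm by measurable
  have WH: "W k y \<le> H k y" for k y
    unfolding W_def H_def
  proof (rule nn_integral_mono)
    fix j assume "j \<in> space (count_space (C k))"
    then have rj: "0 < r k j" "r k j \<le> 1" using r by auto
    show "ennreal (bump j (r k j) y) \<le> ennreal (1 / r k j) * indicator (ball j (8 * r k j)) y"
    proof (cases "y \<in> ball j (8 * r k j)")
      case True
      have "bump j (r k j) y \<le> 1" by (simp add: bump_def)
      also have "1 \<le> 1 / r k j" using rj by simp
      finally have "bump j (r k j) y \<le> 1 / r k j" .
      then show ?thesis using True by (simp add: ennreal_leI)
    qed (use bump_eq_0[OF rj(1), of y j] in simp)
  qed
  have wh: "w y \<le> h y" for y unfolding w_def h_def by (intro suminf_le WH) auto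
  have Hint: "(\<integral>\<^sup>+y\<in>\<Omega>. H k y \<partial>M) \<le> ennreal ((1/2) ^ k)" for k
  proof -
    have "(\<integral>\<^sup>+y\<in>\<Omega>. H k y \<partial>M) =
        (\<integral>\<^sup>+y. (\<integral>\<^sup>+j. ennreal (1 / r k j) * indicator (ball j (8 * r k j) \<inter> \<Omega>) y \<partial>count_space (C k)) \<partial>M)"
      unfolding H_def
      by (intro nn_integral_cong) (simp add: nn_integral_multc[symmetric] mult.assoc flip: indicator_inter_arith)
    also have "\<dots> = (\<integral>\<^sup>+j. (\<integral>\<^sup>+y. ennreal (1 / r k j) * indicator (ball j (8 * r k j) \<inter> \<Omega>) y \<partial>M) \<partial>count_space (C k))"
      using cnt by (intro nn_integral_count_space_nn_integral) measurable
    also have "\<dots> = (\<integral>\<^sup>+j. ennreal (1 / r k j) * emeasure M (ball j (8 * r k j) \<inter> \<Omega>) \<partial>count_space (C k))"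
      by (intro nn_integral_cong nn_integral_cmult_indicator) simp
    finally show ?thesis using small by simp
  qed
  have hint: "(\<integral>\<^sup>+y\<in>\<Omega>. h y \<partial>M) < \<infinity>"
  proof -
    have "(\<integral>\<^sup>+y\<in>\<Omega>. h y \<partial>M) = (\<integral>\<^sup>+y. (\<Sum>k. H k y * indicator \<Omega> y) \<partial>M)"
      unfolding h_def by (intro nn_integral_cong) simp
    also have "\<dots> = (\<Sum>k. \<integral>\<^sup>+y\<in>\<Omega>. H k y \<partial>M)" using Hm by (intro nn_integral_suminf borel_measurable_times_ennreal borel_measurable_indicator) auto
    also have "\<dots> \<le> (\<Sum>k. ennreal ((1/2) ^ k))" by (intro suminf_le Hint) auto
    also have "\<dots> < \<infinity>"
    proof -
      have "(\<lambda>k. (1/2::real) ^ k) sums (1 / (1 - 1/2))" by (rule geometric_sums) simp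
      then have "(\<Sum>k. ennreal ((1/2) ^ k)) = ennreal (1 / (1 - 1/2))"
        by (intro suminf_ennreal_eq) auto
      then show ?thesis by simp
    qed
    finally show ?thesis .
  qed
  have w_le: "w x \<le> w y + ennreal (dist x y) * (h x + h y)" for x y
  proof -
    have "W k x \<le> W k y + ennreal (dist x y) * (H k x + H k y)" for k
    proof -
      have "W k x \<le> (\<integral>\<^sup>+j. ennreal (bump j (r k j) y) + ennreal (dist x y) *
        (ennreal (1 / r k j) * indicator (ball j (8 * r k j)) x + ennreal (1 / r k j) * indicator (ball j (8 * r k j)) y) \<partial>count_space (C k))"
        unfolding W_def using r by (intro nn_integral_mono bump_hajlasz) auto
      also have "\<dots> = W k y + ennreal (dist x y) * (H k x + H k y)"
        unfolding W_def H_def by (simp add: nn_integral_add nn_integral_cmult)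
      finally show ?thesis .
    qed
    then have "w x \<le> (\<Sum>k. W k y + ennreal (dist x y) * (H k x + H k y))"
      unfolding w_def by (intro suminf_le) auto
    also have "\<dots> = w y + ennreal (dist x y) * (h x + h y)"
      unfolding w_def h_def by (simp add: suminf_add[symmetric])
    finally show ?thesis .
  qed
  let ?w = "\<lambda>y. enn2ereal (w y)"
  \<comment> \<open>On \<open>A\<close> the Hajlasz inequality fails already for
    \<open>x = y\<close>, where \<open>ext_absdiff\<close> is infinite and the distance is 0. The
    set is null because the integrable function \<open>h\<close> dominates \<open>w\<close>.\<close>
  define A where "A = {y \<in> \<Omega>. w y = \<infinity>}"
  have A: "A \<in> null_sets M"
  proof -
    let ?f = "\<lambda>y. h y * indicator \<Omega> y"
    have fm: "?f \<in> borel_measurable M"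
      using hm by (intro borel_measurable_times_ennreal borel_measurable_indicator) auto
    have "AE y in M. ?f y \<noteq> \<infinity>" by (rule nn_integral_PInf_AE[OF fm]) (use hint in simp)
    moreover have "h y = \<infinity>" if "w y = \<infinity>" for y
      using wh[of y] that by (simp add: top_unique)
    ultimately have "AE y in M. y \<notin> A"
      by (elim eventually_mono) (auto simp: A_def)
    moreover have As: "A \<in> sets M"
    proof -
      have "A = \<Omega> \<inter> (w -` {\<infinity>} \<inter> space M)" by (auto simp: A_def)
      then show ?thesis using measurable_sets[OF wm, of "{\<infinity>}"] by simp
    qed
    moreover have "{y \<in> space M. \<not> y \<notin> A} = A" by simp
    ultimately show ?thesis using AE_iff_null[of M "\<lambda>y. y \<notin> A"] by (simp only:)
  qed
  have hg: "hajlasz_gradient M \<Omega> ?w h"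
    unfolding hajlasz_gradient_def
  proof (intro conjI exI[of _ A] ballI A hint)
    show "h \<in> borel_measurable (restrict_space M \<Omega>)" by (intro measurable_restrict_space1 hm)
    show "A \<subseteq> \<Omega>" by (auto simp: A_def)
    fix x y assume "x \<in> \<Omega> - A" "y \<in> \<Omega> - A"
    then have "w x \<noteq> \<infinity>" "w y \<noteq> \<infinity>" by (auto simp: A_def)
    then obtain a b where ab: "w x = ennreal a" "0 \<le> a" "w y = ennreal b" "0 \<le> b"
      by (cases "w x"; cases "w y") auto
    have "ennreal \<bar>a - b\<bar> \<le> ennreal (dist x y) * (h x + h y)"
    proof (cases "a \<le> b")
      case True
      have "ennreal b \<le> ennreal a + ennreal (dist x y) * (h x + h y)"
        using w_le[of y x] unfolding ab dist_commute[of y x] add.commute[of "h y"] .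
      then have "ennreal b - ennreal a \<le> ennreal (dist x y) * (h x + h y)"
        by (simp add: ennreal_minus_le_iff)
      then show ?thesis using True ab by (simp add: ennreal_minus)
    next
      case False
      have "ennreal a \<le> ennreal b + ennreal (dist x y) * (h x + h y)"
        using w_le[of x y] unfolding ab .
      then have "ennreal a - ennreal b \<le> ennreal (dist x y) * (h x + h y)"
        by (simp add: ennreal_minus_le_iff)
      then show ?thesis using False ab by (simp add: ennreal_minus)
    qed
    then show "ext_absdiff (?w x) (?w y) \<le> ennreal (dist x y) * (h x + h y)"
      using ab by (simp add: ext_absdiff_ereal)
  qed
  have eq: "e2ennreal \<bar>?w y\<bar> = w y" for y
    by (metis abs_ereal_ge0 e2ennreal_enn2ereal enn2ereal_nonneg)
  have "L1_norm M \<Omega> ?w \<le> (\<integral>\<^sup>+y\<in>\<Omega>. h y \<partial>M)"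
    unfolding L1_norm_def eq by (intro nn_integral_mono mult_right_mono wh) simp
  then have "L1_norm M \<Omega> ?w < \<infinity>" using hint by (rule order_le_less_trans)
  moreover have "?w \<in> borel_measurable (restrict_space M \<Omega>)"
    using wm by (intro measurable_restrict_space1) measurable
  ultimately have M11: "?w \<in> M11 M \<Omega>" using hg by (auto simp: M11_def L1_def)
  have "\<not> is_trace_at M \<Omega> ?w x c" if x: "x \<in> ?E" for x c
  proof
    assume tr: "is_trace_at M \<Omega> ?w x c"
    \<comment> \<open>The first \<open>n\<close> covers make \<open>w\<close> at least
      \<open>n\<close> on a neighbourhood of \<open>x\<close>, an intersection of finitely many open
      balls. There \<open>w\<close> differs from \<open>c\<close> by at least 1, and so does its
      mean deviation from \<open>c\<close>.\<close>
    obtain n :: nat where n: "\<bar>c\<bar> + 1 \<le> real n" using real_arch_simple by blast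
    have "\<forall>k. \<exists>j\<in>C k. x \<in> ball j (5 * r k j)" using cov[OF x] by blast
    then obtain J where J: "\<And>k. J k \<in> C k" "\<And>k. x \<in> ball (J k) (5 * r k (J k))" by metis
    have "open (\<Inter>k<n. ball (J k) (5 * r k (J k)))" by (intro open_INT) auto
    moreover have "x \<in> (\<Inter>k<n. ball (J k) (5 * r k (J k)))" using J by auto
    ultimately obtain t where t: "0 < t" "ball x t \<subseteq> (\<Inter>k<n. ball (J k) (5 * r k (J k)))"
      using open_contains_ball by blast
    have big: "ennreal (real n) \<le> w y" if "y \<in> ball x t" for y
    proof -
      have "1 \<le> W k y" if "k < n" for k
      proof -
        have "y \<in> ball (J k) (5 * r k (J k))" using t(2) \<open>y \<in> ball x t\<close> \<open>k < n\<close> by blast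
        then have "bump (J k) (r k (J k)) y = 1" using r(1)[OF J(1)] by (intro bump_eq_1)
        then have le: "indicator {J k} j \<le> ennreal (bump j (r k j) y)" for j
          by (auto simp: indicator_def)
        have "1 = emeasure (count_space (C k)) {J k}" using J(1) by simp
        also have "\<dots> = (\<integral>\<^sup>+j. indicator {J k} j \<partial>count_space (C k))"
          using J(1) by (intro nn_integral_indicator[symmetric]) simp
        also have "\<dots> \<le> W k y" unfolding W_def by (intro nn_integral_mono le)
        finally show ?thesis .
      qed
      then have "(\<Sum>k<n. 1) \<le> (\<Sum>k<n. W k y)" by (intro sum_mono) auto
      also have "\<dots> \<le> w y" unfolding w_def by (intro sum_le_suminf) auto
      finally show ?thesis by (simp add: ennreal_of_nat_eq_real_of_nat)
    qed
    have ge1: "1 \<le> ext_absdiff (?w y) (ereal c)" if "y \<in> ball x t" for y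
    proof (cases "w y = \<infinity>")
      case True
      then show ?thesis by (simp add: ext_absdiff_def)
    next
      case False
      then obtain a where a: "w y = ennreal a" "0 \<le> a" by (cases "w y") auto
      then have "real n \<le> a" using big[OF that] by (simp add: ennreal_le_iff)
      then have "1 \<le> \<bar>a - c\<bar>" using n by linarith
      then have "ennreal 1 \<le> ennreal \<bar>a - c\<bar>" by (rule ennreal_leI)
      then show ?thesis using a by (simp add: ext_absdiff_ereal)
    qed
    have xcl: "x \<in> closure \<Omega>" using x frontier_notin(2) by (simp add: concentration_set_def)
    have "\<forall>\<^sub>F r in at_right 0. (\<integral>\<^sup>+y\<in>ball x r \<inter> \<Omega>. ext_absdiff (?w y) (ereal c) \<partial>M) / emeasure M (ball x r \<inter> \<Omega>) < 1"
      using tr unfolding is_trace_at_def by (rule order_tendstoD(2)) simp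
    moreover have "\<forall>\<^sub>F r in at_right (0::real). 0 < r \<and> r < t"
      using t(1) eventually_at_right_field by blast
    ultimately have "\<forall>\<^sub>F r in at_right (0::real). False"
    proof eventually_elim
      case (elim s)
      let ?m = "emeasure M (ball x s \<inter> \<Omega>)"
      have "?m = (\<integral>\<^sup>+y. indicator (ball x s \<inter> \<Omega>) y \<partial>M)" by (simp add: nn_integral_indicator)
      also have "\<dots> \<le> (\<integral>\<^sup>+y\<in>ball x s \<inter> \<Omega>. ext_absdiff (?w y) (ereal c) \<partial>M)"
        using elim(2) ge1 by (intro nn_integral_mono) (auto simp: indicator_def)
      finally have "?m / ?m \<le> (\<integral>\<^sup>+y\<in>ball x s \<inter> \<Omega>. ext_absdiff (?w y) (ereal c) \<partial>M) / ?m"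
        by (rule divide_right_mono_ennreal)
      moreover have "?m / ?m = 1"
        using dom_pos[OF xcl, of s] dom_finite[of x s] elim(2) by (intro ennreal_divide_self) auto
      ultimately show False using elim(1) by simp
    qed
    then show False by simp
  qed
  then show ?thesis using M11 by blast
qed

end

section \<open>Traces\<close>

lemma ext_absdiff_commute: "ext_absdiff p q = ext_absdiff q p"
  by (cases p; cases q) (auto simp: ext_absdiff_ereal ext_absdiff_def abs_minus_commute)

lemma ext_absdiff_triangle: "ext_absdiff p r \<le> ext_absdiff p q + ext_absdiff q r"
proof (cases "\<bar>p\<bar> = \<infinity> \<or> \<bar>q\<bar> = \<infinity> \<or> \<bar>r\<bar> = \<infinity>")
  case True
  then show ?thesis by (auto simp: ext_absdiff_def)
next
  case False
  then obtain a b c where "p = ereal a" "q = ereal b" "r = ereal c"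
    by (cases p; cases q; cases r) auto
  then show ?thesis by (simp add: ext_absdiff_ereal ennreal_leI flip: ennreal_plus)
qed

lemma ext_absdiff_measurable [measurable]:
  assumes [measurable]: "f \<in> borel_measurable M" "g \<in> borel_measurable M"
  shows "(\<lambda>x. ext_absdiff (f x) (g x)) \<in> borel_measurable M"
  unfolding ext_absdiff_def by measurable

lemma ennreal_mult_le_epsilon:
  assumes "\<And>e. 0 < e \<Longrightarrow> x \<le> ennreal K * (y + ennreal e)" "0 < K"
  shows "x \<le> ennreal K * y"
proof (rule ennreal_le_epsilon)
  fix e :: real assume "0 < e"
  then have "x \<le> ennreal K * (y + ennreal (e / K))" using assms by simp
  also have "\<dots> = ennreal K * y + ennreal e"
    using assms(2) \<open>0 < e\<close> by (simp add: distrib_left flip: ennreal_mult)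
  finally show "x \<le> ennreal K * y + ennreal e" .
qed

text \<open>A finite infimum is approached up to any \<open>e\<close>; an infinite one makes the
  right-hand side infinite because \<open>K\<close> is positive.\<close>

lemma ennreal_le_mult_INF:
  assumes "\<And>g. g \<in> S \<Longrightarrow> x \<le> ennreal K * (a + F g)" "0 < K"
  shows "x \<le> ennreal K * (a + (INF g\<in>S. F g))"
proof (cases "(INF g\<in>S. F g) < \<infinity>")
  case True
  show ?thesis
  proof (rule ennreal_mult_le_epsilon)
    fix e :: real assume e: "0 < e"
    have "y < y + ennreal e" if "y < \<infinity>" for y
      using that e by (cases y) (auto simp: ennreal_less_iff simp flip: ennreal_plus)
    from this[OF True] obtain g where g: "g \<in> S" "F g < (INF g\<in>S. F g) + ennreal e"
      unfolding INF_less_iff by blast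
    have "x \<le> ennreal K * (a + F g)" by (rule assms(1)[OF g(1)])
    also have "\<dots> \<le> ennreal K * (a + ((INF g\<in>S. F g) + ennreal e))"
      using g(2) by (intro mult_left_mono add_left_mono) auto
    finally show "x \<le> ennreal K * (a + (INF g\<in>S. F g) + ennreal e)" by (simp add: add.assoc)
  qed (rule assms(2))
next
  case False
  then have *: "a + (INF g\<in>S. F g) = \<infinity>" by (simp add: less_top[symmetric])
  show ?thesis unfolding * using assms(2) by (simp add: ennreal_mult_top)
qed

section \<open>Uniqueness, linearity and comparison of traces\<close>

context doubling_domain
begin

text \<open>One quantity for two purposes: with a constant \<open>v\<close> it defines traces, and
  with \<open>v\<close> the smoothing of \<open>u\<close> it measures how far their traces can
  differ. Being symmetric and subject to a triangle inequality, it acts as a pseudometric for each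
  \<open>r\<close>.\<close>

definition mean_dev :: "('a \<Rightarrow> ereal) \<Rightarrow> ('a \<Rightarrow> ereal) \<Rightarrow> 'a \<Rightarrow> real \<Rightarrow> ennreal" where
  "mean_dev u v x r = (\<integral>\<^sup>+y\<in>ball x r \<inter> \<Omega>. ext_absdiff (u y) (v y) \<partial>M) / emeasure M (ball x r \<inter> \<Omega>)"

lemma is_trace_at_iff:
  "is_trace_at M \<Omega> u x c \<longleftrightarrow> (mean_dev u (\<lambda>_. ereal c) x \<longlongrightarrow> 0) (at_right 0)"
  by (simp add: is_trace_at_def mean_dev_def[abs_def])

lemma restrict_mult_indicator:
  assumes "f \<in> borel_measurable (restrict_space M \<Omega>)"
  shows "(\<lambda>y. f y * indicator (ball x r \<inter> \<Omega>) y :: ennreal) \<in> borel_measurable M"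
proof -
  have "(\<lambda>y. f y * indicator \<Omega> y) \<in> borel_measurable M"
    using assms by (subst (asm) borel_measurable_restrict_space_iff_ennreal) auto
  then have "(\<lambda>y. f y * indicator \<Omega> y * indicator (ball x r) y) \<in> borel_measurable M"
    by (rule borel_measurable_times_ennreal) (rule borel_measurable_indicator[OF ball_sets])
  moreover have "(\<lambda>y. f y * indicator \<Omega> y * indicator (ball x r) y) = (\<lambda>y. f y * indicator (ball x r \<inter> \<Omega>) y)"
    by (auto simp: indicator_def fun_eq_iff)
  ultimately show ?thesis by simp
qed

lemma mean_dev_triangle:
  assumes "u \<in> borel_measurable (restrict_space M \<Omega>)" "v \<in> borel_measurable (restrict_space M \<Omega>)"
    "w \<in> borel_measurable (restrict_space M \<Omega>)"
  shows "mean_dev u w x r \<le> mean_dev u v x r + mean_dev v w x r"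
proof -
  have "(\<integral>\<^sup>+y\<in>ball x r \<inter> \<Omega>. ext_absdiff (u y) (w y) \<partial>M) \<le>
      (\<integral>\<^sup>+y. ext_absdiff (u y) (v y) * indicator (ball x r \<inter> \<Omega>) y +
        ext_absdiff (v y) (w y) * indicator (ball x r \<inter> \<Omega>) y \<partial>M)"
    using ext_absdiff_triangle by (intro nn_integral_mono) (auto simp: indicator_def)
  also have "\<dots> = (\<integral>\<^sup>+y\<in>ball x r \<inter> \<Omega>. ext_absdiff (u y) (v y) \<partial>M) + (\<integral>\<^sup>+y\<in>ball x r \<inter> \<Omega>. ext_absdiff (v y) (w y) \<partial>M)"
    using assms by (intro nn_integral_add restrict_mult_indicator ext_absdiff_measurable)
  finally show ?thesis
    unfolding mean_dev_def by (simp add: divide_right_mono_ennreal flip: add_divide_distrib_ennreal)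
qed

lemma mean_dev_commute: "mean_dev u v = mean_dev v u"
  by (intro ext) (simp add: mean_dev_def ext_absdiff_commute)

lemma mean_dev_const:
  assumes "x \<in> closure \<Omega>" "0 < r"
  shows "mean_dev (\<lambda>_. ereal c) (\<lambda>_. ereal c') x r = ennreal \<bar>c - c'\<bar>"
proof -
  have "emeasure M (ball x r \<inter> \<Omega>) / emeasure M (ball x r \<inter> \<Omega>) = 1"
    using dom_pos[OF assms] dom_finite[of x r] by (intro ennreal_divide_self) auto
  then show ?thesis
    unfolding mean_dev_def ext_absdiff_ereal
    by (subst nn_integral_cmult_indicator) (auto simp: ennreal_times_divide[symmetric])
qed

lemma trace_transfer:
  assumes m: "u \<in> borel_measurable (restrict_space M \<Omega>)" "v \<in> borel_measurable (restrict_space M \<Omega>)"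
    and lim: "(mean_dev u v x \<longlongrightarrow> 0) (at_right 0)" and tr: "is_trace_at M \<Omega> v x c"
  shows "is_trace_at M \<Omega> u x c"
  unfolding is_trace_at_iff
proof (rule tendsto_sandwich[where f="\<lambda>_. 0"])
  have "((\<lambda>r. mean_dev u v x r + mean_dev v (\<lambda>_. ereal c) x r) \<longlongrightarrow> 0 + 0) (at_right 0)"
    using lim tr unfolding is_trace_at_iff by (intro tendsto_add)
  then show "((\<lambda>r. mean_dev u v x r + mean_dev v (\<lambda>_. ereal c) x r) \<longlongrightarrow> 0) (at_right 0)" by simp
  show "\<forall>\<^sub>F r in at_right 0. mean_dev u (\<lambda>_. ereal c) x r \<le> mean_dev u v x r + mean_dev v (\<lambda>_. ereal c) x r"
    by (intro always_eventually allI mean_dev_triangle m) simp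
qed (auto intro: always_eventually)

text \<open>Balls around points of the closure meet \<Omega> in positive finite measure, so the mean
  deviation of two constants is their distance. This gives meaning to the \<open>THE\<close> in
  \<open>trace_fun\<close>.\<close>

lemma trace_unique:
  assumes m: "u \<in> borel_measurable (restrict_space M \<Omega>)" and x: "x \<in> closure \<Omega>"
    and tr: "is_trace_at M \<Omega> u x c" "is_trace_at M \<Omega> u x c'"
  shows "c = c'"
proof -
  have "((\<lambda>r. mean_dev (\<lambda>_. ereal c) u x r + mean_dev u (\<lambda>_. ereal c') x r) \<longlongrightarrow> 0 + 0) (at_right 0)"
    using tr unfolding is_trace_at_iff mean_dev_commute[of u "\<lambda>_. ereal c"] by (intro tendsto_add)
  moreover have "\<forall>\<^sub>F r in at_right 0. ennreal \<bar>c - c'\<bar> \<le> mean_dev (\<lambda>_. ereal c) u x r + mean_dev u (\<lambda>_. ereal c') x r"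
    using eventually_at_right_less[of 0]
  proof eventually_elim
    case (elim r)
    show ?case
      unfolding mean_dev_const[OF x elim, symmetric] by (intro mean_dev_triangle m) auto
  qed
  ultimately have "ennreal \<bar>c - c'\<bar> \<le> 0 + 0"
    by (intro tendsto_lowerbound) auto
  then show ?thesis by simp
qed

lemma trace_fun_eq:
  assumes "u \<in> borel_measurable (restrict_space M \<Omega>)" "x \<in> closure \<Omega>" "is_trace_at M \<Omega> u x c"
  shows "trace_fun M \<Omega> u x = c"
  unfolding trace_fun_def by (rule the_equality) (use assms trace_unique in auto)

lemma trace_cong:
  assumes "AE y in M. y \<in> \<Omega> \<longrightarrow> w y = u y"
  shows "is_trace_at M \<Omega> w = is_trace_at M \<Omega> u"
proof -
  have "(\<integral>\<^sup>+y\<in>ball x r \<inter> \<Omega>. ext_absdiff (w y) (ereal c) \<partial>M) = (\<integral>\<^sup>+y\<in>ball x r \<inter> \<Omega>. ext_absdiff (u y) (ereal c) \<partial>M)" for x r c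
    using assms by (intro nn_integral_cong_AE) (auto elim!: eventually_mono simp: indicator_def)
  then show ?thesis by (intro ext) (simp add: is_trace_at_def)
qed

lemma trace_fun_cong:
  assumes "AE y in M. y \<in> \<Omega> \<longrightarrow> w y = u y"
  shows "trace_fun M \<Omega> w = trace_fun M \<Omega> u" "has_trace M \<Omega> \<H> w = has_trace M \<Omega> \<H> u"
  unfolding trace_fun_def[abs_def] has_trace_def trace_cong[OF assms] by simp_all

lemma trace_linear:
  assumes m: "u \<in> L1 M \<Omega>" "v \<in> L1 M \<Omega>"
    and w: "AE y in M. y \<in> \<Omega> \<longrightarrow> w y = ereal \<alpha> * u y + ereal \<beta> * v y"
    and tr: "is_trace_at M \<Omega> u x a" "is_trace_at M \<Omega> v x b"
  shows "is_trace_at M \<Omega> w x (\<alpha> * a + \<beta> * b)"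
  unfolding is_trace_at_iff
proof (rule tendsto_sandwich[where f="\<lambda>_. 0"])
  have "((\<lambda>r. ennreal \<bar>\<alpha>\<bar> * mean_dev u (\<lambda>_. ereal a) x r + ennreal \<bar>\<beta>\<bar> * mean_dev v (\<lambda>_. ereal b) x r)
      \<longlongrightarrow> ennreal \<bar>\<alpha>\<bar> * 0 + ennreal \<bar>\<beta>\<bar> * 0) (at_right 0)"
    using tr unfolding is_trace_at_iff by (intro tendsto_add ennreal_tendsto_cmult) auto
  then show "((\<lambda>r. ennreal \<bar>\<alpha>\<bar> * mean_dev u (\<lambda>_. ereal a) x r + ennreal \<bar>\<beta>\<bar> * mean_dev v (\<lambda>_. ereal b) x r)
      \<longlongrightarrow> 0) (at_right 0)" by simp
  have um: "u \<in> borel_measurable (restrict_space M \<Omega>)" "v \<in> borel_measurable (restrict_space M \<Omega>)"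
    using m by (auto simp: L1_def)
  have ae: "AE y in M. y \<in> \<Omega> \<longrightarrow> ext_absdiff (w y) (ereal (\<alpha> * a + \<beta> * b)) \<le>
      ennreal \<bar>\<alpha>\<bar> * ext_absdiff (u y) (ereal a) + ennreal \<bar>\<beta>\<bar> * ext_absdiff (v y) (ereal b)"
    using w L1_real_on(3)[OF m(1) dom_sets] L1_real_on(3)[OF m(2) dom_sets]
  proof eventually_elim
    case (elim y)
    show ?case
    proof
      assume y: "y \<in> \<Omega>"
      then obtain p q where pq: "u y = ereal p" "v y = ereal q"
        using elim by (cases "u y"; cases "v y") auto
      have "\<bar>\<alpha> * p + \<beta> * q - (\<alpha> * a + \<beta> * b)\<bar> = \<bar>\<alpha> * (p - a) + \<beta> * (q - b)\<bar>" by (simp add: algebra_simps)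
      also have "\<dots> \<le> \<bar>\<alpha>\<bar> * \<bar>p - a\<bar> + \<bar>\<beta>\<bar> * \<bar>q - b\<bar>" by (metis abs_mult abs_triangle_ineq)
      finally have "ennreal \<bar>\<alpha> * p + \<beta> * q - (\<alpha> * a + \<beta> * b)\<bar> \<le>
          ennreal (\<bar>\<alpha>\<bar> * \<bar>p - a\<bar> + \<bar>\<beta>\<bar> * \<bar>q - b\<bar>)" by (rule ennreal_leI)
      then show "ext_absdiff (w y) (ereal (\<alpha> * a + \<beta> * b)) \<le>
          ennreal \<bar>\<alpha>\<bar> * ext_absdiff (u y) (ereal a) + ennreal \<bar>\<beta>\<bar> * ext_absdiff (v y) (ereal b)"
        using elim(1) y pq by (simp add: ext_absdiff_ereal ennreal_mult)
    qed
  qed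
  have "mean_dev w (\<lambda>_. ereal (\<alpha> * a + \<beta> * b)) x r \<le>
      ennreal \<bar>\<alpha>\<bar> * mean_dev u (\<lambda>_. ereal a) x r + ennreal \<bar>\<beta>\<bar> * mean_dev v (\<lambda>_. ereal b) x r" for r
  proof -
    let ?i = "indicator (ball x r \<inter> \<Omega>) :: 'a \<Rightarrow> ennreal"
    note im = restrict_mult_indicator[OF ext_absdiff_measurable[OF um(1) borel_measurable_const[of "ereal a"]], of x r]
      restrict_mult_indicator[OF ext_absdiff_measurable[OF um(2) borel_measurable_const[of "ereal b"]], of x r]
    have "(\<integral>\<^sup>+y\<in>ball x r \<inter> \<Omega>. ext_absdiff (w y) (ereal (\<alpha> * a + \<beta> * b)) \<partial>M) \<le>
      (\<integral>\<^sup>+y. ennreal \<bar>\<alpha>\<bar> * (ext_absdiff (u y) (ereal a) * ?i y) + ennreal \<bar>\<beta>\<bar> * (ext_absdiff (v y) (ereal b) * ?i y) \<partial>M)"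
      using ae by (intro nn_integral_mono_AE) (auto elim!: eventually_mono simp: indicator_def)
    also have "\<dots> = ennreal \<bar>\<alpha>\<bar> * (\<integral>\<^sup>+y\<in>ball x r \<inter> \<Omega>. ext_absdiff (u y) (ereal a) \<partial>M) +
        ennreal \<bar>\<beta>\<bar> * (\<integral>\<^sup>+y\<in>ball x r \<inter> \<Omega>. ext_absdiff (v y) (ereal b) \<partial>M)"
      using im by (subst nn_integral_add) (auto intro!: borel_measurable_times_ennreal simp: nn_integral_cmult)
    finally show ?thesis
      unfolding mean_dev_def
      by (simp add: divide_right_mono_ennreal ennreal_times_divide flip: add_divide_distrib_ennreal)
  qed
  then show "\<forall>\<^sub>F r in at_right 0. mean_dev w (\<lambda>_. ereal (\<alpha> * a + \<beta> * b)) x r \<le>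
      ennreal \<bar>\<alpha>\<bar> * mean_dev u (\<lambda>_. ereal a) x r + ennreal \<bar>\<beta>\<bar> * mean_dev v (\<lambda>_. ereal b) x r"
    by (intro always_eventually allI)
qed (auto intro: always_eventually)

text \<open>Outside the concentration sets at all levels \<open>1 / (m + 1)\<close>,
  \<open>r\<close> times the mean of \<open>G\<close> at radius \<open>r\<close> tends to 0. The
  bound for \<open>u - v\<close> at radius \<open>r\<close> involves \<open>G\<close> on the ball of
  radius \<open>2 * r\<close>, so the condition is used at \<open>2 * r\<close> and
  \<open>dom_double\<close> returns to \<open>r\<close>.\<close>

lemma mean_dev_tendsto_0:
  assumes x: "x \<in> frontier \<Omega>" and conc: "\<And>m::nat. x \<notin> concentration_set M \<Omega> G (1 / real (Suc m))"
    and C: "0 < C" and le: "\<And>r. 0 < r \<Longrightarrow> (\<integral>\<^sup>+y\<in>ball x r \<inter> \<Omega>. ext_absdiff (u y) (v y) \<partial>M) \<le>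
           ennreal (C * r) * (\<integral>\<^sup>+z\<in>ball x (2 * r) \<inter> \<Omega>. G z \<partial>M)"
  shows "(mean_dev u v x \<longlongrightarrow> 0) (at_right 0)"
proof (rule order_tendstoI)
  fix a :: ennreal assume a: "0 < a"
  have xcl: "x \<in> closure \<Omega>" by (rule frontier_notin(2)[OF x])
  have "(\<lambda>m. C * B / real m) \<longlonglongrightarrow> 0" by (rule lim_const_over_n)
  then have "(\<lambda>m. ennreal (C * B / real (Suc m))) \<longlonglongrightarrow> ennreal 0"
    by (intro tendsto_ennrealI LIMSEQ_Suc)
  then have "\<forall>\<^sub>F m in sequentially. ennreal (C * B / real (Suc m)) < a"
    using a by (intro order_tendstoD(2)) auto
  then obtain m where m: "ennreal (C * B / real (Suc m)) < a" by (meson eventually_sequentially order_refl)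
  obtain s where s: "0 < s" "\<And>r. 0 < r \<Longrightarrow> r < s \<Longrightarrow>
      ennreal r * (\<integral>\<^sup>+z\<in>ball x r \<inter> \<Omega>. G z \<partial>M) \<le> ennreal (1 / real (Suc m)) * emeasure M (ball x r \<inter> \<Omega>)"
    using conc[of m] x unfolding concentration_set_def by (auto simp: not_le intro: less_imp_le)
  have "\<forall>\<^sub>F r in at_right (0::real). 0 < r \<and> r < s / 2"
    using s(1) eventually_at_right_field[of _ "0::real"] by (auto intro!: exI[of _ "s / 2"])
  then show "\<forall>\<^sub>F r in at_right 0. mean_dev u v x r < a"
  proof eventually_elim
    case (elim r)
    let ?m = "\<lambda>r. emeasure M (ball x r \<inter> \<Omega>)"
    have "(\<integral>\<^sup>+y\<in>ball x r \<inter> \<Omega>. ext_absdiff (u y) (v y) \<partial>M) \<le> ennreal (C * r) * (\<integral>\<^sup>+z\<in>ball x (2 * r) \<inter> \<Omega>. G z \<partial>M)"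
      using elim by (intro le) simp
    also have "\<dots> = ennreal (C / 2) * (ennreal (2 * r) * (\<integral>\<^sup>+z\<in>ball x (2 * r) \<inter> \<Omega>. G z \<partial>M))"
      using C elim by (simp add: mult.assoc[symmetric] flip: ennreal_mult)
    also have "\<dots> \<le> ennreal (C / 2) * (ennreal (1 / real (Suc m)) * ?m (2 * r))"
      using elim by (intro mult_left_mono s(2)) auto
    also have "\<dots> \<le> ennreal (C / 2) * (ennreal (1 / real (Suc m)) * (ennreal B * ?m r))"
      using elim by (intro mult_left_mono dom_double xcl) auto
    also have "\<dots> = ennreal (C / 2 * (1 / real (Suc m)) * B) * ?m r"
    proof -
      have "0 \<le> C / 2" "0 \<le> 1 / real (Suc m)" "0 \<le> B" using C B_ge_1 by simp_all
      then have "ennreal (C / 2 * (1 / real (Suc m)) * B) = ennreal (C / 2) * ennreal (1 / real (Suc m)) * ennreal B"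
        by (simp only: ennreal_mult mult_nonneg_nonneg)
      then show ?thesis by (simp only: mult.assoc)
    qed
    also have "\<dots> \<le> ennreal (C * B / real (Suc m)) * ?m r"
      using C B_ge_1 by (intro mult_right_mono ennreal_leI) (auto simp: field_simps)
    finally have "mean_dev u v x r \<le> ennreal (C * B / real (Suc m)) * ?m r / ?m r"
      unfolding mean_dev_def by (rule divide_right_mono_ennreal)
    also have "\<dots> = ennreal (C * B / real (Suc m))"
      using dom_pos[OF xcl, of r] dom_finite[of x r] elim
      by (simp add: ennreal_times_divide[symmetric] ennreal_divide_self)
    finally show ?case using m by (rule order_le_less_trans)
  qed
qed simp

lemma N11_subset_L1: "u \<in> N11 M \<Omega> \<Longrightarrow> u \<in> L1 M \<Omega>"
  by (auto simp: N11_def N11_norm_def L1_def)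

lemma M11_subset_L1: "u \<in> M11 M \<Omega> \<Longrightarrow> u \<in> L1 M \<Omega>"
  by (simp add: M11_def)

text \<open>The exceptional sets where the smoothing might change the trace are \<open>\<H>\<close>-null, since each of
  them carries a function of \<open>M\<^sup>1\<^sup>,\<^sup>1\<close> without any trace.\<close>

lemma smoothing_trace:
  assumes space: "space \<H> = frontier \<Omega>" and tr: "\<And>w. w \<in> M11 M \<Omega> \<Longrightarrow> has_trace M \<Omega> \<H> w"
    and u: "u \<in> L1 M \<Omega>" and v: "v \<in> M11 M \<Omega>"
    and G: "G \<in> borel_measurable M" "(\<integral>\<^sup>+z\<in>\<Omega>. G z \<partial>M) < \<infinity>" and C: "0 < C"
    and le: "\<And>x r. x \<notin> \<Omega> \<Longrightarrow> 0 < r \<Longrightarrow> (\<integral>\<^sup>+y\<in>ball x r \<inter> \<Omega>. ext_absdiff (u y) (v y) \<partial>M) \<le>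
           ennreal (C * r) * (\<integral>\<^sup>+z\<in>ball x (2 * r) \<inter> \<Omega>. G z \<partial>M)"
  shows "has_trace M \<Omega> \<H> u" "AE x in \<H>. trace_fun M \<Omega> v x = trace_fun M \<Omega> u x"
proof -
  have "AE x in \<H>. x \<notin> concentration_set M \<Omega> G (1 / real (Suc m))" for m
  proof -
    obtain w where w: "w \<in> M11 M \<Omega>"
      "\<And>x c. x \<in> concentration_set M \<Omega> G (1 / real (Suc m)) \<Longrightarrow> \<not> is_trace_at M \<Omega> w x c"
      using no_trace_function[OF G, of "1 / real (Suc m)"] by auto
    from tr[OF w(1)] show ?thesis
      unfolding has_trace_def by eventually_elim (use w(2) in blast)
  qed
  then have "AE x in \<H>. \<forall>m. x \<notin> concentration_set M \<Omega> G (1 / real (Suc m))"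
    by (simp add: AE_all_countable)
  then have *: "AE x in \<H>. \<exists>c. is_trace_at M \<Omega> u x c \<and> trace_fun M \<Omega> u x = c \<and> trace_fun M \<Omega> v x = c"
    using tr[OF v, unfolded has_trace_def] AE_space
  proof eventually_elim
    case (elim x)
    then have x: "x \<in> frontier \<Omega>" using space by simp
    have m: "u \<in> borel_measurable (restrict_space M \<Omega>)" "v \<in> borel_measurable (restrict_space M \<Omega>)"
      using u M11_subset_L1[OF v] by (auto simp: L1_def)
    obtain c where c: "is_trace_at M \<Omega> v x c" using elim by blast
    have "(mean_dev u v x \<longlongrightarrow> 0) (at_right 0)"
      using elim(1) frontier_notin(1)[OF x] by (intro mean_dev_tendsto_0[OF x _ C le]) auto
    then have "is_trace_at M \<Omega> u x c" by (rule trace_transfer[OF m _ c])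
    then show ?case
      using trace_fun_eq[OF m(1) frontier_notin(2)[OF x]] trace_fun_eq[OF m(2) frontier_notin(2)[OF x] c] by blast
  qed
  from * show "has_trace M \<Omega> \<H> u" unfolding has_trace_def by eventually_elim blast
  from * show "AE x in \<H>. trace_fun M \<Omega> v x = trace_fun M \<Omega> u x" by eventually_elim auto
qed

lemma trace_fun_linear:
  assumes space: "space \<H> = frontier \<Omega>" and m: "u \<in> L1 M \<Omega>" "v \<in> L1 M \<Omega>" "w \<in> L1 M \<Omega>"
    and w: "AE y in M. y \<in> \<Omega> \<longrightarrow> w y = ereal \<alpha> * u y + ereal \<beta> * v y"
    and tr: "has_trace M \<Omega> \<H> u" "has_trace M \<Omega> \<H> v"
  shows "AE x in \<H>. trace_fun M \<Omega> w x = \<alpha> * trace_fun M \<Omega> u x + \<beta> * trace_fun M \<Omega> v x"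
  using tr[unfolded has_trace_def] AE_space
proof eventually_elim
  case (elim x)
  then have x: "x \<in> closure \<Omega>" using space frontier_notin(2) by simp
  obtain a b where ab: "is_trace_at M \<Omega> u x a" "is_trace_at M \<Omega> v x b" using elim by blast
  have mm: "u \<in> borel_measurable (restrict_space M \<Omega>)" "v \<in> borel_measurable (restrict_space M \<Omega>)"
    "w \<in> borel_measurable (restrict_space M \<Omega>)" using m by (auto simp: L1_def)
  show ?case
    using trace_fun_eq[OF mm(1) x ab(1)] trace_fun_eq[OF mm(2) x ab(2)]
      trace_fun_eq[OF mm(3) x trace_linear[OF m(1,2) w ab]] by simp
qed

text \<open>Representatives have literally the same trace function, as traces ignore null sets of
  \<Omega>; smoothing preserves it only \<H>-almost everywhere, so \<open>Z\<close> is then entered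
  through its closure under such equality. Each implication uses one of the two for the bound and
  the other for surjectivity. Smoothing requires traces on all of \<open>M11\<close>; in the first
  implication these come from representatives.\<close>

theorem trace_spaces_coincide:
  assumes P: "poincare_1_1 M" and unif: "uniform_domain \<Omega>" and space: "space \<H> = frontier \<Omega>"
    and Z: "banach_function_space \<H> Z nZ"
  shows "is_trace_space M \<Omega> \<H> (N11 M \<Omega>) (N11_norm M \<Omega>) Z nZ \<longleftrightarrow>
    is_trace_space M \<Omega> \<H> (M11 M \<Omega>) (M11_norm M \<Omega>) Z nZ"
proof -
  obtain C where C: "0 < C"
    and smooth: "\<And>u e. u \<in> N11 M \<Omega> \<Longrightarrow> 0 < e \<Longrightarrow> \<exists>v G. (\<lambda>x. ereal (v x)) \<in> M11 M \<Omega> \<and>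
        M11_norm M \<Omega> (\<lambda>x. ereal (v x)) \<le> ennreal C * (N11_norm M \<Omega> u + ennreal e) \<and>
        G \<in> borel_measurable M \<and> (\<integral>\<^sup>+z\<in>\<Omega>. G z \<partial>M) < \<infinity> \<and>
        (\<forall>x r. x \<notin> \<Omega> \<longrightarrow> 0 < r \<longrightarrow> (\<integral>\<^sup>+y\<in>ball x r \<inter> \<Omega>. ext_absdiff (u y) (ereal (v y)) \<partial>M) \<le>
           ennreal (C * r) * (\<integral>\<^sup>+z\<in>ball x (2 * r) \<inter> \<Omega>. G z \<partial>M))"
    using N11_smoothing[OF P unif compl_ne] by blast
  have Zclosed: "g \<in> Z \<and> nZ g = nZ f" if "f \<in> Z" "AE x in \<H>. f x = g x" for f g
    using Z that unfolding banach_function_space_def by blast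
  have rep: "\<exists>w. w \<in> N11 M \<Omega> \<and> trace_fun M \<Omega> w = trace_fun M \<Omega> u \<and>
      has_trace M \<Omega> \<H> w = has_trace M \<Omega> \<H> u \<and> N11_norm M \<Omega> w \<le> 4 * (L1_norm M \<Omega> u + (\<integral>\<^sup>+x\<in>\<Omega>. g x \<partial>M))"
    if "u \<in> M11 M \<Omega>" "hajlasz_gradient M \<Omega> u g" for u g
    using M11_representative[OF dom_sets that] trace_fun_cong by blast
  have rep': "\<exists>w. w \<in> N11 M \<Omega> \<and> trace_fun M \<Omega> w = trace_fun M \<Omega> u \<and> has_trace M \<Omega> \<H> w = has_trace M \<Omega> \<H> u"
    if u: "u \<in> M11 M \<Omega>" for u
  proof -
    obtain g where "hajlasz_gradient M \<Omega> u g" using u by (auto simp: M11_def)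
    from rep[OF u this] show ?thesis by blast
  qed
  have sm: "\<exists>v. v \<in> M11 M \<Omega> \<and> M11_norm M \<Omega> v \<le> ennreal C * (N11_norm M \<Omega> u + ennreal e) \<and>
      has_trace M \<Omega> \<H> u \<and> (AE x in \<H>. trace_fun M \<Omega> v x = trace_fun M \<Omega> u x)"
    if tr: "\<And>w. w \<in> M11 M \<Omega> \<Longrightarrow> has_trace M \<Omega> \<H> w" and u: "u \<in> N11 M \<Omega>" and e: "0 < e" for u and e :: real
  proof -
    obtain v G where v: "(\<lambda>x. ereal (v x)) \<in> M11 M \<Omega>"
        "M11_norm M \<Omega> (\<lambda>x. ereal (v x)) \<le> ennreal C * (N11_norm M \<Omega> u + ennreal e)"
      and G: "G \<in> borel_measurable M" "(\<integral>\<^sup>+z\<in>\<Omega>. G z \<partial>M) < \<infinity>"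
      and le: "\<And>x r. x \<notin> \<Omega> \<Longrightarrow> 0 < r \<Longrightarrow> (\<integral>\<^sup>+y\<in>ball x r \<inter> \<Omega>. ext_absdiff (u y) (ereal (v y)) \<partial>M) \<le>
           ennreal (C * r) * (\<integral>\<^sup>+z\<in>ball x (2 * r) \<inter> \<Omega>. G z \<partial>M)"
      using smooth[OF u e] by blast
    show ?thesis
      using smoothing_trace[OF space tr N11_subset_L1[OF u] v(1) G C le] v by blast
  qed
  show ?thesis
  proof
    assume N: "is_trace_space M \<Omega> \<H> (N11 M \<Omega>) (N11_norm M \<Omega>) Z nZ"
    have trN: "has_trace M \<Omega> \<H> u" "trace_fun M \<Omega> u \<in> Z" if "u \<in> N11 M \<Omega>" for u
      using N that by (auto simp: is_trace_space_def)
    have trM: "has_trace M \<Omega> \<H> u" "trace_fun M \<Omega> u \<in> Z" if "u \<in> M11 M \<Omega>" for u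
      using rep'[OF that] trN by metis+
    obtain C' where C': "\<And>u. u \<in> N11 M \<Omega> \<Longrightarrow> ennreal (nZ (trace_fun M \<Omega> u)) \<le> ennreal C' * N11_norm M \<Omega> u"
      using N unfolding is_trace_space_def by blast
    \<comment> \<open>\<open>max C' 1\<close> because the given constant may fail to be positive,
      while passing to the infimum over gradients uses \<open>0 < K\<close>; the factor 4 is that of
      \<open>M11_representative\<close>.\<close>
    define K where "K = 4 * max C' 1"
    have K: "0 < K" by (simp add: K_def)
    have bound: "ennreal (nZ (trace_fun M \<Omega> u)) \<le> ennreal K * M11_norm M \<Omega> u" if u: "u \<in> M11 M \<Omega>" for u
      unfolding M11_norm_def
    proof (rule ennreal_le_mult_INF[OF _ K])
      fix g assume "g \<in> {g. hajlasz_gradient M \<Omega> u g}"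
      then obtain w where w: "w \<in> N11 M \<Omega>" "trace_fun M \<Omega> w = trace_fun M \<Omega> u"
        "N11_norm M \<Omega> w \<le> 4 * (L1_norm M \<Omega> u + (\<integral>\<^sup>+x\<in>\<Omega>. g x \<partial>M))" using rep[OF u] by blast
      have "ennreal (nZ (trace_fun M \<Omega> u)) \<le> ennreal C' * N11_norm M \<Omega> w" using C'[OF w(1)] w(2) by simp
      also have "\<dots> \<le> ennreal (max C' 1) * (4 * (L1_norm M \<Omega> u + (\<integral>\<^sup>+x\<in>\<Omega>. g x \<partial>M)))"
        by (intro mult_mono w(3) ennreal_leI) auto
      also have "\<dots> = ennreal K * (L1_norm M \<Omega> u + (\<integral>\<^sup>+x\<in>\<Omega>. g x \<partial>M))"
        by (simp add: K_def ennreal_mult mult_ac)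
      finally show "ennreal (nZ (trace_fun M \<Omega> u)) \<le> ennreal K * (L1_norm M \<Omega> u + (\<integral>\<^sup>+x\<in>\<Omega>. g x \<partial>M))" .
    qed
    show "is_trace_space M \<Omega> \<H> (M11 M \<Omega>) (M11_norm M \<Omega>) Z nZ"
      unfolding is_trace_space_def
    proof (intro conjI ballI allI impI)
      fix u v w \<alpha> \<beta> assume "u \<in> M11 M \<Omega>" "v \<in> M11 M \<Omega>" "w \<in> M11 M \<Omega>"
        "AE x in M. x \<in> \<Omega> \<longrightarrow> w x = ereal \<alpha> * u x + ereal \<beta> * v x"
      then show "AE x in \<H>. trace_fun M \<Omega> w x = \<alpha> * trace_fun M \<Omega> u x + \<beta> * trace_fun M \<Omega> v x"
        by (intro trace_fun_linear[OF space]) (auto intro: M11_subset_L1 trM)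
    next
      show "\<exists>C. \<forall>u\<in>M11 M \<Omega>. ennreal (nZ (trace_fun M \<Omega> u)) \<le> ennreal C * M11_norm M \<Omega> u"
        using bound by blast
    next
      fix f assume "f \<in> Z"
      then obtain u where u: "u \<in> N11 M \<Omega>" "AE x in \<H>. trace_fun M \<Omega> u x = f x"
        using N unfolding is_trace_space_def by blast
      obtain v where v: "v \<in> M11 M \<Omega>" "AE x in \<H>. trace_fun M \<Omega> v x = trace_fun M \<Omega> u x"
        using sm[OF trM(1) u(1), of 1] by auto
      have "AE x in \<H>. trace_fun M \<Omega> v x = f x" using v(2) u(2) by eventually_elim simp
      then show "\<exists>u\<in>M11 M \<Omega>. AE x in \<H>. trace_fun M \<Omega> u x = f x" using v(1) by blast
    qed (rule trM, assumption)+
  next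
    assume N: "is_trace_space M \<Omega> \<H> (M11 M \<Omega>) (M11_norm M \<Omega>) Z nZ"
    have trM: "has_trace M \<Omega> \<H> u" "trace_fun M \<Omega> u \<in> Z" if "u \<in> M11 M \<Omega>" for u
      using N that by (auto simp: is_trace_space_def)
    have trN: "has_trace M \<Omega> \<H> u" "trace_fun M \<Omega> u \<in> Z" if u: "u \<in> N11 M \<Omega>" for u
    proof -
      obtain v where v: "v \<in> M11 M \<Omega>" "has_trace M \<Omega> \<H> u" "AE x in \<H>. trace_fun M \<Omega> v x = trace_fun M \<Omega> u x"
        using sm[OF trM(1) u, of 1] by auto
      show "has_trace M \<Omega> \<H> u" by (rule v(2))
      show "trace_fun M \<Omega> u \<in> Z" using Zclosed[OF trM(2)[OF v(1)] v(3)] by simp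
    qed
    obtain C' where C': "\<And>u. u \<in> M11 M \<Omega> \<Longrightarrow> ennreal (nZ (trace_fun M \<Omega> u)) \<le> ennreal C' * M11_norm M \<Omega> u"
      using N unfolding is_trace_space_def by blast
    define K where "K = max C' 1 * C"
    have K: "0 < K" using C by (simp add: K_def)
    have bound: "ennreal (nZ (trace_fun M \<Omega> u)) \<le> ennreal K * N11_norm M \<Omega> u" if u: "u \<in> N11 M \<Omega>" for u
    \<comment> \<open>\<open>K\<close> does not depend on \<open>e\<close>, so the loss in the
      smoothing disappears in the limit.\<close>
    proof (rule ennreal_mult_le_epsilon[OF _ K])
      fix e :: real assume e: "0 < e"
      obtain v where v: "v \<in> M11 M \<Omega>" "M11_norm M \<Omega> v \<le> ennreal C * (N11_norm M \<Omega> u + ennreal e)"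
        "AE x in \<H>. trace_fun M \<Omega> v x = trace_fun M \<Omega> u x"
        using sm[OF trM(1) u e] by auto
      have "nZ (trace_fun M \<Omega> u) = nZ (trace_fun M \<Omega> v)" using Zclosed[OF trM(2)[OF v(1)] v(3)] by simp
      then have "ennreal (nZ (trace_fun M \<Omega> u)) \<le> ennreal C' * M11_norm M \<Omega> v" using C'[OF v(1)] by simp
      also have "\<dots> \<le> ennreal (max C' 1) * (ennreal C * (N11_norm M \<Omega> u + ennreal e))"
        by (intro mult_mono v(2) ennreal_leI) auto
      also have "\<dots> = ennreal K * (N11_norm M \<Omega> u + ennreal e)"
        using C by (simp add: K_def ennreal_mult mult.assoc)
      finally show "ennreal (nZ (trace_fun M \<Omega> u)) \<le> ennreal K * (N11_norm M \<Omega> u + ennreal e)" .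
    qed
    show "is_trace_space M \<Omega> \<H> (N11 M \<Omega>) (N11_norm M \<Omega>) Z nZ"
      unfolding is_trace_space_def
    proof (intro conjI ballI allI impI)
      fix u v w \<alpha> \<beta> assume "u \<in> N11 M \<Omega>" "v \<in> N11 M \<Omega>" "w \<in> N11 M \<Omega>"
        "AE x in M. x \<in> \<Omega> \<longrightarrow> w x = ereal \<alpha> * u x + ereal \<beta> * v x"
      then show "AE x in \<H>. trace_fun M \<Omega> w x = \<alpha> * trace_fun M \<Omega> u x + \<beta> * trace_fun M \<Omega> v x"
        by (intro trace_fun_linear[OF space]) (auto intro: N11_subset_L1 trN)
    next
      show "\<exists>C. \<forall>u\<in>N11 M \<Omega>. ennreal (nZ (trace_fun M \<Omega> u)) \<le> ennreal C * N11_norm M \<Omega> u"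
        using bound by blast
    next
      fix f assume "f \<in> Z"
      then obtain u where u: "u \<in> M11 M \<Omega>" "AE x in \<H>. trace_fun M \<Omega> u x = f x"
        using N unfolding is_trace_space_def by blast
      then show "\<exists>u\<in>N11 M \<Omega>. AE x in \<H>. trace_fun M \<Omega> u x = f x"
        using rep'[OF u(1)] by metis
    qed (rule trN, assumption)+
  qed
qed

end

theorem corollary1p8:
  fixes \<mu> :: "'a::complete_space set \<Rightarrow> ennreal"
    and \<Omega> :: "'a set"
    and \<H> :: "'a measure"
    and Z :: "('a \<Rightarrow> real) set"
    and normZ :: "('a \<Rightarrow> real) \<Rightarrow> real"
  assumes "borel_regular_outer_measure \<mu>"
    and "doubling \<mu>"
    and "poincare_1_1 (caratheodory_measure \<mu>)"
    and "uniform_domain \<Omega>"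
    and "- \<Omega> \<noteq> {}"
    and "doubling_on \<mu> \<Omega>"
    and "space \<H> = frontier \<Omega>"
    and "banach_function_space \<H> Z normZ"
  shows "is_trace_space (caratheodory_measure \<mu>) \<Omega> \<H>
           (N11 (caratheodory_measure \<mu>) \<Omega>) (N11_norm (caratheodory_measure \<mu>) \<Omega>) Z normZ
         \<longleftrightarrow> is_trace_space (caratheodory_measure \<mu>) \<Omega> \<H>
           (M11 (caratheodory_measure \<mu>) \<Omega>) (M11_norm (caratheodory_measure \<mu>) \<Omega>) Z normZ"
proof -
  let ?M = "caratheodory_measure \<mu>"
  obtain D where "doubling_space ?M D" using doubling_space_caratheodory[OF assms(1,2)] by blast
  then interpret doubling_space ?M D .
  have opn: "open \<Omega>" using assms(4) by (simp add: uniform_domain_def)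
  have em: "emeasure ?M (ball x r \<inter> \<Omega>) = \<mu> (ball x r \<inter> \<Omega>)" for x r
  proof -
    have "ball x r \<inter> \<Omega> \<in> sets ?M" using opn by (intro open_sets open_Int) auto
    then show ?thesis
      using caratheodory_measure_props(2,3)[OF assms(1)] by simp
  qed
  obtain c where c: "c > 0" "\<And>x r. x \<in> closure \<Omega> \<Longrightarrow> r > 0 \<Longrightarrow>
        0 < \<mu> (ball x (2 * r) \<inter> \<Omega>) \<and> \<mu> (ball x (2 * r) \<inter> \<Omega>) \<le> ennreal c * \<mu> (ball x r \<inter> \<Omega>)"
    using assms(6) unfolding doubling_on_def by blast
  \<comment> \<open>The doubling constant of \<Omega> is enlarged to be at least 1, as the locale
    demands.\<close>
  interpret doubling_domain ?M D \<Omega> "max c 1"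
  proof
    show "0 < emeasure ?M (ball x r \<inter> \<Omega>)" if "x \<in> closure \<Omega>" "0 < r" for x r
      using c(2)[OF that(1), of "r / 2"] that(2) by (simp add: em)
    show "emeasure ?M (ball x (2 * r) \<inter> \<Omega>) \<le> ennreal (max c 1) * emeasure ?M (ball x r \<inter> \<Omega>)"
      if "x \<in> closure \<Omega>" "0 < r" for x r
    proof -
      have "\<mu> (ball x (2 * r) \<inter> \<Omega>) \<le> ennreal c * \<mu> (ball x r \<inter> \<Omega>)" using c(2)[OF that] by simp
      also have "\<dots> \<le> ennreal (max c 1) * \<mu> (ball x r \<inter> \<Omega>)" by (intro mult_right_mono ennreal_leI) auto
      finally show ?thesis by (simp add: em)
    qed
  qed (use opn assms(5) in auto)
  show ?thesis by (rule trace_spaces_coincide[OF assms(3,4,7,8)])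
qed

end
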